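(* Let $(\xi^{(j)},j\ge1)$ be independent real-valued Lévy processes, $\xi^{(j)}$ having characteristics $(a_j,\sigma_j,\pi_j)$; let $\gamma_j>0$ for $j\ge1$, let $(m_j,j\ge1)$ be positive reals with $\sum_{j\ge1}m_j=1$, and let $x=(x_j,j\ge1)$ be a real sequence. Assume: (a) $\sum_{j}m_j|x_j|<\infty$; (b) $\sum_{j}\frac{m_j|a_j|}{\gamma_j}<\infty$ and $\sum_{j}\frac{m_j^2\sigma_j}{\gamma_j}<\infty$; (c) $\sum_{j}\frac{m_j^2}{\gamma_j}\int_{(-1,1)}z^2\pi_j(\mathrm{d}z)<\infty$ and $\sum_{j}\frac{m_j}{\gamma_j}\pi_j([-1,1]^c)<\infty$; (d) $\sum_{j}\frac1{\gamma_j}\int_{[-1,1]^c}\log|z|\,\pi_j(\mathrm{d}z)<\infty$; (e) there exists $j\ge1$ such that the laws of $I^{(\natural,j)}_t$, $t>0$, satisfy condition (H); (f) there exists $\gamma>0$ such that $\gamma_j\ge\gamma$ for all $j\ge1$; (g) with $\hat\gamma:=\inf_{k\in\mathbb{N}}\gamma_k$, the set $J:=\{j\ge1:\gamma_j=\hat\gamma\}$ is non-empty and $\sum_{j\in J}m_jx_j\ne0$. Then the family $(\chi^{(\epsilon)},\epsilon>0)$ possesses profile cut-off in total variation distance as $\epsilon\to0$, with cut-off time and window $$t_\epsilon:=\frac1{2\hat\gamma}\ln\left(\frac1\epsilon\right),\qquad w_\epsilon:=\frac1{\hat\gamma}+o(1),$$ where $o(1)$ is any function of $\epsilon$ tending to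 $0$ as $\epsilon\to0$, and with profile function $G_{x,m}:\mathbb{R}\to[0,1]$ given for every $c\in\mathbb{R}$ by $$G_{x,m}(c):=\lim_{\epsilon\to0}d^{(\epsilon,m)}(t_\epsilon+cw_\epsilon)=d_{\mathrm{TV}}\left(e^{-c}\sum_{j\in J}m_jx_j+I^{\natural,m}_\infty,\ I^{\natural,m}_\infty\right),$$ which satisfies $\lim_{c\to-\infty}G_{x,m}(c)=1$ and $\lim_{c\to\infty}G_{x,m}(c)=0$.
   Context: $d_{\mathrm{TV}}(X,Y)=\sup_{A}|\mathbb{P}(X\in A)-\mathbb{P}(Y\in A)|$ is the total variation distance between the laws of $X$ and $Y$. A real Lévy process $\xi$ (càdlàg, $\xi_0=0$, stationary independent increments) has characteristics $(a,\sigma,\pi)$, where $a\in\mathbb{R}$, $\sigma\ge0$, $\pi$ a measure on $\mathbb{R}\setminus\{0\}$ with $\int(1\wedge z^2)\pi(\mathrm{d}z)<\infty$, if $\mathbb{E}[e^{iz\xi_t}]=e^{t\psi(z)}$ with $\psi(z)=iaz-\frac12\sigma z^2+\int_{\mathbb{R}}(e^{izx}-1-izx\mathbf{1}_{\{|x|\le1\}})\pi(\mathrm{d}x)$. For $\epsilon>0$ and $j\ge1$, $X^{(\epsilon,j)}$ solves $\mathrm{d}X^{(\epsilon,j)}_t=-\gamma_jX^{(\epsilon,j)}_t\mathrm{d}t+\sqrt\epsilon\,\mathrm{d}\xi^{(j)}_t$, $X^{(\epsilon,j)}_0=x_j$, and the superposition process is $\chi^{(\epsilon)}_t:=\sum_{j=1}^\infty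 m_jX^{(\epsilon,j)}_t$. Under (a)-(d) it is well defined (for each $t$ the series of independent terms converges almost surely) and $\chi^{(\epsilon)}_t$ converges in law as $t\to\infty$ to a random variable $\chi^{(\epsilon,m)}_\infty$ not depending on $x$. Put $d^{(\epsilon,m)}(t):=d_{\mathrm{TV}}(\chi^{(\epsilon)}_t,\chi^{(\epsilon,m)}_\infty)$. $\xi^{(\natural,j)}_t:=\xi^{(j)}_t-a_jt$ (a Lévy process with characteristics $(0,\sigma_j,\pi_j)$), $I^{(\natural,j)}_t:=\int_0^te^{-\gamma_j(t-s)}\mathrm{d}\xi^{(\natural,j)}_s$, $I^{\natural,m}_t:=\sum_{j=1}^\infty m_jI^{(\natural,j)}_t$, and $I^{\natural,m}_\infty$ is a random variable distributed as the limit in law of $I^{\natural,m}_t$ as $t\to\infty$ (which exists under (b)-(d)). Condition (H) for a family of laws $(\mu_t,t>0)$ on $\mathbb{R}$ with characteristic functions $\widehat\mu_t$: for every $t>0$, $\widehat\mu_t$ is Lebesgue integrable on $\mathbb{R}$, and $\lim_{R\to\infty}\sup_{s>t_0(R)}\int_{\{|\lambda|>R\}}|\widehat\mu_s(\lambda)|\mathrm{d}\lambda=0$ for some positive function $R\mapsto t_0(R)$ with $t_0(R)\to\infty$ as $R\to\infty$. Profile cut-off at $(t_\epsilon,w_\epsilon)$ with profile $G$ means: $t_\epsilon\to\infty$ as $\epsilon\to0$, $w_\epsilon=o(t_\epsilon)$, $G(c):=\lim_{\epsilon\to0}d^{(\epsilon,m)}(t_\epsilon+cw_\epsilon)$ exists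 for all $c\in\mathbb{R}$, and $\lim_{c\to-\infty}G(c)=1$, $\lim_{c\to\infty}G(c)=0$.
   Formalization: In (c) the first integral is taken over the closed interval [-1,1] instead of (-1,1); otherwise atoms of the measures π_j at ±1 are uncontrolled and the superposition series can diverge, leaving χ undefined. *)

theory Defs
  imports "HOL-Probability.Probability" "HOL-Library.Landau_Symbols"
begin

section \<open>Distances and limits of laws on the real line\<close>

definition tv_dist :: "real measure \<Rightarrow> real measure \<Rightarrow> real" where
  "tv_dist \<mu> \<nu> = (SUP A\<in>sets borel. \<bar>measure \<mu> A - measure \<nu> A\<bar>)"

text \<open>The library's weak convergence is for sequences; the limit over real times is taken along
  all sequences of times tending to infinity.\<close>

definition converges_in_law :: "(real \<Rightarrow> real measure) \<Rightarrow> real measure \<Rightarrow> bool" where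
  "converges_in_law L \<mu> \<longleftrightarrow> real_distribution \<mu> \<and>
     (\<forall>s :: nat \<Rightarrow> real. (\<forall>n. 0 \<le> s n) \<and> filterlim s at_top sequentially \<longrightarrow>
        weak_conv_m (\<lambda>n. L (s n)) \<mu>)"

text \<open>A limit in law is unique, so this is the limit whenever one exists.\<close>

definition limit_law :: "(real \<Rightarrow> real measure) \<Rightarrow> real measure" where
  "limit_law L = (THE \<mu>. converges_in_law L \<mu>)"

section \<open>Levy processes\<close>

definition cadlag :: "(real \<Rightarrow> real) \<Rightarrow> bool" where
  "cadlag f \<longleftrightarrow> (\<forall>t\<ge>0. (f \<longlongrightarrow> f t) (at_right t)) \<and> (\<forall>t>0. \<exists>l. (f \<longlongrightarrow> l) (at_left t))"

text \<open>Processes are indexed by real numbers; only their values at times \<open>t \<ge> 0\<close> matter.\<close>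

definition levy_process :: "'a measure \<Rightarrow> (real \<Rightarrow> 'a \<Rightarrow> real) \<Rightarrow> bool" where
  "levy_process M \<xi> \<longleftrightarrow> prob_space M \<and>
     (\<forall>t\<ge>0. \<xi> t \<in> borel_measurable M) \<and>
     (AE \<omega> in M. \<xi> 0 \<omega> = 0 \<and> cadlag (\<lambda>t. \<xi> t \<omega>)) \<and>
     (\<forall>(n :: nat) (t :: nat \<Rightarrow> real). 0 \<le> t 0 \<and> (\<forall>i<n. t i \<le> t (Suc i)) \<longrightarrow>
        prob_space.indep_vars M (\<lambda>_. borel) (\<lambda>i \<omega>. \<xi> (t (Suc i)) \<omega> - \<xi> (t i) \<omega>) {..<n}) \<and>
     (\<forall>s t. 0 \<le> s \<and> s \<le> t \<longrightarrow>
        distr M borel (\<lambda>\<omega>. \<xi> t \<omega> - \<xi> s \<omega>) = distr M borel (\<xi> (t - s)))"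

text \<open>A measure on the punctured line is a Borel measure on the line without mass at 0.\<close>

definition levy_measure :: "real measure \<Rightarrow> bool" where
  "levy_measure \<pi> \<longleftrightarrow> sets \<pi> = sets borel \<and> emeasure \<pi> {0} = 0 \<and>
     (\<integral>\<^sup>+ z. ennreal (min 1 (z\<^sup>2)) \<partial>\<pi>) < \<infinity>"

text \<open>Here \<open>\<sigma>\<close> is the variance of the Gaussian part, not its standard deviation. The compensated
  region is the closed interval, so jumps of size exactly 1 count as small jumps.\<close>

definition levy_exponent :: "real \<Rightarrow> real \<Rightarrow> real measure \<Rightarrow> real \<Rightarrow> complex" where
  "levy_exponent a \<sigma> \<pi> z = \<i> * complex_of_real (a * z) - complex_of_real (\<sigma> * z\<^sup>2 / 2) +
     (CLINT x|\<pi>. iexp (z * x) - 1 - \<i> * complex_of_real (z * x * indicator {-1..1} x))"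

definition levy_process_with ::
    "'a measure \<Rightarrow> (real \<Rightarrow> 'a \<Rightarrow> real) \<Rightarrow> real \<Rightarrow> real \<Rightarrow> real measure \<Rightarrow> bool" where
  "levy_process_with M \<xi> a \<sigma> \<pi> \<longleftrightarrow> levy_process M \<xi> \<and> 0 \<le> \<sigma> \<and> levy_measure \<pi> \<and>
     (\<forall>t\<ge>0. \<forall>z. char (distr M borel (\<xi> t)) z = exp (complex_of_real t * levy_exponent a \<sigma> \<pi> z))"

text \<open>Independence of whole processes, seen as random elements of the product space.\<close>

definition indep_processes :: "'a measure \<Rightarrow> (nat \<Rightarrow> real \<Rightarrow> 'a \<Rightarrow> real) \<Rightarrow> bool" where
  "indep_processes M \<xi> \<longleftrightarrow>
     prob_space.indep_vars M (\<lambda>_. Pi\<^sub>M {0..} (\<lambda>_. borel)) (\<lambda>j \<omega>. \<lambda>t\<in>{0..}. \<xi> j t \<omega>) UNIV"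

section \<open>Ornstein-Uhlenbeck processes and Levy integrals\<close>

text \<open>The noise is additive, so the equation \<open>dX = - \<gamma> X dt + sqrt \<epsilon> d\<xi>\<close> with \<open>X 0 = x\<close> is a pathwise
  integral equation.\<close>

definition OU_solution ::
    "'a measure \<Rightarrow> (real \<Rightarrow> 'a \<Rightarrow> real) \<Rightarrow> real \<Rightarrow> real \<Rightarrow> real \<Rightarrow> (real \<Rightarrow> 'a \<Rightarrow> real) \<Rightarrow> bool" where
  "OU_solution M \<xi> \<gamma> x \<epsilon> X \<longleftrightarrow>
     (\<forall>t\<ge>0. X t \<in> borel_measurable M) \<and>
     (AE \<omega> in M. cadlag (\<lambda>t. X t \<omega>) \<and>
        (\<forall>t\<ge>0. X t \<omega> = x - \<gamma> * (LBINT s:{0..t}. X s \<omega>) + sqrt \<epsilon> * \<xi> t \<omega>))"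

text \<open>Riemann-Stieltjes integral of \<open>f\<close> with respect to \<open>g\<close> over \<open>[a, b]\<close>; it exists when \<open>f\<close> is
  continuously differentiable and \<open>g\<close> is cadlag.\<close>

definition has_RS_integral :: "(real \<Rightarrow> real) \<Rightarrow> (real \<Rightarrow> real) \<Rightarrow> real \<Rightarrow> real \<Rightarrow> real \<Rightarrow> bool" where
  "has_RS_integral f g a b I \<longleftrightarrow>
     (\<forall>e>0. \<exists>d>0. \<forall>(n :: nat) (p :: nat \<Rightarrow> real) (u :: nat \<Rightarrow> real).
        p 0 = a \<and> p n = b \<and>
        (\<forall>i<n. p i \<le> u i \<and> u i \<le> p (Suc i) \<and> p (Suc i) - p i < d) \<longrightarrow>
        \<bar>(\<Sum>i<n. f (u i) * (g (p (Suc i)) - g (p i))) - I\<bar> < e)"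

text \<open>\<open>I t\<close> is a version of the integral over \<open>[0, t]\<close> of \<open>exp (- \<gamma> (t - s))\<close> with respect to
  \<open>d\<xi>(s)\<close>.\<close>

definition levy_OU_integral ::
    "'a measure \<Rightarrow> (real \<Rightarrow> 'a \<Rightarrow> real) \<Rightarrow> real \<Rightarrow> (real \<Rightarrow> 'a \<Rightarrow> real) \<Rightarrow> bool" where
  "levy_OU_integral M \<xi> \<gamma> I \<longleftrightarrow>
     (\<forall>t\<ge>0. I t \<in> borel_measurable M \<and>
        (AE \<omega> in M. has_RS_integral (\<lambda>s. exp (- \<gamma> * (t - s))) (\<lambda>s. \<xi> s \<omega>) 0 t (I t \<omega>)))"

section \<open>Superpositions\<close>

definition superposition ::
    "(nat \<Rightarrow> real) \<Rightarrow> (nat \<Rightarrow> real \<Rightarrow> 'a \<Rightarrow> real) \<Rightarrow> real \<Rightarrow> 'a \<Rightarrow> real" where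
  "superposition m Y t \<omega> = (\<Sum>j. m j * Y j t \<omega>)"

definition superposition_law ::
    "'a measure \<Rightarrow> (nat \<Rightarrow> real) \<Rightarrow> (nat \<Rightarrow> real \<Rightarrow> 'a \<Rightarrow> real) \<Rightarrow> real \<Rightarrow> real measure" where
  "superposition_law M m Y t = distr M borel (superposition m Y t)"

definition well_posed ::
    "'a measure \<Rightarrow> (nat \<Rightarrow> real) \<Rightarrow> (nat \<Rightarrow> real \<Rightarrow> 'a \<Rightarrow> real) \<Rightarrow> bool" where
  "well_posed M m Y \<longleftrightarrow>
     (\<forall>t\<ge>0. AE \<omega> in M. summable (\<lambda>j. m j * Y j t \<omega>)) \<and>
     (\<exists>\<mu>. converges_in_law (superposition_law M m Y) \<mu>)"

definition dist_to_equilibrium ::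
    "'a measure \<Rightarrow> (nat \<Rightarrow> real) \<Rightarrow> (nat \<Rightarrow> real \<Rightarrow> 'a \<Rightarrow> real) \<Rightarrow> real \<Rightarrow> real" where
  "dist_to_equilibrium M m Y t =
     tv_dist (superposition_law M m Y t) (limit_law (superposition_law M m Y))"

definition min_rate :: "(nat \<Rightarrow> real) \<Rightarrow> real" where
  "min_rate \<gamma> = (INF k. \<gamma> k)"

definition slowest :: "(nat \<Rightarrow> real) \<Rightarrow> nat set" where
  "slowest \<gamma> = {j. \<gamma> j = min_rate \<gamma>}"

section \<open>Condition (H) and profile cut-off\<close>

definition condition_H :: "(real \<Rightarrow> real measure) \<Rightarrow> bool" where
  "condition_H \<mu> \<longleftrightarrow>
     (\<forall>t>0. integrable lborel (char (\<mu> t))) \<and>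
     (\<exists>t0 :: real \<Rightarrow> real. (\<forall>R>0. 0 < t0 R) \<and> filterlim t0 at_top at_top \<and>
        ((\<lambda>R. SUP s\<in>{t0 R<..}. \<integral>\<^sup>+l\<in>{l. R < \<bar>l\<bar>}. ennreal (cmod (char (\<mu> s) l)) \<partial>lborel)
           \<longlongrightarrow> 0) at_top)"

definition profile_cutoff ::
    "(real \<Rightarrow> real \<Rightarrow> real) \<Rightarrow> (real \<Rightarrow> real) \<Rightarrow> (real \<Rightarrow> real) \<Rightarrow> (real \<Rightarrow> real) \<Rightarrow> bool" where
  "profile_cutoff d t w G \<longleftrightarrow>
     filterlim t at_top (at_right 0) \<and>
     w \<in> o[at_right 0](t) \<and>
     (\<forall>c. ((\<lambda>\<epsilon>. d \<epsilon> (t \<epsilon> + c * w \<epsilon>)) \<longlongrightarrow> G c) (at_right 0)) \<and>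
     (G \<longlongrightarrow> 1) at_bot \<and> (G \<longlongrightarrow> 0) at_top"

end

theory Submission
  imports Defs
begin

text \<open>
  Solving the equation pathwise gives \<open>\<chi> t = D t + sqrt \<epsilon> * (A t + I t)\<close> with deterministic \<open>D\<close> and \<open>A\<close>,
  so by invariance under affine maps the distance to equilibrium is the total variation distance between
  \<open>b + I t\<close> and the limit of \<open>I\<close>, where \<open>b = D t / sqrt \<epsilon> + (A t - A \<infinity>)\<close>. In the cut-off window only
  the slowest rates contribute to \<open>b\<close>, which tends to \<open>exp (- c) * S\<close>. It remains to see that
  \<open>I t\<close> converges in total variation, even when shifted. The characteristic function of one summand bounds
  that of the superposition, so condition (H) turns pointwise convergence of the characteristic functions
  into convergence in \<open>L\<^sup>1\<close>; Fourier inversion then gives pointwise convergence of the densities, and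
  Scheffe's lemma gives total variation. Convergence of the series and of the laws rests on one estimate:
  the exponent of the \<open>j\<close>-th summand is at most \<open>(1 + z\<^sup>2) * C j\<close> uniformly in time, with \<open>C\<close> summable.
\<close>

subsection \<open>Densities by Fourier inversion\<close>

text \<open>A Levy path need not have finite variation, so \<open>X\<close> and \<open>I\<close> are
  compared through left-tagged sums over uniform grids: both are limits of the same sums. These also
  yield the characteristic function of \<open>I\<close>, since increments over a grid are
  independent and stationary. Weak convergence is too coarse for total variation. Densities are
  needed, and (H) for one summand supplies them because the other independent factors have modulus
  at most 1. The limit law is not given in advance: its characteristic function is first only a
  candidate, and continuity at 0 has to provide the tightness that makes it the transform of a
  probability measure. The logarithmic moment enters because a jump \<open>x\<close> of age
  \<open>s\<close> contributes only \<open>x * exp (- \<gamma> s)\<close>, and its effect integrated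
  over all ages is of order \<open>ln (1 + \<bar>x\<bar>) / \<gamma>\<close>. The cut-off time
  solves \<open>exp (- g * t) = sqrt \<epsilon>\<close> for the slowest rate \<open>g\<close>: the
  initial condition has then shrunk to the size of the noise, and a further delay
  \<open>c / g\<close> multiplies it by \<open>exp (- c)\<close>.\<close>

lemma set_Levy_kernel:
  fixes a b t :: real
  assumes "a \<le> b" "t \<noteq> 0"
  shows "(CLBINT x:{a..b}. iexp (- (t * x))) = (iexp (- (t * a)) - iexp (- (t * b))) / (\<i> * t)"
proof -
  let ?G = "\<lambda>x. iexp (- (t * x)) * (- 1 / (\<i> * t))"
  have "(CLBINT x:{a..b}. iexp (- (t * x))) = (CLBINT x=a..b. iexp (- (t * x)))"
    using assms by (simp add: interval_integral_Icc)
  also have "\<dots> = ?G b - ?G a"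
  proof (rule interval_integral_FTC_finite)
    show "continuous_on {min a b..max a b} (\<lambda>x. iexp (- (t * x)))"
      by (intro continuous_intros)
    fix x :: real
    have "((\<lambda>z. exp (- (\<i> * t * z)) * (- 1 / (\<i> * t))) has_field_derivative exp (- (\<i> * t * of_real x))) (at (of_real x))"
      using assms by (auto intro!: derivative_eq_intros)
    then have "((\<lambda>x. exp (- (\<i> * t * of_real x)) * (- 1 / (\<i> * t))) has_vector_derivative exp (- (\<i> * t * of_real x)))
        (at x within {min a b..max a b})"
      by (rule has_vector_derivative_real_field)
    then show "(?G has_vector_derivative iexp (- (t * x))) (at x within {min a b..max a b})"
      by (simp add: mult.assoc)
  qed
  also have "\<dots> = (iexp (- (t * a)) - iexp (- (t * b))) / (\<i> * t)"
    using assms by (simp add: field_simps)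
  finally show ?thesis .
qed

text \<open>Levy's inversion formula requires end points without mass. A law has only countably many
  atoms, so such points exist in every interval.\<close>

lemma (in real_distribution) exists_null_point:
  fixes u v :: real
  assumes "u < v"
  shows "\<exists>a\<in>{u<..<v}. measure M {a} = 0"
proof -
  have "countable {x. measure M {x} \<noteq> 0}"
    using countable_support by simp
  moreover have "uncountable {u<..<v}"
    using assms by (simp add: uncountable_open_interval)
  ultimately have "\<not> {u<..<v} \<subseteq> {x. measure M {x} \<noteq> 0}"
    using countable_subset by blast
  then show ?thesis by auto
qed

text \<open>The Fourier inversion formula. Taking the real part makes the function real-valued
  outright, without first showing that the imaginary part vanishes.\<close>

definition inversion_density :: "real measure \<Rightarrow> real \<Rightarrow> real" where
  "inversion_density M x = Re (CLBINT l. iexp (- (l * x)) * char M l) / (2 * pi)"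

context real_distribution
begin

context
  assumes int: "integrable lborel (char M)"
begin

lemma integrable_kernel: "complex_integrable lborel (\<lambda>l. iexp (- (l * x)) * char M l)"
proof (rule Bochner_Integration.integrable_bound[OF int])
  show "(\<lambda>l. iexp (- (l * x)) * char M l) \<in> borel_measurable lborel" by measurable
qed (simp add: norm_mult)

lemma continuous_inversion_density: "continuous_on UNIV (inversion_density M)"
proof -
  have "isCont (\<lambda>x. CLBINT l. iexp (- (l * x)) * char M l) x" for x
  proof (unfold continuous_at_sequentially comp_def, intro allI impI)
    fix X :: "nat \<Rightarrow> real" assume X: "X \<longlonglongrightarrow> x"
    show "(\<lambda>n. CLBINT l. iexp (- (l * X n)) * char M l) \<longlonglongrightarrow> (CLBINT l. iexp (- (l * x)) * char M l)"
      by (intro integral_dominated_convergence[where w="\<lambda>l. norm (char M l)"])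
         (auto intro!: tendsto_intros X int integrable_norm simp: norm_mult)
  qed
  then have "isCont (\<lambda>x. Re (CLBINT l. iexp (- (l * x)) * char M l) / (2 * pi)) x" for x
    by (intro continuous_intros) auto
  then show ?thesis
    unfolding inversion_density_def[abs_def] by (intro continuous_at_imp_continuous_on) auto
qed

lemma borel_measurable_inversion_density [measurable]: "inversion_density M \<in> borel_measurable borel"
  using continuous_inversion_density by (rule borel_measurable_continuous_onI)

text \<open>Integrability of the characteristic function turns the truncated integrals in Levy's
  formula into one absolutely convergent integral. Since the kernel is itself an integral of
  \<open>iexp (- (t * x))\<close> over the interval, Fubini moves the interval outside and leaves
  the density.\<close>

lemma measure_Ioc_null:
  assumes "a \<le> b" "measure M {a} = 0" "measure M {b} = 0"
  shows "measure M {a<..b} = (LBINT x:{a..b}. inversion_density M x)"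
proof -
  let ?F = "\<lambda>t. (iexp (-(t * a)) - iexp (-(t * b))) / (\<i> * t)"
  have F: "cmod (?F t) \<le> b - a" if "t \<noteq> 0" for t
    using Levy_Inversion_aux2[of "-b" "-a" t] that assms(1) by simp
  have AEF: "AE t in lborel. cmod (?F t) \<le> b - a"
    using F by (intro AE_I[of _ _ "{0}"]) auto
  \<comment> \<open>At \<open>t = 0\<close> the quotient is 0 by the convention on division, while
    the integral is \<open>b - a\<close>; hence equality only almost everywhere.\<close>
  have AEK: "AE t in lborel. ?F t = (CLBINT x:{a..b}. iexp (- (t * x)))"
    using AE_lborel_singleton[of 0]
  proof eventually_elim
    case (elim t)
    show ?case using set_Levy_kernel[OF \<open>a \<le> b\<close> elim] by (rule sym)
  qed
  have "(\<lambda>n. CLBINT t=-real n..real n. ?F t * char M t) \<longlonglongrightarrow> (CLBINT t. ?F t * char M t)"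
  proof -
    have "(\<lambda>n. CLBINT t. indicator {-real n<..<real n} t *\<^sub>R (?F t * char M t)) \<longlonglongrightarrow> (CLBINT t. ?F t * char M t)"
    proof (rule integral_dominated_convergence[where w="\<lambda>t. (b - a) * norm (char M t)"])
      show "AE t in lborel. (\<lambda>n. indicator {-real n<..<real n} t *\<^sub>R (?F t * char M t)) \<longlonglongrightarrow> ?F t * char M t"
      proof (intro AE_I2)
        fix t :: real
        have "eventually (\<lambda>n. indicator {-real n<..<real n} t *\<^sub>R (?F t * char M t) = ?F t * char M t) sequentially"
          using eventually_gt_at_top[of "nat \<lceil>\<bar>t\<bar>\<rceil>"]
        proof eventually_elim
          case (elim n)
          then have "\<bar>t\<bar> < real n" by linarith
          then show ?case by (auto simp: indicator_def abs_if split: if_splits)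
        qed
        then show "(\<lambda>n. indicator {-real n<..<real n} t *\<^sub>R (?F t * char M t)) \<longlonglongrightarrow> ?F t * char M t"
          by (rule tendsto_eventually)
      qed
      show "AE t in lborel. cmod (indicator {-real n<..<real n} t *\<^sub>R (?F t * char M t)) \<le> (b - a) * norm (char M t)" for n
        using AEF
      proof eventually_elim
        case (elim t)
        have "cmod (indicator {-real n<..<real n} t *\<^sub>R (?F t * char M t)) \<le> cmod (?F t) * cmod (char M t)"
          by (simp add: norm_mult norm_divide indicator_def)
        also have "\<dots> \<le> (b - a) * norm (char M t)"
          using elim by (rule mult_right_mono) simp
        finally show ?case .
      qed
    qed (use int in \<open>auto intro!: integrable_mult_right integrable_norm\<close>)
    then show ?thesis
      by (simp add: interval_lebesgue_integral_def set_lebesgue_integral_def einterval_eq)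
  qed
  moreover have "(\<lambda>n::nat. 1 / (2 * pi) * (CLBINT t=-real n..real n. ?F t * char M t)) \<longlonglongrightarrow> of_real (measure M {a<..b})"
    using Levy_Inversion[OF assms] by simp
  ultimately have 1: "of_real (measure M {a<..b}) = 1 / (2 * pi) * (CLBINT t. ?F t * char M t)"
    by (intro LIMSEQ_unique) (auto intro!: tendsto_intros)
  have "(CLBINT t. ?F t * char M t) = (CLBINT t. (CLBINT x:{a..b}. iexp (- (t * x))) * char M t)"
  proof (rule integral_cong_AE)
    show "AE t in lborel. ?F t * char M t = (CLBINT x:{a..b}. iexp (- (t * x))) * char M t"
      using AEK by eventually_elim (simp only:)
  qed (simp_all add: set_lebesgue_integral_def)
  also have "\<dots> = (CLBINT t. (CLBINT x. indicator {a..b} x *\<^sub>R (iexp (- (t * x)) * char M t)))"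
    by (intro Bochner_Integration.integral_cong refl)
       (simp add: set_lebesgue_integral_def flip: integral_mult_left_zero)
  also have "\<dots> = (CLBINT x. (CLBINT t. indicator {a..b} x *\<^sub>R (iexp (- (t * x)) * char M t)))"
  proof (rule lborel_pair.Fubini_integral)
    have "integrable (lborel \<Otimes>\<^sub>M lborel) (\<lambda>(x, t). indicator {a..b} x * cmod (char M t))"
    proof (rule lborel_pair.Fubini_integrable)
      show "integrable lborel (\<lambda>x. LBINT t. norm (case (x, t) of (x, t) \<Rightarrow> indicator {a..b} x * cmod (char M t)))"
        by (simp add: abs_mult emeasure_lborel_Icc_eq)
      show "AE x in lborel. integrable lborel (\<lambda>t. case (x, t) of (x, t) \<Rightarrow> indicator {a..b} x * cmod (char M t))"
        using int by simp
    qed (auto simp: split_beta')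
    then show "integrable (lborel \<Otimes>\<^sub>M lborel) (\<lambda>(x, t). indicator {a..b} x *\<^sub>R (iexp (- (t * x)) * char M t))"
      by (rule Bochner_Integration.integrable_bound) (auto simp: norm_mult split_beta')
  qed
  also have "\<dots> = (CLBINT x:{a..b}. (CLBINT t. iexp (- (t * x)) * char M t))"
    by (simp add: set_lebesgue_integral_def)
  finally have 2: "(CLBINT t. ?F t * char M t) = (CLBINT x:{a..b}. (CLBINT t. iexp (- (t * x)) * char M t))" .
  have ii: "complex_integrable lborel (\<lambda>x. indicator {a..b} x *\<^sub>R (CLBINT t. iexp (- (t * x)) * char M t))"
  proof (rule Bochner_Integration.integrable_bound)
    show "integrable lborel (\<lambda>x. indicator {a..b} x * (LBINT t. cmod (char M t)))"
      by (simp add: emeasure_lborel_Icc_eq)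
    show "AE x in lborel. cmod (indicator {a..b} x *\<^sub>R (CLBINT t. iexp (- (t * x)) * char M t))
        \<le> norm (indicator {a..b} x * (LBINT t. cmod (char M t)))"
    proof (intro AE_I2)
      fix x :: real
      have "cmod (CLBINT t. iexp (- (t * x)) * char M t) \<le> (LBINT t. cmod (char M t))"
        using integral_norm_bound[of lborel "\<lambda>t. iexp (- (t * x)) * char M t"] by (simp add: norm_mult)
      then show "cmod (indicator {a..b} x *\<^sub>R (CLBINT t. iexp (- (t * x)) * char M t))
        \<le> norm (indicator {a..b} x * (LBINT t. cmod (char M t)))"
        by (auto simp: indicator_def)
    qed
  qed measurable
  have "measure M {a<..b} = Re (1 / (2 * pi) * (CLBINT x:{a..b}. (CLBINT t. iexp (- (t * x)) * char M t)))"
    using 1 unfolding 2 by (metis Re_complex_of_real)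
  also have "\<dots> = 1 / (2 * pi) * Re (CLBINT x:{a..b}. (CLBINT t. iexp (- (t * x)) * char M t))"
    by (simp add: Re_divide_of_real)
  also have "Re (CLBINT x:{a..b}. (CLBINT t. iexp (- (t * x)) * char M t)) = (LBINT x:{a..b}. Re (CLBINT t. iexp (- (t * x)) * char M t))"
    unfolding set_lebesgue_integral_def using integral_Re[OF ii] by simp
  also have "1 / (2 * pi) * \<dots> = (LBINT x:{a..b}. inversion_density M x)"
    unfolding inversion_density_def set_lebesgue_integral_def
    by (simp flip: integral_mult_right_zero integral_divide_zero)
  finally show ?thesis .
qed

lemma inversion_density_bound: "\<bar>inversion_density M x\<bar> \<le> (LBINT t. cmod (char M t)) / (2 * pi)"
proof -
  have "\<bar>Re (CLBINT t. iexp (- (t * x)) * char M t)\<bar> \<le> cmod (CLBINT t. iexp (- (t * x)) * char M t)"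
    by (rule abs_Re_le_cmod)
  also have "\<dots> \<le> (LBINT t. cmod (char M t))"
    using integral_norm_bound[of lborel "\<lambda>t. iexp (- (t * x)) * char M t"] by (simp add: norm_mult)
  finally show ?thesis
    by (auto simp: inversion_density_def divide_right_mono)
qed

lemma set_integrable_inversion_density: "set_integrable lborel {a..b} (inversion_density M)"
  by (intro borel_integrable_atLeastAtMost') (rule continuous_on_subset[OF continuous_inversion_density], simp)

text \<open>The density is bounded, so short intervals with null end points have small mass and
  cannot contain an atom. This frees the interval formula from its condition on end points.\<close>

lemma measure_singleton_eq_0: "measure M {x} = 0"
proof (rule ccontr)
  assume "measure M {x} \<noteq> 0"
  then have pos: "0 < measure M {x}" by (simp add: less_le)
  define C where "C = (LBINT t. cmod (char M t)) / (2 * pi)"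
  have C: "0 \<le> C" "\<bar>inversion_density M y\<bar> \<le> C" for y
    using inversion_density_bound by (auto simp: C_def)
  \<comment> \<open>The interval around \<open>x\<close> will be shorter than
    \<open>2 * \<delta>\<close>, so its mass is at most \<open>2 * \<delta> * C\<close>, which is
    less than half the supposed mass of the atom; the \<open>+ 1\<close> guards against
    \<open>C = 0\<close>.\<close>
  define \<delta> where "\<delta> = measure M {x} / (4 * (C + 1))"
  have \<delta>: "0 < \<delta>" using pos C by (simp add: \<delta>_def)
  obtain a where a: "x - \<delta> < a" "a < x" "measure M {a} = 0"
    using exists_null_point[of "x - \<delta>" x] \<delta> by auto
  obtain b where b: "x < b" "b < x + \<delta>" "measure M {b} = 0"
    using exists_null_point[of x "x + \<delta>"] \<delta> by auto
  have "measure M {x} \<le> measure M {a<..b}"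
    using a b by (intro finite_measure_mono) auto
  also have "\<dots> = (LBINT y:{a..b}. inversion_density M y)"
    using a b by (intro measure_Ioc_null) auto
  also have "\<dots> \<le> (LBINT y:{a..b}. C)"
    using set_integrable_inversion_density C(2)
    by (intro set_integral_mono) (auto simp: set_integrable_def abs_le_iff emeasure_lborel_Icc_eq)
  also have "\<dots> = (b - a) * C"
    using a b by (simp add: set_lebesgue_integral_def)
  also have "\<dots> \<le> 2 * \<delta> * C"
    using a b C by (intro mult_right_mono) auto
  also have "\<dots> < measure M {x}"
    using pos C by (simp add: \<delta>_def field_simps add_pos_nonneg)
  finally show False by simp
qed

lemma measure_Ioc_eq:
  assumes "a \<le> b"
  shows "measure M {a<..b} = (LBINT x:{a..b}. inversion_density M x)"
  using assms measure_singleton_eq_0 by (intro measure_Ioc_null) auto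

text \<open>A negative value would persist on a whole interval by continuity, and that interval
  would have negative mass.\<close>

lemma inversion_density_nonneg: "0 \<le> inversion_density M x"
proof (rule ccontr)
  assume "\<not> ?thesis"
  then have neg: "inversion_density M x < 0" by simp
  define c where "c = inversion_density M x / 2"
  have c: "c < 0" "inversion_density M x < c" using neg by (auto simp: c_def)
  have "isCont (inversion_density M) x"
    using continuous_inversion_density by (simp add: continuous_on_eq_continuous_at)
  then have "eventually (\<lambda>y. inversion_density M y < c) (nhds x)"
    using c(2) by (intro order_tendstoD) (simp_all add: continuous_at tendsto_at_iff_tendsto_nhds)
  then obtain d where d: "0 < d" "\<And>y. dist y x < d \<Longrightarrow> inversion_density M y < c"
    unfolding eventually_nhds_metric by auto
  have "(LBINT y:{x..x+d/2}. inversion_density M y) \<le> (LBINT y:{x..x+d/2}. c)"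
    using set_integrable_inversion_density d
    by (intro set_integral_mono) (auto simp: set_integrable_def dist_real_def intro!: less_imp_le)
  also have "\<dots> = d / 2 * c"
    using d by (simp add: set_lebesgue_integral_def)
  also have "\<dots> < 0" using d c by (simp add: mult_pos_neg)
  finally show False
    using measure_Ioc_eq[of x "x + d / 2"] d by (simp add: not_less)
      (metis measure_nonneg not_less)
qed

lemma eq_density_inversion_density: "M = density lborel (inversion_density M)"
proof (rule measure_eqI_generator_eq[where \<Omega>=UNIV])
  show "emeasure M X = emeasure (density lborel (inversion_density M)) X"
    if X: "X \<in> range (\<lambda>(a, b). {a<..b::real})" for X
  proof -
    obtain a b where X: "X = {a<..b}" using X by auto
    show ?thesis
    proof (cases "a \<le> b")
      case True
      have "emeasure (density lborel (inversion_density M)) X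
          = (\<integral>\<^sup>+x. ennreal (indicator {a<..b} x * inversion_density M x) \<partial>lborel)"
        unfolding X by (subst emeasure_density) (auto intro!: nn_integral_cong simp: indicator_def)
      also have "\<dots> = (\<integral>\<^sup>+x. ennreal (indicator {a..b} x * inversion_density M x) \<partial>lborel)"
        using AE_lborel_singleton[of a] by (intro nn_integral_cong_AE) (auto simp: indicator_def)
      also have "\<dots> = ennreal (LBINT x:{a..b}. inversion_density M x)"
        using set_integrable_inversion_density inversion_density_nonneg
        unfolding set_lebesgue_integral_def set_integrable_def by (subst nn_integral_eq_integral) auto
      also have "\<dots> = emeasure M X"
        unfolding X emeasure_eq_measure measure_Ioc_eq[OF True] ..
      finally show ?thesis ..
    qed (simp add: X)
  qed
  show "Int_stable (range (\<lambda>(a, b). {a<..b::real}))"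
    by (auto simp: Int_stable_def)
  show "range (\<lambda>n::nat. {- real n<..real n}) \<subseteq> range (\<lambda>(a, b). {a<..b::real})" by auto
  show "(\<Union>n::nat. {- real n<..real n}) = UNIV"
    by (auto, metis leI le_less_trans less_imp_le minus_less_iff reals_Archimedean2)
qed (auto simp: borel_sigma_sets_Ioc emeasure_eq_measure)

lemma integrable_inversion_density: "integrable lborel (inversion_density M)"
  and integral_inversion_density: "(LBINT x. inversion_density M x) = 1"
proof -
  have *: "(\<integral>\<^sup>+x. ennreal (inversion_density M x) \<partial>lborel) = 1"
  proof -
    have "1 = emeasure (density lborel (inversion_density M)) UNIV"
      unfolding eq_density_inversion_density[symmetric] using emeasure_space_1 by simp
    also have "\<dots> = (\<integral>\<^sup>+x. ennreal (inversion_density M x) \<partial>lborel)"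
      by (subst emeasure_density) auto
    finally show ?thesis ..
  qed
  show 1: "integrable lborel (inversion_density M)"
    using * inversion_density_nonneg by (intro integrableI_nonneg) auto
  show "(LBINT x. inversion_density M x) = 1"
    using * inversion_density_nonneg nn_integral_eq_integral[OF 1] by simp
qed

lemma measure_eq_inversion_density:
  assumes "A \<in> sets borel"
  shows "measure M A = (LBINT x:A. inversion_density M x)"
proof -
  have "emeasure M A = (\<integral>\<^sup>+x. ennreal (indicator A x * inversion_density M x) \<partial>lborel)"
    using assms by (subst eq_density_inversion_density, subst emeasure_density)
      (auto intro!: nn_integral_cong simp: indicator_def)
  also have "\<dots> = ennreal (LBINT x:A. inversion_density M x)"
    using integrable_inversion_density inversion_density_nonneg assms
    unfolding set_lebesgue_integral_def by (subst nn_integral_eq_integral) 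
      (auto intro!: integrable_mult_indicator[where 'b=real, simplified])
  finally show ?thesis
    using inversion_density_nonneg by (auto simp: measure_def set_lebesgue_integral_def intro!: enn2real_ennreal integral_nonneg)
qed

end
end

subsection \<open>Total variation distance\<close>

text \<open>A real supremum can only be used over a bounded set, so this precedes every upper
  estimate.\<close>

lemma tv_dist_bdd:
  assumes "real_distribution \<mu>" "real_distribution \<nu>"
  shows "bdd_above ((\<lambda>A. \<bar>measure \<mu> A - measure \<nu> A\<bar>) ` sets borel)"
proof -
  interpret \<mu>: real_distribution \<mu> by fact
  interpret \<nu>: real_distribution \<nu> by fact
  have "\<bar>measure \<mu> A - measure \<nu> A\<bar> \<le> 1" for A
    using \<mu>.prob_le_1[of A] \<nu>.prob_le_1[of A] measure_nonneg[of \<mu> A] measure_nonneg[of \<nu> A] by linarith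
  then show ?thesis by (intro bdd_aboveI[of _ 1]) auto
qed

lemma tv_dist_upper:
  assumes "real_distribution \<mu>" "real_distribution \<nu>" "A \<in> sets borel"
  shows "\<bar>measure \<mu> A - measure \<nu> A\<bar> \<le> tv_dist \<mu> \<nu>"
  unfolding tv_dist_def using assms by (intro cSUP_upper tv_dist_bdd)

lemma tv_dist_least:
  assumes "\<And>A. A \<in> sets borel \<Longrightarrow> \<bar>measure \<mu> A - measure \<nu> A\<bar> \<le> c"
  shows "tv_dist \<mu> \<nu> \<le> c"
  unfolding tv_dist_def using assms by (intro cSUP_least) auto

lemma tv_dist_nonneg: "real_distribution \<mu> \<Longrightarrow> real_distribution \<nu> \<Longrightarrow> 0 \<le> tv_dist \<mu> \<nu>"
  using tv_dist_upper[of \<mu> \<nu> "{}"] by simp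

lemma tv_dist_le_1:
  assumes "real_distribution \<mu>" "real_distribution \<nu>"
  shows "tv_dist \<mu> \<nu> \<le> 1"
proof (rule tv_dist_least)
  fix A :: "real set"
  interpret \<mu>: real_distribution \<mu> by fact
  interpret \<nu>: real_distribution \<nu> by fact
  show "\<bar>measure \<mu> A - measure \<nu> A\<bar> \<le> 1"
    using \<mu>.prob_le_1[of A] \<nu>.prob_le_1[of A] measure_nonneg[of \<mu> A] measure_nonneg[of \<nu> A] by linarith
qed

lemma tv_dist_commute: "tv_dist \<mu> \<nu> = tv_dist \<nu> \<mu>"
  unfolding tv_dist_def by (simp add: abs_minus_commute)

lemma tv_dist_triangle:
  assumes "real_distribution \<mu>" "real_distribution \<nu>" "real_distribution \<rho>"
  shows "tv_dist \<mu> \<rho> \<le> tv_dist \<mu> \<nu> + tv_dist \<nu> \<rho>"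
proof (rule tv_dist_least)
  fix A :: "real set" assume "A \<in> sets borel"
  then show "\<bar>measure \<mu> A - measure \<rho> A\<bar> \<le> tv_dist \<mu> \<nu> + tv_dist \<nu> \<rho>"
    using tv_dist_upper[of \<mu> \<nu> A] tv_dist_upper[of \<nu> \<rho> A] assms by linarith
qed

text \<open>The preimage map of a bimeasurable bijection permutes the Borel sets, so both suprema
  run over the same values. This is what later removes the factor \<open>sqrt \<epsilon>\<close>
  from the distance.\<close>

lemma tv_dist_distr_inverse:
  fixes T T' :: "real \<Rightarrow> real"
  assumes [measurable]: "T \<in> borel_measurable borel" "T' \<in> borel_measurable borel"
    and inv: "\<And>y. T' (T y) = y" "\<And>y. T (T' y) = y"
    and "real_distribution \<mu>" "real_distribution \<nu>"
  shows "tv_dist (distr \<mu> borel T) (distr \<nu> borel T) = tv_dist \<mu> \<nu>"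
proof -
  interpret \<mu>: real_distribution \<mu> by fact
  interpret \<nu>: real_distribution \<nu> by fact
  have "(\<lambda>A. T -` A) ` sets borel = sets borel"
  proof safe
    fix A :: "real set" assume [measurable]: "A \<in> sets borel"
    show "T -` A \<in> sets borel" using measurable_sets[of T borel borel A] by simp
    have "A = T -` (T' -` A)" using inv by auto
    moreover have "T' -` A \<in> sets borel" using measurable_sets[of T' borel borel A] by simp
    ultimately show "A \<in> (\<lambda>A. T -` A) ` sets borel" by blast
  qed
  then have "tv_dist \<mu> \<nu> = (SUP A\<in>(\<lambda>A. T -` A) ` sets borel. \<bar>measure \<mu> A - measure \<nu> A\<bar>)"
    by (simp add: tv_dist_def)
  also have "\<dots> = tv_dist (distr \<mu> borel T) (distr \<nu> borel T)"
    unfolding tv_dist_def image_image by (intro SUP_cong refl) (simp add: measure_distr)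
  finally show ?thesis ..
qed

lemma real_distribution_distr_real:
  "real_distribution \<mu> \<Longrightarrow> T \<in> borel_measurable borel \<Longrightarrow> real_distribution (distr \<mu> borel T)"
proof -
  assume "real_distribution \<mu>" and T: "T \<in> borel_measurable borel"
  then interpret \<mu>: real_distribution \<mu> by simp
  show ?thesis using T by (intro \<mu>.real_distribution_distr) simp
qed

lemma char_distr_affine:
  assumes "real_distribution \<mu>"
  shows "char (distr \<mu> borel (\<lambda>y. b + c * y)) l = iexp (b * l) * char \<mu> (c * l)"
proof -
  interpret \<mu>: real_distribution \<mu> by fact
  have "char (distr \<mu> borel (\<lambda>y. b + c * y)) l = (CLINT y|\<mu>. iexp (l * (b + c * y)))"
    unfolding char_def by (subst integral_distr) auto
  also have "\<dots> = (CLINT y|\<mu>. iexp (b * l) * iexp (c * l * y))"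
    by (intro Bochner_Integration.integral_cong refl) (simp add: exp_add[symmetric] algebra_simps)
  finally show ?thesis by (simp add: char_def)
qed

text \<open>Closeness of the characteristic functions in L1 makes the densities uniformly close,
  which on a line of infinite length does not yet give L1 convergence of the densities. Scheffe's
  lemma closes the gap because all of them have total mass 1.\<close>

lemma tv_dist_tendsto_0:
  fixes \<mu> :: "nat \<Rightarrow> real measure"
  assumes \<mu>: "\<And>n. real_distribution (\<mu> n)" and \<nu>: "real_distribution \<nu>"
    and int: "\<And>n. integrable lborel (char (\<mu> n))" "integrable lborel (char \<nu>)"
    and lim: "(\<lambda>n. LBINT l. cmod (char (\<mu> n) l - char \<nu> l)) \<longlonglongrightarrow> 0"
  shows "(\<lambda>n. tv_dist (\<mu> n) \<nu>) \<longlonglongrightarrow> 0"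
proof -
  interpret \<mu>: real_distribution "\<mu> n" for n by fact
  interpret \<nu>: real_distribution \<nu> by fact
  let ?f = "\<lambda>n. inversion_density (\<mu> n)" and ?g = "inversion_density \<nu>"
  note [measurable] = \<mu>.borel_measurable_inversion_density[OF int(1)] \<nu>.borel_measurable_inversion_density[OF int(2)]
  note fint = \<mu>.integrable_inversion_density[OF int(1)] and gint = \<nu>.integrable_inversion_density[OF int(2)]
  have bound: "\<bar>?f n x - ?g x\<bar> \<le> (LBINT l. cmod (char (\<mu> n) l - char \<nu> l))" for n x
  proof -
    let ?D = "CLBINT l. iexp (- (l * x)) * (char (\<mu> n) l - char \<nu> l)"
    have "?f n x - ?g x = Re ?D / (2 * pi)"
      unfolding inversion_density_def right_diff_distrib
      using \<mu>.integrable_kernel[OF int(1)] \<nu>.integrable_kernel[OF int(2)]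
      by (subst Bochner_Integration.integral_diff) (auto simp: diff_divide_distrib)
    then have "\<bar>?f n x - ?g x\<bar> = \<bar>Re ?D\<bar> / (2 * pi)" by simp
    also have "\<dots> \<le> \<bar>Re ?D\<bar> / 1"
      using pi_gt3 by (intro divide_left_mono) auto
    also have "\<dots> \<le> cmod ?D" by (simp add: abs_Re_le_cmod)
    also have "\<dots> \<le> (LBINT l. cmod (char (\<mu> n) l - char \<nu> l))"
      using integral_norm_bound[of lborel "\<lambda>l. iexp (- (l * x)) * (char (\<mu> n) l - char \<nu> l)"]
      by (simp add: norm_mult)
    finally show ?thesis .
  qed
  have pt: "(\<lambda>n. ?f n x) \<longlonglongrightarrow> ?g x" for x
  proof (rule LIM_zero_cancel, rule tendsto_rabs_zero_cancel)
    show "(\<lambda>n. \<bar>?f n x - ?g x\<bar>) \<longlonglongrightarrow> 0"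
      by (rule tendsto_sandwich[OF _ _ tendsto_const lim]) (use bound in auto)
  qed
  have nn1: "(\<integral>\<^sup>+ x. norm (?f n x) \<partial>lborel) = 1" for n
    using \<mu>.inversion_density_nonneg[OF int(1)] \<mu>.integral_inversion_density[OF int(1)]
    by (subst nn_integral_eq_integral) (auto intro!: fint integrable_norm)
  have nn2: "(\<integral>\<^sup>+ x. norm (?g x) \<partial>lborel) = 1"
    using \<nu>.inversion_density_nonneg[OF int(2)] \<nu>.integral_inversion_density[OF int(2)]
    by (subst nn_integral_eq_integral) (auto intro!: gint integrable_norm)
  have "(\<lambda>n. \<integral>\<^sup>+ x. norm (?f n x - ?g x) \<partial>lborel) \<longlonglongrightarrow> 0"
    by (rule Scheffe_lemma1) (use fint gint pt nn1 nn2 in \<open>auto simp: Limsup_const\<close>)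
  also have "(\<lambda>n. \<integral>\<^sup>+ x. norm (?f n x - ?g x) \<partial>lborel) = (\<lambda>n. ennreal (LBINT x. \<bar>?f n x - ?g x\<bar>))"
    using fint gint by (intro ext, subst nn_integral_eq_integral) auto
  finally have L1: "(\<lambda>n. LBINT x. \<bar>?f n x - ?g x\<bar>) \<longlonglongrightarrow> 0"
    by (subst (asm) ennreal_0[symmetric], subst (asm) tendsto_ennreal_iff) auto
  show ?thesis
  proof (rule tendsto_sandwich[OF _ _ tendsto_const L1])
    show "\<forall>\<^sub>F n in sequentially. 0 \<le> tv_dist (\<mu> n) \<nu>"
      using tv_dist_nonneg \<mu> \<nu> by simp
    have "tv_dist (\<mu> n) \<nu> \<le> (LBINT x. \<bar>?f n x - ?g x\<bar>)" for n
    proof (rule tv_dist_least)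
      fix A :: "real set" assume A [measurable]: "A \<in> sets borel"
      have i: "integrable lborel (\<lambda>x. indicator A x * ?f n x)" "integrable lborel (\<lambda>x. indicator A x * ?g x)"
        using integrable_mult_indicator[OF _ fint, of A] integrable_mult_indicator[OF _ gint, of A] by simp_all
      have "\<bar>measure (\<mu> n) A - measure \<nu> A\<bar> = \<bar>LBINT x. indicator A x * ?f n x - indicator A x * ?g x\<bar>"
        using \<mu>.measure_eq_inversion_density[OF int(1) A] \<nu>.measure_eq_inversion_density[OF int(2) A] i
        by (simp add: set_lebesgue_integral_def Bochner_Integration.integral_diff)
      also have "\<dots> \<le> (LBINT x. \<bar>indicator A x * ?f n x - indicator A x * ?g x\<bar>)"
        by (rule integral_abs_bound)
      also have "\<dots> \<le> (LBINT x. \<bar>?f n x - ?g x\<bar>)"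
        using fint gint i by (intro integral_mono) (auto simp: indicator_def)
      finally show "\<bar>measure (\<mu> n) A - measure \<nu> A\<bar> \<le> (LBINT x. \<bar>?f n x - ?g x\<bar>)" .
    qed
    then show "\<forall>\<^sub>F n in sequentially. tv_dist (\<mu> n) \<nu> \<le> (LBINT x. \<bar>?f n x - ?g x\<bar>)" by simp
  qed
qed

text \<open>On a compact interval the difference is bounded by 2 and dominated convergence applies;
  outside it the uniform tail bound takes over. The bound is asked only eventually in
  \<open>n\<close>, since condition (H) speaks only of large times.\<close>

lemma char_L1_convergence:
  fixes \<mu> :: "nat \<Rightarrow> real measure"
  assumes \<mu>: "\<And>n. real_distribution (\<mu> n)" and \<nu>: "real_distribution \<nu>"
    and int: "\<And>n. integrable lborel (char (\<mu> n))"
    and lim: "\<And>l. (\<lambda>n. char (\<mu> n) l) \<longlonglongrightarrow> char \<nu> l"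
    and tails: "\<And>e::real. 0 < e \<Longrightarrow> \<exists>R>0. \<forall>\<^sub>F n in sequentially.
      (\<integral>\<^sup>+l\<in>{l. R < \<bar>l\<bar>}. ennreal (cmod (char (\<mu> n) l)) \<partial>lborel) \<le> ennreal e"
  shows "integrable lborel (char \<nu>)" "(\<lambda>n. LBINT l. cmod (char (\<mu> n) l - char \<nu> l)) \<longlonglongrightarrow> 0"
proof -
  interpret \<mu>: real_distribution "\<mu> n" for n by fact
  interpret \<nu>: real_distribution \<nu> by fact
  \<comment> \<open>Fatou's lemma hands the tail bound on to the limit, which gives its
    integrability as well.\<close>
  have tail_lim: "(\<integral>\<^sup>+l\<in>{l. R < \<bar>l\<bar>}. ennreal (cmod (char \<nu> l)) \<partial>lborel) \<le> ennreal e"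
    if "\<forall>\<^sub>F n in sequentially. (\<integral>\<^sup>+l\<in>{l. R < \<bar>l\<bar>}. ennreal (cmod (char (\<mu> n) l)) \<partial>lborel) \<le> ennreal e" for R e
  proof -
    have "(\<integral>\<^sup>+l\<in>{l. R < \<bar>l\<bar>}. ennreal (cmod (char \<nu> l)) \<partial>lborel)
        = (\<integral>\<^sup>+l. liminf (\<lambda>n. ennreal (cmod (char (\<mu> n) l)) * indicator {l. R < \<bar>l\<bar>} l) \<partial>lborel)"
      by (intro nn_integral_cong lim_imp_Liminf[symmetric])
         (auto simp: indicator_def intro!: tendsto_intros lim)
    also have "\<dots> \<le> liminf (\<lambda>n. \<integral>\<^sup>+l\<in>{l. R < \<bar>l\<bar>}. ennreal (cmod (char (\<mu> n) l)) \<partial>lborel)"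
      by (intro nn_integral_liminf) measurable
    also have "\<dots> \<le> ennreal e"
      using that by (intro Liminf_le) auto
    finally show ?thesis .
  qed
  show int\<nu>: "integrable lborel (char \<nu>)"
  proof -
    obtain R where R: "0 < R" "\<forall>\<^sub>F n in sequentially.
      (\<integral>\<^sup>+l\<in>{l. R < \<bar>l\<bar>}. ennreal (cmod (char (\<mu> n) l)) \<partial>lborel) \<le> ennreal 1"
      using tails[of 1] by auto
    have "(\<integral>\<^sup>+l. ennreal (cmod (char \<nu> l)) \<partial>lborel)
      \<le> (\<integral>\<^sup>+l. ennreal (cmod (char \<nu> l)) * indicator {l. R < \<bar>l\<bar>} l + indicator {-R..R} l \<partial>lborel)"
      using \<nu>.cmod_char_le_1 by (intro nn_integral_mono) (auto simp: indicator_def abs_if ennreal_le_1 split: if_splits)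
    also have "\<dots> = (\<integral>\<^sup>+l\<in>{l. R < \<bar>l\<bar>}. ennreal (cmod (char \<nu> l)) \<partial>lborel) + emeasure lborel {-R..R}"
      by (subst nn_integral_add) auto
    also have "\<dots> < \<infinity>"
      using tail_lim[OF R(2)] R(1) by (auto simp: emeasure_lborel_Icc_eq intro: le_less_trans)
    finally show ?thesis
      by (simp add: integrable_iff_bounded)
  qed
  show "(\<lambda>n. LBINT l. cmod (char (\<mu> n) l - char \<nu> l)) \<longlonglongrightarrow> 0"
  proof (rule LIMSEQ_I)
    fix e :: real assume "0 < e"
    \<comment> \<open>One quarter of \<open>e\<close> each for the compact part and for the tails of
      \<open>char (\<mu> n)\<close> and \<open>char \<nu>\<close>, so the total stays strictly below
      \<open>e\<close>.\<close>
    then obtain R where R: "0 < R" "\<forall>\<^sub>F n in sequentially.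
      (\<integral>\<^sup>+l\<in>{l. R < \<bar>l\<bar>}. ennreal (cmod (char (\<mu> n) l)) \<partial>lborel) \<le> ennreal (e/4)"
      using tails[of "e/4"] by auto
    have "(\<lambda>n. LBINT l. indicator {-R..R} l * cmod (char (\<mu> n) l - char \<nu> l)) \<longlonglongrightarrow> (LBINT l. indicator {-R..R} l * 0)"
    proof (intro integral_dominated_convergence[where w="\<lambda>l. indicator {-R..R} l * 2"] AE_I2)
      fix l
      show "(\<lambda>n. indicator {-R..R} l * cmod (char (\<mu> n) l - char \<nu> l)) \<longlonglongrightarrow> indicator {-R..R} l * 0"
        using lim[of l] by (intro tendsto_intros tendsto_norm_zero) (simp add: LIM_zero_iff)
      have "cmod (char (\<mu> n) l - char \<nu> l) \<le> 1 + 1" for n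
        by (rule norm_triangle_le_diff) (intro add_mono \<mu>.cmod_char_le_1 \<nu>.cmod_char_le_1)
      then show "norm (indicator {-R..R} l * cmod (char (\<mu> n) l - char \<nu> l)) \<le> indicator {-R..R} l * 2" for n
        by (auto simp: indicator_def)
    qed (auto simp: emeasure_lborel_Icc_eq)
    then have "\<forall>\<^sub>F n in sequentially. (LBINT l. indicator {-R..R} l * cmod (char (\<mu> n) l - char \<nu> l)) < e / 4"
      using \<open>0 < e\<close> by (intro order_tendstoD) auto
    then have "\<forall>\<^sub>F n in sequentially. (LBINT l. cmod (char (\<mu> n) l - char \<nu> l)) < e"
      using R(2)
    proof eventually_elim
      case (elim n)
      let ?T = "indicator {l. R < \<bar>l\<bar>} :: real \<Rightarrow> real"
      have tint: "integrable lborel (\<lambda>l. ?T l * cmod (char (\<mu> n) l))" "integrable lborel (\<lambda>l. ?T l * cmod (char \<nu> l))"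
        using int[of n] int\<nu> by (auto intro!: integrable_mult_indicator[where 'b=real, simplified] integrable_norm)
      have t: "(LBINT l. ?T l * cmod (char (\<mu> n) l)) \<le> e/4" "(LBINT l. ?T l * cmod (char \<nu> l)) \<le> e/4"
        using elim(2) tail_lim[OF R(2)] \<open>0 < e\<close>
          nn_integral_eq_integral[OF tint(1)] nn_integral_eq_integral[OF tint(2)]
        by (auto simp: ennreal_mult' ennreal_indicator mult.commute)
      have i: "integrable lborel (\<lambda>l. cmod (char (\<mu> n) l - char \<nu> l))"
        using int[of n] int\<nu> by auto
      have ii: "integrable lborel (\<lambda>l. indicator {-R..R} l * cmod (char (\<mu> n) l - char \<nu> l))"
        using integrable_mult_indicator[OF _ i, of "{-R..R}"] by simp
      have "(LBINT l. cmod (char (\<mu> n) l - char \<nu> l)) \<le> (LBINT l. indicator {-R..R} l * cmod (char (\<mu> n) l - char \<nu> l)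
          + (?T l * cmod (char (\<mu> n) l) + ?T l * cmod (char \<nu> l)))"
        using i ii tint by (intro integral_mono) (auto simp: indicator_def abs_if norm_triangle_ineq4 split: if_splits)
      also have "\<dots> = (LBINT l. indicator {-R..R} l * cmod (char (\<mu> n) l - char \<nu> l))
          + ((LBINT l. ?T l * cmod (char (\<mu> n) l)) + (LBINT l. ?T l * cmod (char \<nu> l)))"
        using ii tint by simp
      also have "\<dots> < e" using t elim(1) \<open>0 < e\<close> by linarith
      finally show ?case .
    qed
    moreover have "0 \<le> (LBINT l. cmod (char (\<mu> n) l - char \<nu> l))" for n by simp
    ultimately show "\<exists>no. \<forall>n\<ge>no. norm ((LBINT l. cmod (char (\<mu> n) l - char \<nu> l)) - 0) < e"
      by (simp add: eventually_sequentially)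
  qed
qed

text \<open>An interval carrying almost all of the mass of \<open>L\<close> serves as test set: a
  shift longer than the interval moves that mass off it.\<close>

lemma tv_dist_shift_at_infinity:
  assumes "real_distribution L" and b: "filterlim (\<lambda>x. \<bar>b x\<bar>) at_top F"
  shows "((\<lambda>x. tv_dist (distr L borel (\<lambda>y. b x + y)) L) \<longlongrightarrow> 1) F"
proof (rule tendstoI)
  interpret real_distribution L by fact
  fix e :: real assume "0 < e"
  have "(\<lambda>k. measure L {- real k..real k}) \<longlonglongrightarrow> measure L (\<Union>k::nat. {- real k..real k})"
    by (rule finite_Lim_measure_incseq) (auto simp: incseq_def)
  also have "(\<Union>k::nat. {- real k..real k}) = UNIV"
    by auto (metis abs_le_iff minus_le_iff real_arch_simple)
  finally have "(\<lambda>k. measure L {- real k..real k}) \<longlonglongrightarrow> 1"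
    using prob_space by simp
  then have "eventually (\<lambda>k. 1 - e / 2 < measure L {- real k..real k}) sequentially"
    using \<open>0 < e\<close> by (intro order_tendstoD) auto
  then obtain k :: nat where k: "1 - e / 2 < measure L {- real k..real k}"
    by (auto simp: eventually_sequentially)
  let ?A = "{- real k..real k}"
  \<comment> \<open>Any shift longer than \<open>2 * k\<close> makes the interval and its translate
    disjoint.\<close>
  have "eventually (\<lambda>x. 2 * real k + 1 \<le> \<bar>b x\<bar>) F"
    using b by (simp add: filterlim_at_top)
  then show "eventually (\<lambda>x. dist (tv_dist (distr L borel (\<lambda>y. b x + y)) L) 1 < e) F"
  proof eventually_elim
    case (elim x)
    let ?\<mu> = "distr L borel (\<lambda>y. b x + y)"
    have rd: "real_distribution ?\<mu>" by (intro real_distribution_distr_real assms) simp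
    have "measure ?\<mu> ?A = measure L ((\<lambda>y. b x + y) -` ?A)"
      by (subst measure_distr) auto
    also have "\<dots> \<le> measure L (UNIV - ?A)"
      using elim by (intro finite_measure_mono) (auto simp: abs_if split: if_splits)
    also have "\<dots> = 1 - measure L ?A"
      using prob_compl[of ?A] by simp
    finally have "measure ?\<mu> ?A < e / 2" using k by simp
    then have "1 - e < \<bar>measure ?\<mu> ?A - measure L ?A\<bar>"
      using k by linarith
    also have "\<dots> \<le> tv_dist ?\<mu> L"
      by (intro tv_dist_upper rd assms) simp
    finally show ?case
      using tv_dist_le_1[OF rd assms(1)] \<open>0 < e\<close> by (simp add: dist_real_def)
  qed
qed

subsection \<open>Tails and tightness from characteristic functions\<close>

text \<open>A Gaussian bump is itself the characteristic function of the standard normal law, so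
  Fubini trades its mean under \<open>\<mu>\<close> for a Gaussian average of
  \<open>1 - char \<mu>\<close>.\<close>

lemma integral_one_minus_gauss:
  assumes "real_distribution \<mu>"
  shows "(LINT y|\<mu>. 1 - exp (- (s * y)\<^sup>2 / 2)) = Re (CLINT z|std_normal_distribution. 1 - char \<mu> (s * z))"
proof -
  interpret \<mu>: real_distribution \<mu> by fact
  interpret N: real_distribution std_normal_distribution by (rule real_dist_normal_dist)
  interpret P: pair_prob_space \<mu> std_normal_distribution ..
  have bnd: "cmod (1 - iexp (s * z * y)) \<le> 2" for z y
    using norm_triangle_ineq4[of 1 "iexp (s * z * y)"] by simp
  have int: "complex_integrable (\<mu> \<Otimes>\<^sub>M std_normal_distribution) (\<lambda>(y, z). 1 - iexp (s * z * y))"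
    by (rule P.integrable_const_bound[where B=2]) (use bnd in auto)
  have "complex_of_real (LINT y|\<mu>. 1 - exp (- (s * y)\<^sup>2 / 2)) = (CLINT y|\<mu>. 1 - char std_normal_distribution (s * y))"
    by (simp add: char_std_normal_distribution flip: integral_complex_of_real)
  also have "\<dots> = (CLINT y|\<mu>. (CLINT z|std_normal_distribution. 1 - iexp (s * z * y)))"
  proof (rule Bochner_Integration.integral_cong[OF refl])
    fix y
    show "1 - char std_normal_distribution (s * y) = (CLINT z|std_normal_distribution. 1 - iexp (s * z * y))"
      using N.integrable_iexp[of "\<lambda>z. z * (s * y)"] N.prob_space
      by (subst Bochner_Integration.integral_diff) (auto simp: char_def algebra_simps)
  qed
  also have "\<dots> = (CLINT z|std_normal_distribution. (CLINT y|\<mu>. 1 - iexp (s * z * y)))"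
    using P.Fubini_integral[OF int] by simp
  also have "\<dots> = (CLINT z|std_normal_distribution. 1 - char \<mu> (s * z))"
  proof (rule Bochner_Integration.integral_cong[OF refl])
    fix z
    show "(CLINT y|\<mu>. 1 - iexp (s * z * y)) = 1 - char \<mu> (s * z)"
      using \<mu>.integrable_iexp[of "\<lambda>y. s * z * y"] \<mu>.prob_space
      by (subst Bochner_Integration.integral_diff) (auto simp: char_def algebra_simps)
  qed
  finally show ?thesis by (metis Re_complex_of_real)
qed

text \<open>Reciprocal of the least value of \<open>1 - exp (- u\<^sup>2 / 2)\<close> over
  \<open>\<bar>u\<bar> \<ge> 1\<close>; it is the factor that makes this function dominate the
  indicator of \<open>\<bar>u\<bar> \<ge> 1\<close>.\<close>

definition gauss_const :: real where "gauss_const = 1 / (1 - exp (- 1 / 2))"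

lemma gauss_const_pos: "0 < gauss_const"
  by (simp add: gauss_const_def)

text \<open>A Markov inequality with the test function
  \<open>1 - exp (- (y / c)\<^sup>2 / 2)\<close>. It serves both for tightness and for the Cauchy
  property of the random series.\<close>

lemma measure_tail_le_char:
  assumes "real_distribution \<mu>" "0 < c"
  shows "measure \<mu> {y. c \<le> \<bar>y\<bar>} \<le> gauss_const * (LINT z|std_normal_distribution. cmod (1 - char \<mu> (z / c)))"
proof -
  interpret \<mu>: real_distribution \<mu> by fact
  interpret N: real_distribution std_normal_distribution by (rule real_dist_normal_dist)
  have "measure \<mu> {y. c \<le> \<bar>y\<bar>} = (LINT y|\<mu>. indicator {y. c \<le> \<bar>y\<bar>} y)"
    by simp
  also have "\<dots> \<le> (LINT y|\<mu>. gauss_const * (1 - exp (- (1 / c * y)\<^sup>2 / 2)))"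
  proof (rule integral_mono)
    show "integrable \<mu> (\<lambda>y. gauss_const * (1 - exp (- (1 / c * y)\<^sup>2 / 2)))"
      using gauss_const_pos by (intro integrable_mult_right \<mu>.integrable_const_bound[where B=1]) auto
    show "indicator {y. c \<le> \<bar>y\<bar>} y \<le> gauss_const * (1 - exp (- (1 / c * y)\<^sup>2 / 2))" for y
    proof (cases "c \<le> \<bar>y\<bar>")
      case True
      then have "1\<^sup>2 \<le> \<bar>1 / c * y\<bar>\<^sup>2"
        using assms by (intro power_mono) (auto simp: abs_mult field_simps)
      then have "1 \<le> (1 / c * y)\<^sup>2" by (simp only: power2_abs one_power2)
      then have "exp (- (1 / c * y)\<^sup>2 / 2) \<le> exp (- 1 / 2)" by simp
      then have "gauss_const * (1 - exp (- 1 / 2)) \<le> gauss_const * (1 - exp (- (1 / c * y)\<^sup>2 / 2))"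
        using gauss_const_pos by (intro mult_left_mono) auto
      then show ?thesis using True by (simp add: gauss_const_def)
    qed (use gauss_const_pos in auto)
  qed (simp add: \<mu>.emeasure_eq_measure)
  also have "\<dots> = gauss_const * Re (CLINT z|std_normal_distribution. 1 - char \<mu> (z / c))"
    using integral_one_minus_gauss[OF assms(1), of "1 / c"] by simp
  also have "\<dots> \<le> gauss_const * (LINT z|std_normal_distribution. cmod (1 - char \<mu> (z / c)))"
    using gauss_const_pos
    by (intro mult_left_mono order_trans[OF complex_Re_le_cmod] integral_norm_bound) auto
  finally show ?thesis .
qed

text \<open>The half of Levy's continuity theorem in which the limit is not known to be a
  characteristic function. Continuity at 0 makes the Gaussian averages of
  \<open>1 - \<phi> (z / c)\<close> small for large \<open>c\<close>, which gives tightness; a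
  weakly convergent subsequence then has \<open>\<phi>\<close> as its transform.\<close>

lemma limit_distribution_exists:
  fixes \<mu> :: "nat \<Rightarrow> real measure" and \<phi> :: "real \<Rightarrow> complex"
  assumes \<mu>: "\<And>n. real_distribution (\<mu> n)"
    and lim: "\<And>z. (\<lambda>n. char (\<mu> n) z) \<longlonglongrightarrow> \<phi> z"
    and cont: "isCont \<phi> 0"
  shows "\<exists>\<nu>. real_distribution \<nu> \<and> char \<nu> = \<phi>"
proof -
  interpret \<mu>: real_distribution "\<mu> n" for n by fact
  interpret N: real_distribution std_normal_distribution by (rule real_dist_normal_dist)
  have \<phi>0: "\<phi> 0 = 1"
    using lim[of 0] \<mu>.char_zero by (simp add: LIMSEQ_const_iff)
  have [measurable]: "\<phi> \<in> borel_measurable borel"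
    using lim by (rule borel_measurable_LIMSEQ_metric[rotated]) measurable
  have \<phi>1: "cmod (\<phi> z) \<le> 1" for z
    by (rule LIMSEQ_le_const2[OF tendsto_norm[OF lim[of z]]]) (simp add: \<mu>.cmod_char_le_1)
  have b2: "cmod (1 - \<phi> z) \<le> 2" for z
    using norm_triangle_ineq4[of 1 "\<phi> z"] \<phi>1[of z] by simp
  have b2': "cmod (1 - char (\<mu> n) z) \<le> 2" for n z
    using norm_triangle_ineq4[of 1 "char (\<mu> n) z"] \<mu>.cmod_char_le_1[of n z] by simp
  \<comment> \<open>Up to the factor \<open>gauss_const\<close>, \<open>J c\<close> controls the
    mass outside \<open>{- c<..<c}\<close> for all late \<open>n\<close>. A large \<open>c\<close>
    probes \<open>\<phi>\<close> only near 0.\<close>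
  define J where "J c = (LINT z|std_normal_distribution. cmod (1 - \<phi> (z / c)))" for c :: real
  have Jn: "(\<lambda>n. LINT z|std_normal_distribution. cmod (1 - char (\<mu> n) (z / c))) \<longlonglongrightarrow> J c" for c
    unfolding J_def
    by (rule integral_dominated_convergence[where w="\<lambda>_. 2"]) (auto intro!: tendsto_intros lim b2')
  have "(\<lambda>k. J (real k)) \<longlonglongrightarrow> (LINT z|std_normal_distribution. 0)"
    unfolding J_def
  proof (rule integral_dominated_convergence[where w="\<lambda>_. 2"])
    have "(\<lambda>k. cmod (1 - \<phi> (z / real k))) \<longlonglongrightarrow> cmod (1 - \<phi> 0)" for z
      by (intro tendsto_intros isCont_tendsto_compose[OF cont]
          tendsto_divide_0[OF tendsto_const] filterlim_compose[OF filterlim_at_top_imp_at_infinity filterlim_real_sequentially] filterlim_real_sequentially)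
    then show "AE z in std_normal_distribution. (\<lambda>k. cmod (1 - \<phi> (z / real k))) \<longlonglongrightarrow> 0"
      by (simp add: \<phi>0)
  qed (auto simp: b2)
  then have J0: "(\<lambda>k. J (real k)) \<longlonglongrightarrow> 0" by simp
  have "tight \<mu>"
    unfolding tight_def
  proof (intro conjI allI impI \<mu>)
    fix e :: real assume e: "0 < e"
    define e' where "e' = e / gauss_const"
    have e': "0 < e'" using e gauss_const_pos by (simp add: e'_def)
    have "\<forall>\<^sub>F k in sequentially. J (real k) < e' \<and> 0 < k"
      using order_tendstoD(2)[OF J0 e'] eventually_gt_at_top[of 0] by eventually_elim simp
    then obtain k where k: "J (real k) < e'" "0 < k"
      by (auto simp: eventually_sequentially)
    have "\<forall>\<^sub>F n in sequentially. (LINT z|std_normal_distribution. cmod (1 - char (\<mu> n) (z / real k))) < e'"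
      using Jn[of "real k"] k(1) by (rule order_tendstoD)
    then obtain n0 where n0: "\<And>n. n \<ge> n0 \<Longrightarrow> (LINT z|std_normal_distribution. cmod (1 - char (\<mu> n) (z / real k))) < e'"
      by (auto simp: eventually_sequentially)
    \<comment> \<open>This interval works only from \<open>n0\<close> on. The finitely many earlier
      laws get an interval of their own below, and the larger of the two serves all indices.\<close>
    have big: "1 - e < measure (\<mu> n) {- real k<..<real k}" if "n \<ge> n0" for n
    proof -
      have "measure (\<mu> n) {y. real k \<le> \<bar>y\<bar>} \<le> gauss_const * (LINT z|std_normal_distribution. cmod (1 - char (\<mu> n) (z / real k)))"
        using k by (intro measure_tail_le_char \<mu>) auto
      also have "\<dots> < gauss_const * e'"
        using n0[OF that] gauss_const_pos by simp
      also have "\<dots> = e" using gauss_const_pos by (simp add: e'_def)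
      finally have "measure (\<mu> n) {y. real k \<le> \<bar>y\<bar>} < e" .
      moreover have "UNIV - {y. real k \<le> \<bar>y\<bar>} = {- real k<..<real k}" by auto
      then have "measure (\<mu> n) {- real k<..<real k} = 1 - measure (\<mu> n) {y. real k \<le> \<bar>y\<bar>}"
        using \<mu>.prob_compl[of "{y. real k \<le> \<bar>y\<bar>}" n] by simp
      ultimately show ?thesis by simp
    qed
    have "\<forall>\<^sub>F K in sequentially. 1 - e < measure (\<mu> n) {- real K<..real K}" for n
    proof -
      have "(\<lambda>k. measure (\<mu> n) {- real k<..real k}) \<longlonglongrightarrow> measure (\<mu> n) (\<Union>k::nat. {- real k<..real k})"
        by (rule \<mu>.finite_Lim_measure_incseq) (auto simp: incseq_def)
      also have "(\<Union>k::nat. {- real k<..real k}) = UNIV"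
        by (auto, metis leI le_less_trans less_imp_le minus_less_iff reals_Archimedean2)
      finally show ?thesis
        using \<mu>.prob_space e by (intro order_tendstoD) auto
    qed
    then have "\<forall>\<^sub>F K in sequentially. \<forall>n\<in>{..<n0}. 1 - e < measure (\<mu> n) {- real K<..real K}"
      by (intro eventually_ball_finite) auto
    then obtain K where K: "\<And>n. n < n0 \<Longrightarrow> 1 - e < measure (\<mu> n) {- real K<..real K}"
      by (auto simp: eventually_sequentially)
    let ?K = "max (real K) (real k)"
    have "1 - e < measure (\<mu> n) {- ?K<..?K}" for n
    proof (cases "n < n0")
      case True
      show ?thesis by (rule less_le_trans[OF K[OF True]]) (intro \<mu>.finite_measure_mono, auto)
    next
      case False
      then show ?thesis by (intro less_le_trans[OF big[of n]]) (auto intro!: \<mu>.finite_measure_mono)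
    qed
    then show "\<exists>a b. a < b \<and> (\<forall>n. 1 - e < measure (\<mu> n) {a<..b})"
      using k by (intro exI[of _ "- ?K"] exI[of _ ?K]) auto
  qed
  then obtain r \<nu> where r: "strict_mono r" "real_distribution \<nu>" "weak_conv_m (\<mu> \<circ> id \<circ> r) \<nu>"
    using tight_imp_convergent_subsubsequence[of \<mu> id] by (auto simp: strict_mono_def)
  have "char \<nu> z = \<phi> z" for z
  proof (rule LIMSEQ_unique)
    show "(\<lambda>n. char ((\<mu> \<circ> id \<circ> r) n) z) \<longlonglongrightarrow> char \<nu> z"
      by (rule levy_continuity1) (use r \<mu> in \<open>simp_all add: comp_def\<close>)
    show "(\<lambda>n. char ((\<mu> \<circ> id \<circ> r) n) z) \<longlonglongrightarrow> \<phi> z"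
      using LIMSEQ_subseq_LIMSEQ[OF lim r(1), of z] by (simp add: comp_def)
  qed
  then show ?thesis using r(2) by blast
qed

subsection \<open>Almost sure convergence of independent series\<close>

text \<open>Ottaviani's maximal inequality. Decompose by the first index \<open>k\<close> at which
  the partial sum reaches \<open>2 * c\<close>: the remaining sum is independent of that event and
  stays below \<open>c\<close> with probability at least 1/2, in which case the full sum is still at
  least \<open>c\<close>.\<close>

lemma (in prob_space) ottaviani:
  fixes Y :: "nat \<Rightarrow> 'a \<Rightarrow> real"
  assumes indep: "indep_vars (\<lambda>_. borel) Y UNIV"
    and c: "0 < c"
    and half: "\<And>k. m \<le> k \<Longrightarrow> k \<le> n \<Longrightarrow> prob {\<omega>\<in>space M. c \<le> \<bar>\<Sum>j=k..<n. Y j \<omega>\<bar>} \<le> 1 / 2"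
  shows "prob {\<omega>\<in>space M. \<exists>k\<in>{m..n}. 2 * c \<le> \<bar>\<Sum>j=m..<k. Y j \<omega>\<bar>} \<le> 2 * prob {\<omega>\<in>space M. c \<le> \<bar>\<Sum>j=m..<n. Y j \<omega>\<bar>}"
proof -
  have [measurable]: "random_variable borel (Y j)" for j
    using indep unfolding indep_vars_def by auto
  define A where "A k = {\<omega>\<in>space M. 2 * c \<le> \<bar>\<Sum>j=m..<k. Y j \<omega>\<bar> \<and> (\<forall>i\<in>{m..<k}. \<bar>\<Sum>j=m..<i. Y j \<omega>\<bar> < 2 * c)}" for k
  define B where "B k = {\<omega>\<in>space M. \<bar>\<Sum>j=k..<n. Y j \<omega>\<bar> < c}" for k
  have [measurable]: "A k \<in> events" "B k \<in> events" for k
    unfolding A_def B_def by measurable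
  have disj: "disjoint_family_on A {m..n}"
  proof (unfold disjoint_family_on_def, intro ballI impI equals0I)
    fix k l \<omega> assume "k \<in> {m..n}" "l \<in> {m..n}" "k \<noteq> l" "\<omega> \<in> A k \<inter> A l"
    then show False
      by (cases "k < l") (force simp: A_def)+
  qed
  have union: "{\<omega>\<in>space M. \<exists>k\<in>{m..n}. 2 * c \<le> \<bar>\<Sum>j=m..<k. Y j \<omega>\<bar>} = (\<Union>k\<in>{m..n}. A k)"
  proof safe
    fix \<omega> k assume *: "\<omega> \<in> space M" "k \<in> {m..n}" "2 * c \<le> \<bar>\<Sum>j=m..<k. Y j \<omega>\<bar>"
    let ?P = "\<lambda>k. k \<in> {m..n} \<and> 2 * c \<le> \<bar>\<Sum>j=m..<k. Y j \<omega>\<bar>"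
    define l where "l = (LEAST k. ?P k)"
    have l: "?P l" unfolding l_def using * by (intro LeastI[of ?P k]) auto
    have "\<not> ?P i" if "i < l" for i using that not_less_Least unfolding l_def by blast
    then have "\<omega> \<in> A l" using l * by (auto simp: A_def not_le) (meson le_trans less_imp_le not_le)
    then show "\<omega> \<in> (\<Union>k\<in>{m..n}. A k)" using l by auto
  qed (auto simp: A_def)
  have indepAB: "prob (A k \<inter> B k) = prob (A k) * prob (B k)" if k: "k \<in> {m..n}" for k
  proof -
    have "indep_var (PiM {m..<k} (\<lambda>_. borel)) (\<lambda>\<omega>. restrict (\<lambda>i. Y i \<omega>) {m..<k})
        (PiM {k..<n} (\<lambda>_. borel)) (\<lambda>\<omega>. restrict (\<lambda>i. Y i \<omega>) {k..<n})"
      by (rule indep_var_restrict[OF indep]) auto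
    then have *: "indep_var borel (f \<circ> (\<lambda>\<omega>. restrict (\<lambda>i. Y i \<omega>) {m..<k})) borel (g \<circ> (\<lambda>\<omega>. restrict (\<lambda>i. Y i \<omega>) {k..<n}))"
      if "f \<in> borel_measurable (PiM {m..<k} (\<lambda>_. borel))" "g \<in> borel_measurable (PiM {k..<n} (\<lambda>_. borel))" for f g :: "(nat \<Rightarrow> real) \<Rightarrow> real"
      using that by (intro indep_var_compose)
    \<comment> \<open>The event \<open>A k\<close> is encoded as a function with values 0 and 1, so
      that independence of the two blocks passes to it by composition.\<close>
    let ?f = "\<lambda>y. if 2 * c \<le> \<bar>\<Sum>j=m..<k. y j\<bar> \<and> (\<forall>i\<in>{m..<k}. \<bar>\<Sum>j=m..<i. y j\<bar> < 2 * c) then 1 else (0::real)"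
    let ?g = "\<lambda>y. \<Sum>j=k..<n. y j :: real"
    have S: "(\<lambda>y. \<Sum>j=m..<i. y j) \<in> borel_measurable (PiM {m..<k} (\<lambda>_. borel :: real measure))" if "i \<le> k" for i
      by (intro borel_measurable_sum measurable_component_singleton) (use that in auto)
    then have 1: "?f \<in> borel_measurable (PiM {m..<k} (\<lambda>_. borel))"
      by (intro measurable_If sets.sets_Collect_conj sets.sets_Collect_finite_All borel_measurable_le
          borel_measurable_less borel_measurable_abs borel_measurable_const S) auto
    have 2: "?g \<in> borel_measurable (PiM {k..<n} (\<lambda>_. borel))"
      by (intro borel_measurable_sum measurable_component_singleton) auto
    have "prob ((?f \<circ> (\<lambda>\<omega>. restrict (\<lambda>i. Y i \<omega>) {m..<k})) -` {1} \<inter> space M \<inter> ((?g \<circ> (\<lambda>\<omega>. restrict (\<lambda>i. Y i \<omega>) {k..<n})) -` {-c<..<c} \<inter> space M))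
      = prob ((?f \<circ> (\<lambda>\<omega>. restrict (\<lambda>i. Y i \<omega>) {m..<k})) -` {1} \<inter> space M) * prob ((?g \<circ> (\<lambda>\<omega>. restrict (\<lambda>i. Y i \<omega>) {k..<n})) -` {-c<..<c} \<inter> space M)"
    proof -
      have gen: "(\<lambda>x. (F x, G x)) -` (S \<times> T) \<inter> space M = F -` S \<inter> space M \<inter> (G -` T \<inter> space M)"
        for F G :: "'a \<Rightarrow> real" and S T by auto
      have "{1::real} \<in> sets borel" "{-c<..<c} \<in> sets borel" by auto
      from indep_varD[OF *[OF 1 2] this] show ?thesis unfolding gen .
    qed
    moreover have "(?f \<circ> (\<lambda>\<omega>. restrict (\<lambda>i. Y i \<omega>) {m..<k})) -` {1} \<inter> space M = A k"
      by (auto simp: A_def split: if_splits)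
    moreover have "(?g \<circ> (\<lambda>\<omega>. restrict (\<lambda>i. Y i \<omega>) {k..<n})) -` {-c<..<c} \<inter> space M = B k"
      by (auto simp: B_def abs_less_iff)
    ultimately show ?thesis by simp
  qed
  have AB: "prob (A k) / 2 \<le> prob (A k \<inter> B k)" if k: "k \<in> {m..n}" for k
  proof -
    have "prob (B k) = 1 - prob {\<omega>\<in>space M. c \<le> \<bar>\<Sum>j=k..<n. Y j \<omega>\<bar>}"
      by (subst prob_compl[symmetric]) (auto simp: B_def intro!: arg_cong[where f=prob])
    then have "1 / 2 \<le> prob (B k)" using half[of k] k by auto
    then have "prob (A k) * (1 / 2) \<le> prob (A k) * prob (B k)"
      by (intro mult_left_mono) auto
    then show ?thesis using indepAB[OF k] by simp
  qed
  have "prob {\<omega>\<in>space M. \<exists>k\<in>{m..n}. 2 * c \<le> \<bar>\<Sum>j=m..<k. Y j \<omega>\<bar>} = (\<Sum>k=m..n. prob (A k))"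
    unfolding union using disj by (intro finite_measure_finite_Union) auto
  also have "\<dots> = 2 * (\<Sum>k=m..n. prob (A k) / 2)"
    by (simp flip: sum_divide_distrib)
  also have "\<dots> \<le> 2 * (\<Sum>k=m..n. prob (A k \<inter> B k))"
    by (intro mult_left_mono sum_mono AB) auto
  also have "(\<Sum>k=m..n. prob (A k \<inter> B k)) = prob (\<Union>k\<in>{m..n}. A k \<inter> B k)"
    using disj by (intro finite_measure_finite_Union[symmetric]) (auto simp: disjoint_family_on_def)
  also have "\<dots> \<le> prob {\<omega>\<in>space M. c \<le> \<bar>\<Sum>j=m..<n. Y j \<omega>\<bar>}"
  proof (intro finite_measure_mono subsetI)
    fix \<omega> assume "\<omega> \<in> (\<Union>k\<in>{m..n}. A k \<inter> B k)"
    then obtain k where k: "k \<in> {m..n}" "\<omega> \<in> A k" "\<omega> \<in> B k" by auto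
    have "(\<Sum>j=m..<n. Y j \<omega>) = (\<Sum>j=m..<k. Y j \<omega>) + (\<Sum>j=k..<n. Y j \<omega>)"
      using k(1) by (simp add: sum.atLeastLessThan_concat)
    then show "\<omega> \<in> {\<omega>\<in>space M. c \<le> \<bar>\<Sum>j=m..<n. Y j \<omega>\<bar>}"
      using k by (auto simp: A_def B_def)
  qed measurable
  finally show ?thesis by simp
qed

text \<open>For independent terms a Cauchy property in probability already gives almost sure
  convergence: the maximal inequality controls all later partial sums at once.\<close>

lemma (in prob_space) indep_series_AE_summable:
  fixes Y :: "nat \<Rightarrow> 'a \<Rightarrow> real"
  assumes indep: "indep_vars (\<lambda>_. borel) Y UNIV"
    and cauchy: "\<And>c e. 0 < c \<Longrightarrow> 0 < e \<Longrightarrow> \<exists>N. \<forall>m\<ge>N. \<forall>n\<ge>m. prob {\<omega>\<in>space M. c \<le> \<bar>\<Sum>j=m..<n. Y j \<omega>\<bar>} \<le> e"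
  shows "AE \<omega> in M. summable (\<lambda>j. Y j \<omega>)"
proof -
  have [measurable]: "random_variable borel (Y j)" for j
    using indep unfolding indep_vars_def by auto
  define D where "D c m = {\<omega>\<in>space M. \<exists>k\<ge>m. 2 * c \<le> \<bar>\<Sum>j=m..<k. Y j \<omega>\<bar>}" for c m
  have [measurable]: "D c m \<in> events" for c m
    unfolding D_def by measurable
  have small: "\<exists>m. prob (D c m) \<le> e" if c: "0 < c" and e: "0 < e" for c e
  proof -
    \<comment> \<open>The bound 1/2 is the premise of the maximal inequality, and \<open>e/2\<close>
      absorbs the factor 2 in its conclusion.\<close>
    have "0 < min (1/2) (e/2)" using e by simp
    then obtain N where N: "\<And>m n. m \<ge> N \<Longrightarrow> n \<ge> m \<Longrightarrow> prob {\<omega>\<in>space M. c \<le> \<bar>\<Sum>j=m..<n. Y j \<omega>\<bar>} \<le> min (1/2) (e/2)"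
      using cauchy[OF c] by blast
    let ?E = "\<lambda>n. {\<omega>\<in>space M. \<exists>k\<in>{N..n}. 2 * c \<le> \<bar>\<Sum>j=N..<k. Y j \<omega>\<bar>}"
    have "(\<lambda>n. prob (?E n)) \<longlonglongrightarrow> prob (\<Union>n. ?E n)"
      by (rule finite_Lim_measure_incseq) (auto simp: incseq_def)
    also have "(\<Union>n. ?E n) = D c N" unfolding D_def by auto (metis atLeastAtMost_iff order_refl)
    finally have lim: "(\<lambda>n. prob (?E n)) \<longlonglongrightarrow> prob (D c N)" .
    have "prob (D c N) \<le> e"
    proof (rule LIMSEQ_le_const2[OF lim], intro exI allI impI)
      fix n assume n: "N \<le> n"
      have "prob (?E n) \<le> 2 * prob {\<omega>\<in>space M. c \<le> \<bar>\<Sum>j=N..<n. Y j \<omega>\<bar>}"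
        using N by (intro ottaviani indep c) auto
      also have "\<dots> \<le> e" using N[OF _ n] by simp
      finally show "prob (?E n) \<le> e" .
    qed
    then show ?thesis ..
  qed
  have "AE \<omega> in M. \<exists>m. \<omega> \<notin> D c m" if "0 < c" for c
  proof -
    have "prob (\<Inter>m. D c m) \<le> 0 + e" if "0 < e" for e
    proof -
      obtain m where "prob (D c m) \<le> e" using small[OF \<open>0 < c\<close> \<open>0 < e\<close>] by auto
      moreover have "prob (\<Inter>m. D c m) \<le> prob (D c m)" by (intro finite_measure_mono) auto
      ultimately show ?thesis by simp
    qed
    then have "prob (\<Inter>m. D c m) \<le> 0" by (rule field_le_epsilon)
    then have "prob (\<Inter>m. D c m) = 0" by (simp add: measure_le_0_iff)
    then show ?thesis
      by (intro AE_I[of _ _ "\<Inter>m. D c m"]) (auto simp: emeasure_eq_measure)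
  qed
  then have "AE \<omega> in M. \<forall>i::nat. \<exists>m. \<omega> \<notin> D (1 / real (Suc i)) m"
    by (subst AE_all_countable) simp
  then show ?thesis
    using AE_space
  proof eventually_elim
    case (elim \<omega>)
    show ?case
      unfolding summable_Cauchy
    proof (intro allI impI)
      fix e :: real assume "0 < e"
      \<comment> \<open>Sums starting at \<open>m\<close> will stay below
        \<open>2 / (i + 1) < e / 2\<close>, and any later block is a difference of two of
        them.\<close>
      then obtain i :: nat where i: "inverse (real (Suc i)) < e / 4"
        using reals_Archimedean[of "e/4"] by auto
      obtain m where m: "\<omega> \<notin> D (1 / real (Suc i)) m" using elim by blast
      have b: "\<bar>\<Sum>j=m..<k. Y j \<omega>\<bar> < e / 2" if "m \<le> k" for k
      proof -
        have "\<not> 2 * (1 / real (Suc i)) \<le> \<bar>\<Sum>j=m..<k. Y j \<omega>\<bar>"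
          using m elim(2) that unfolding D_def by blast
        then show ?thesis using i by (simp add: inverse_eq_divide del: of_nat_Suc)
      qed
      have "norm (\<Sum>j=k..<l. Y j \<omega>) < e" if k: "m \<le> k" for k l
      proof (cases "k \<le> l")
        case True
        have "(\<Sum>j=k..<l. Y j \<omega>) = (\<Sum>j=m..<l. Y j \<omega>) - (\<Sum>j=m..<k. Y j \<omega>)"
          using k True by (simp add: sum_diff_nat_ivl)
        then show ?thesis using b[of k] b[of l] k True by simp
      qed (use \<open>0 < e\<close> in simp)
      then show "\<exists>N. \<forall>m\<ge>N. \<forall>n. norm (\<Sum>j=m..<n. Y j \<omega>) < e" by blast
    qed
  qed
qed

subsection \<open>Left-tagged Riemann--Stieltjes sums along uniform partitions\<close>

definition grid :: "real \<Rightarrow> nat \<Rightarrow> nat \<Rightarrow> real" where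
  "grid t n i = t * real i / real n"

text \<open>The sum sees \<open>g\<close> only at grid points. It is therefore measurable in the
  path and, on a Levy path, a combination of independent stationary increments.\<close>

definition OU_sum :: "real \<Rightarrow> real \<Rightarrow> nat \<Rightarrow> (real \<Rightarrow> real) \<Rightarrow> real" where
  "OU_sum \<gamma> t n g = (\<Sum>i<n. exp (- \<gamma> * (t - grid t n i)) * (g (grid t n (Suc i)) - g (grid t n i)))"

lemma grid_0 [simp]: "grid t n 0 = 0" by (simp add: grid_def)
lemma grid_n [simp]: "0 < n \<Longrightarrow> grid t n n = t" by (simp add: grid_def)
lemma grid_mono: "0 \<le> t \<Longrightarrow> i \<le> j \<Longrightarrow> grid t n i \<le> grid t n j"
  by (auto simp: grid_def intro!: divide_right_mono mult_left_mono)
lemma grid_nonneg: "0 \<le> t \<Longrightarrow> 0 \<le> grid t n i" by (simp add: grid_def)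
lemma grid_le: "0 \<le> t \<Longrightarrow> i \<le> n \<Longrightarrow> grid t n i \<le> t"
  using grid_mono[of t i n n] by (cases "n = 0") (auto simp: grid_def)
lemma grid_Suc: "grid t n (Suc i) - grid t n i = t / real n"
  by (cases "n = 0") (simp_all add: grid_def field_simps)

lemma OU_sum_tendsto:
  assumes "has_RS_integral (\<lambda>s. exp (- \<gamma> * (t - s))) g 0 t I" "0 \<le> t"
  shows "(\<lambda>n. OU_sum \<gamma> t n g) \<longlonglongrightarrow> I"
proof (rule LIMSEQ_I)
  fix e :: real assume "0 < e"
  then obtain d where d: "0 < d" "\<And>n p u. p 0 = 0 \<and> p n = t \<and>
        (\<forall>i<n. p i \<le> u i \<and> u i \<le> p (Suc i) \<and> p (Suc i) - p i < d) \<Longrightarrow>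
        \<bar>(\<Sum>i<n. exp (- \<gamma> * (t - u i)) * (g (p (Suc i)) - g (p i))) - I\<bar> < e"
    using assms(1) unfolding has_RS_integral_def by (elim allE[of _ e] impE exE conjE) blast+
  have "\<forall>\<^sub>F n in sequentially. t / real n < d"
    using d(1) by real_asymp
  then have "\<forall>\<^sub>F n in sequentially. norm (OU_sum \<gamma> t n g - I) < e"
    using eventually_gt_at_top[of 0]
  proof eventually_elim
    case (elim n)
    then show ?case
      unfolding OU_sum_def real_norm_def using assms(2)
      by (intro d(2)) (auto simp: grid_Suc intro!: grid_mono)
  qed
  then show "\<exists>no. \<forall>n\<ge>no. norm (OU_sum \<gamma> t n g - I) < e"
    by (simp add: eventually_sequentially)
qed

lemma LBINT_Icc_same: "(LBINT s:{a..a::real}. h s) = (0 :: 'b :: {banach, second_countable_topology})"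
  using interval_integral_Icc[of a a h] by simp

lemma LBINT_grid_sum:
  fixes h :: "real \<Rightarrow> 'b :: {banach, second_countable_topology}"
  assumes "0 \<le> t" "0 < n" "set_integrable lborel {0..t} h"
  shows "(LBINT s:{0..t}. h s) = (\<Sum>i<n. LBINT s:{grid t n i<..grid t n (Suc i)}. h s)"
proof -
  have "k \<le> n \<Longrightarrow> (LBINT s:{0<..grid t n k}. h s) = (\<Sum>i<k. LBINT s:{grid t n i<..grid t n (Suc i)}. h s)" for k
  proof (induction k)
    case (Suc k)
    have "{0<..grid t n (Suc k)} = {0<..grid t n k} \<union> {grid t n k<..grid t n (Suc k)}"
      using assms grid_mono[of t k "Suc k" n] grid_nonneg[of t n k] by auto
    then have "(LBINT s:{0<..grid t n (Suc k)}. h s) = (LBINT s:{0<..grid t n k}. h s) + (LBINT s:{grid t n k<..grid t n (Suc k)}. h s)"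
      using Suc.prems assms grid_le[of t "Suc k" n] grid_le[of t k n] grid_nonneg[of t n k]
      by (simp only:) (intro set_integral_Un set_integrable_subset[OF assms(3)], auto)
    then show ?case using Suc by simp
  qed (simp add: set_lebesgue_integral_def)
  from this[of n] have "(LBINT s:{0<..t}. h s) = (\<Sum>i<n. LBINT s:{grid t n i<..grid t n (Suc i)}. h s)"
    using assms by simp
  moreover have "(LBINT s:{0..t}. h s) = (LBINT s:{0<..t}. h s)"
    using interval_integral_Icc[of 0 t h] interval_integral_Ioc[of 0 t h] assms by simp
  ultimately show ?thesis by simp
qed

text \<open>The ceiling makes \<open>left_pt\<close> and \<open>right_pt\<close> constant on each
  cell, open on the left and closed on the right, with the end points of the cell as values. Riemann
  sums become integrals of step functions, open to dominated convergence.\<close>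

definition left_pt :: "real \<Rightarrow> nat \<Rightarrow> real \<Rightarrow> real" where
  "left_pt t n s = t * (of_int \<lceil>s * real n / t\<rceil> - 1) / real n"

definition right_pt :: "real \<Rightarrow> nat \<Rightarrow> real \<Rightarrow> real" where
  "right_pt t n s = t * of_int \<lceil>s * real n / t\<rceil> / real n"

lemma grid_pts:
  assumes "0 < t" "0 < n" "s \<in> {grid t n i<..grid t n (Suc i)}"
  shows "left_pt t n s = grid t n i" "right_pt t n s = grid t n (Suc i)"
proof -
  have "\<lceil>s * real n / t\<rceil> = int (Suc i)"
    using assms by (intro ceiling_unique) (auto simp: grid_def field_simps)
  then show "left_pt t n s = grid t n i" "right_pt t n s = grid t n (Suc i)"
    by (simp_all add: left_pt_def right_pt_def grid_def)
qed

lemma right_pt_bounds: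
  assumes "0 < t" "0 < n"
  shows "s \<le> right_pt t n s" "right_pt t n s < s + t / real n"
    "left_pt t n s < s" "s - t / real n \<le> left_pt t n s"
proof -
  define q where "q = real_of_int \<lceil>s * real n / t\<rceil>"
  have "s * real n / t \<le> q" "q < s * real n / t + 1"
    unfolding q_def by linarith+
  then have "s * real n \<le> t * q" "t * q < s * real n + t"
    using assms by (simp_all add: field_simps)
  then show "s \<le> right_pt t n s" "right_pt t n s < s + t / real n"
    "left_pt t n s < s" "s - t / real n \<le> left_pt t n s"
    unfolding right_pt_def left_pt_def q_def[symmetric] using assms
    by (simp_all add: add_divide_eq_iff diff_divide_eq_iff pos_le_divide_eq pos_divide_less_eq divide_strict_right_mono
        divide_right_mono right_diff_distrib)
qed

lemma right_pt_le:
  assumes "0 < t" "0 < n" "s \<le> t" shows "right_pt t n s \<le> t"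
proof -
  have "s * real n / t \<le> real n" using assms by (simp add: field_simps)
  then have "\<lceil>s * real n / t\<rceil> \<le> int n" by (simp add: ceiling_le_iff)
  then have "of_int \<lceil>s * real n / t\<rceil> \<le> real n" by linarith
  then show ?thesis using assms by (simp add: right_pt_def field_simps)
qed

lemma left_pt_tendsto: "0 < t \<Longrightarrow> (\<lambda>n. left_pt t n s) \<longlonglongrightarrow> s"
proof -
  assume t: "0 < t"
  show ?thesis
  proof (rule tendsto_sandwich)
    show "\<forall>\<^sub>F n in sequentially. s - t / real n \<le> left_pt t n s"
      using eventually_gt_at_top[of 0] by eventually_elim (use right_pt_bounds t in auto)
    show "\<forall>\<^sub>F n in sequentially. left_pt t n s \<le> s"
      using eventually_gt_at_top[of 0] by eventually_elim (use right_pt_bounds t in \<open>auto intro: less_imp_le\<close>)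
    show "(\<lambda>n. s - t / real n) \<longlonglongrightarrow> s" by real_asymp
  qed simp
qed

lemma right_pt_tendsto: "0 < t \<Longrightarrow> (\<lambda>n. right_pt t n s) \<longlonglongrightarrow> s"
proof -
  assume t: "0 < t"
  show ?thesis
  proof (rule tendsto_sandwich)
    show "\<forall>\<^sub>F n in sequentially. right_pt t n s \<le> s + t / real n"
      using eventually_gt_at_top[of 0] by eventually_elim (use right_pt_bounds t in \<open>auto intro: less_imp_le\<close>)
    show "\<forall>\<^sub>F n in sequentially. s \<le> right_pt t n s"
      using eventually_gt_at_top[of 0] by eventually_elim (use right_pt_bounds t in auto)
    show "(\<lambda>n. s + t / real n) \<longlonglongrightarrow> s" by real_asymp
  qed simp
qed

lemma measurable_pts [measurable]: "left_pt t n \<in> borel_measurable borel" "right_pt t n \<in> borel_measurable borel"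
  unfolding left_pt_def[abs_def] right_pt_def[abs_def] by measurable

text \<open>The sum is the integral of \<open>h\<close> composed with \<open>left_pt\<close>, so
  dominated convergence gives the limit, also for complex-valued \<open>h\<close>.\<close>

lemma Riemann_sum_tendsto:
  fixes h :: "real \<Rightarrow> 'b :: {banach, second_countable_topology}"
  assumes "0 \<le> t" and h: "continuous_on UNIV h"
  shows "(\<lambda>n. \<Sum>i<n. (t / real n) *\<^sub>R h (grid t n i)) \<longlonglongrightarrow> (LBINT s:{0..t}. h s)"
proof (cases "t = 0")
  case True
  have "(LBINT s:{0..t}. h s) = 0"
    using True LBINT_Icc_same[of 0 h] by simp
  then show ?thesis using True by simp
next
  case False
  with assms have t: "0 < t" by simp
  have [measurable]: "h \<in> borel_measurable borel" using h by (rule borel_measurable_continuous_onI)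
  have "compact (h ` {-t..t})"
    by (intro compact_continuous_image continuous_on_subset[OF h]) auto
  then obtain B where B: "\<And>s. s \<in> {-t..t} \<Longrightarrow> norm (h s) \<le> B"
    by (meson bounded_iff compact_imp_bounded imageI)
  have bnd: "norm (h (left_pt t n s)) \<le> B" if "0 < n" "s \<in> {0..t}" for n s
  proof (rule B)
    have "t / real n \<le> t" using that t by (simp add: field_simps)
    then show "left_pt t n s \<in> {-t..t}"
      using right_pt_bounds[OF t that(1), of s] that by auto
  qed
  have "(\<lambda>n. LBINT s:{0..t}. h (left_pt t (Suc n) s)) \<longlonglongrightarrow> (LBINT s:{0..t}. h s)"
    unfolding set_lebesgue_integral_def
  proof (rule integral_dominated_convergence[where w="\<lambda>s. indicator {0..t} s * B"])
    show "AE s in lborel. (\<lambda>n. indicator {0..t} s *\<^sub>R h (left_pt t (Suc n) s)) \<longlonglongrightarrow> indicator {0..t} s *\<^sub>R h s"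
      using h by (intro AE_I2 tendsto_intros isCont_tendsto_compose[of _ h] LIMSEQ_Suc left_pt_tendsto t)
        (auto simp: continuous_on_eq_continuous_at)
    show "AE s in lborel. norm (indicator {0..t} s *\<^sub>R h (left_pt t (Suc n) s)) \<le> indicator {0..t} s * B" for n
      using bnd[of "Suc n"] by (auto simp: indicator_def)
  qed (auto simp: emeasure_lborel_Icc_eq)
  moreover have "(LBINT s:{0..t}. h (left_pt t n s)) = (\<Sum>i<n. (t / real n) *\<^sub>R h (grid t n i))" if n: "0 < n" for n
  proof -
    have "set_integrable lborel {0..t} (\<lambda>s. h (left_pt t n s))"
      unfolding set_integrable_def
      by (rule integrableI_bounded_set_indicator[where B=B]) (use bnd n in \<open>auto simp: emeasure_lborel_Icc_eq\<close>)
    then have "(LBINT s:{0..t}. h (left_pt t n s)) = (\<Sum>i<n. LBINT s:{grid t n i<..grid t n (Suc i)}. h (left_pt t n s))"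
      using n t by (intro LBINT_grid_sum) auto
    also have "\<dots> = (\<Sum>i<n. LBINT s:{grid t n i<..grid t n (Suc i)}. h (grid t n i))"
      by (intro sum.cong refl set_lebesgue_integral_cong) (auto simp: grid_pts[OF t n])
    also have "\<dots> = (\<Sum>i<n. (t / real n) *\<^sub>R h (grid t n i))"
      using t grid_mono[of t i "Suc i" n for i] by (intro sum.cong refl) (simp add: set_lebesgue_integral_def grid_Suc)
    finally show ?thesis .
  qed
  ultimately have "(\<lambda>n. \<Sum>i<Suc n. (t / real (Suc n)) *\<^sub>R h (grid t (Suc n) i)) \<longlonglongrightarrow> (LBINT s:{0..t}. h s)"
    by simp
  then show ?thesis by (rule LIMSEQ_imp_Suc)
qed

subsection \<open>Pathwise solution of the Ornstein--Uhlenbeck equation\<close>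

text \<open>Bisection reduces this to a local bound, which the two one-sided limits provide. The
  premise \<open>0 \<le> a\<close> discards negative times, where \<open>cadlag\<close> asserts
  nothing.\<close>

lemma cadlag_bounded:
  assumes "cadlag f" "0 \<le> t"
  shows "\<exists>B. \<forall>s\<in>{0..t}. \<bar>f s\<bar> \<le> B"
proof (rule Bolzano[of 0 t "\<lambda>a b. 0 \<le> a \<longrightarrow> (\<exists>B. \<forall>s\<in>{a..b}. \<bar>f s\<bar> \<le> B)", THEN mp])
  fix a b c :: real
  assume *: "0 \<le> a \<longrightarrow> (\<exists>B. \<forall>s\<in>{a..b}. \<bar>f s\<bar> \<le> B)" "0 \<le> b \<longrightarrow> (\<exists>B. \<forall>s\<in>{b..c}. \<bar>f s\<bar> \<le> B)" "a \<le> b" "b \<le> c"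
  show "0 \<le> a \<longrightarrow> (\<exists>B. \<forall>s\<in>{a..c}. \<bar>f s\<bar> \<le> B)"
  proof
    assume a: "0 \<le> a"
    obtain B where B: "\<forall>s\<in>{a..b}. \<bar>f s\<bar> \<le> B" using * a by auto
    obtain C where C: "\<forall>s\<in>{b..c}. \<bar>f s\<bar> \<le> C" using * a by auto
    have "\<bar>f s\<bar> \<le> max B C" if "s \<in> {a..c}" for s
      using B C that by (cases "s \<le> b") (auto simp: le_max_iff_disj)
    then show "\<exists>B. \<forall>s\<in>{a..c}. \<bar>f s\<bar> \<le> B" by blast
  qed
next
  fix x assume x: "0 \<le> x" "x \<le> t"
  have "(f \<longlongrightarrow> f x) (at_right x)" using assms(1) x by (simp add: cadlag_def)
  then have "\<forall>\<^sub>F y in at_right x. dist (f y) (f x) < 1" by (simp add: tendsto_iff)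
  then obtain d1 where d1: "x < d1" "\<And>y. x < y \<Longrightarrow> y < d1 \<Longrightarrow> dist (f y) (f x) < 1"
    unfolding eventually_at_right_field by auto
  obtain d2 l where d2: "d2 < x" "\<And>y. 0 \<le> y \<Longrightarrow> d2 < y \<Longrightarrow> y < x \<Longrightarrow> dist (f y) l < 1"
  proof (cases "0 < x")
    case True
    then obtain l where "(f \<longlongrightarrow> l) (at_left x)" using assms(1) by (auto simp: cadlag_def)
    then have "\<forall>\<^sub>F y in at_left x. dist (f y) l < 1" by (simp add: tendsto_iff)
    then obtain d2 where "d2 < x" "\<And>y. d2 < y \<Longrightarrow> y < x \<Longrightarrow> dist (f y) l < 1"
      unfolding eventually_at_left_field by auto
    then show ?thesis by (intro that) auto
  next
    case False
    then show ?thesis using x by (intro that[of "x - 1" 0]) auto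
  qed
  let ?B = "\<bar>f x\<bar> + \<bar>l\<bar> + 1"
  have bd: "\<bar>f y\<bar> \<le> ?B" if "0 \<le> y" "d2 < y" "y < d1" for y
    using d1(2)[of y] d2(2)[of y] that by (cases y x rule: linorder_cases) (auto simp: dist_real_def)
  show "\<exists>d>0. \<forall>a b. a \<le> x \<and> x \<le> b \<and> b - a < d \<longrightarrow> (0 \<le> a \<longrightarrow> (\<exists>B. \<forall>s\<in>{a..b}. \<bar>f s\<bar> \<le> B))"
  proof (rule exI[of _ "min (d1 - x) (x - d2)"], intro conjI allI impI)
    show "0 < min (d1 - x) (x - d2)" using d1 d2 by simp
    fix a b assume "a \<le> x \<and> x \<le> b \<and> b - a < min (d1 - x) (x - d2)" "0 \<le> a"
    then show "\<exists>B. \<forall>s\<in>{a..b}. \<bar>f s\<bar> \<le> B"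
      by (intro exI[of _ ?B] ballI bd) auto
  qed
qed (use assms in auto)

text \<open>The right end points approach \<open>s\<close> from above but may equal it, so
  right-continuity is first restated as continuity within \<open>{s..}\<close>.\<close>

lemma cadlag_right_pt:
  assumes "cadlag f" "0 \<le> s" "0 < t"
  shows "(\<lambda>n. f (right_pt t (Suc n) s)) \<longlonglongrightarrow> f s"
proof -
  have R: "(f \<longlongrightarrow> f s) (at_right s)" using assms by (simp add: cadlag_def)
  have "(f \<longlongrightarrow> f s) (at s within {s..})"
  proof -
    have "{s..} - {s} = {s<..} - {s}" by auto
    then show ?thesis using R unfolding at_within_def by simp
  qed
  then have "continuous (at s within {s..}) f"
    by (simp add: continuous_within)
  then show ?thesis
    by (rule continuous_within_tendsto_compose'[where S="{s..}"])
       (use right_pt_bounds(1)[OF assms(3)] right_pt_tendsto[OF assms(3), THEN LIMSEQ_Suc] in auto)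
qed

lemma LBINT_exp_Ioc:
  fixes a b \<gamma> t :: real
  assumes "a \<le> b"
  shows "(LBINT s:{a<..b}. \<gamma> * exp (- \<gamma> * (t - s))) = exp (- \<gamma> * (t - b)) - exp (- \<gamma> * (t - a))"
proof -
  have "(LBINT s:{a<..b}. \<gamma> * exp (- \<gamma> * (t - s))) = (LBINT s=a..b. \<gamma> * exp (- \<gamma> * (t - s)))"
    using assms by (simp add: interval_integral_Ioc)
  also have "\<dots> = exp (- \<gamma> * (t - b)) - exp (- \<gamma> * (t - a))"
    by (rule interval_integral_FTC_finite)
       (auto intro!: continuous_intros derivative_eq_intros simp flip: has_real_derivative_iff_has_vector_derivative)
  finally show ?thesis .
qed

text \<open>\<open>right_pt\<close> factors through an integer, so composing any path with it is
  measurable; right-continuity exhibits the path as a pointwise limit of these compositions.\<close>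

lemma cadlag_borel_measurable:
  assumes "cadlag X" "0 < t"
  shows "(\<lambda>s. indicator {0..t} s * X s) \<in> borel_measurable borel"
proof (rule borel_measurable_LIMSEQ_metric)
  show "(\<lambda>s. indicator {0..t} s * X (right_pt t (Suc n) s)) \<in> borel_measurable borel" for n
    unfolding right_pt_def
    by (intro borel_measurable_times borel_measurable_indicator
        measurable_compose[where f="\<lambda>s. \<lceil>s * real (Suc n) / t\<rceil>" and g="\<lambda>k. X (t * of_int k / real (Suc n))" and N="count_space UNIV"]) measurable
  show "(\<lambda>n. indicator {0..t} s * X (right_pt t (Suc n) s)) \<longlonglongrightarrow> indicator {0..t} s * X s" for s
    using cadlag_right_pt[OF assms(1) _ assms(2), of s]
    by (cases "s \<in> {0..t}") (auto intro!: tendsto_intros)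
qed

text \<open>With left tags, summation by parts leaves the path at right end points, where it converges to its
  value by right-continuity.\<close>

lemma OU_path_limit:
  fixes X \<xi> :: "real \<Rightarrow> real"
  assumes cad: "cadlag X" and t: "0 \<le> t" and \<gamma>: "0 \<le> \<gamma>" and \<xi>0: "\<xi> 0 = 0"
    and eq: "\<And>s. 0 \<le> s \<Longrightarrow> X s = x - \<gamma> * (LBINT u:{0..s}. X u) + c * \<xi> s"
  shows "(\<lambda>n. c * OU_sum \<gamma> t n \<xi>) \<longlonglongrightarrow> X t - exp (- \<gamma> * t) * x"
proof -
  have X0: "X 0 = x" using eq[of 0] \<xi>0 LBINT_Icc_same[of 0 X] by simp
  show ?thesis
  proof (cases "t = 0")
    case True
    then show ?thesis using X0 by (simp add: OU_sum_def grid_def)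
  next
    case False
    with t have t: "0 < t" by simp
    \<comment> \<open>Cutting the path off outside \<open>{0..t}\<close> yields a function that is
      bounded and measurable on the whole line.\<close>
    define u where "u s = indicator {0..t} s * X s" for s
    have [measurable]: "u \<in> borel_measurable borel"
      unfolding u_def[abs_def] by (rule cadlag_borel_measurable[OF cad t])
    obtain B where B: "\<forall>s\<in>{0..t}. \<bar>X s\<bar> \<le> B"
      using cadlag_bounded[OF cad, of t] t by auto
    have B0: "0 \<le> B" using B t by (meson abs_ge_zero atLeastAtMost_iff less_imp_le order_refl order_trans)
    have uB: "\<bar>u s\<bar> \<le> B" for s using B B0 by (auto simp: u_def indicator_def)
    have uint: "set_integrable lborel {a..b} u" for a b :: real
      unfolding set_integrable_def
      by (rule integrableI_bounded_set_indicator[where B=B]) (use uB in \<open>auto simp: emeasure_lborel_Icc_eq\<close>)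
    have uint': "set_integrable lborel {a<..b} u" for a b :: real
      by (rule set_integrable_subset[OF uint[of a b]]) auto
    \<comment> \<open>The density of the discretisation error. The first term is the drift of the
      equation weighted at left tags; the second comes from the variation of the weight, paired with
      the path at right end points. Both have the same limit.\<close>
    define E where "E n s = \<gamma> * exp (- \<gamma> * (t - left_pt t n s)) * u s - \<gamma> * exp (- \<gamma> * (t - s)) * u (right_pt t n s)" for n s
    have [measurable]: "E n \<in> borel_measurable borel" for n unfolding E_def[abs_def] by measurable
    have EB: "\<bar>E n s\<bar> \<le> 2 * \<gamma> * B" if "0 < n" "s \<in> {0..t}" for n s
    proof -
      have 1: "exp (- \<gamma> * (t - left_pt t n s)) \<le> 1" "exp (- \<gamma> * (t - s)) \<le> 1"
        using right_pt_bounds[OF t that(1), of s] that \<gamma> by auto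
      have "\<bar>\<gamma> * exp (- \<gamma> * (t - left_pt t n s)) * u s\<bar> \<le> \<gamma> * 1 * B"
        unfolding abs_mult using 1 uB \<gamma> by (intro mult_mono) auto
      moreover have "\<bar>\<gamma> * exp (- \<gamma> * (t - s)) * u (right_pt t n s)\<bar> \<le> \<gamma> * 1 * B"
        unfolding abs_mult using 1 uB \<gamma> by (intro mult_mono) auto
      ultimately show ?thesis unfolding E_def by linarith
    qed
    have Eint: "set_integrable lborel {0..t} (E n)" if "0 < n" for n
      unfolding set_integrable_def
      by (rule integrableI_bounded_set_indicator[where B="2 * \<gamma> * B"]) (use EB that in \<open>auto simp: emeasure_lborel_Icc_eq\<close>)
    have "(\<lambda>n. LBINT s:{0..t}. E (Suc n) s) \<longlonglongrightarrow> (LBINT s:{0..t}. 0)"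
      unfolding set_lebesgue_integral_def
    proof (rule integral_dominated_convergence[where w="\<lambda>s. indicator {0..t} s * (2 * \<gamma> * B)"])
      show "AE s in lborel. (\<lambda>n. indicator {0..t} s *\<^sub>R E (Suc n) s) \<longlonglongrightarrow> indicator {0..t} s *\<^sub>R 0"
      proof (intro AE_I2)
        fix s
        show "(\<lambda>n. indicator {0..t} s *\<^sub>R E (Suc n) s) \<longlonglongrightarrow> indicator {0..t} s *\<^sub>R 0"
        proof (cases "s \<in> {0..t}")
          case True
          have "u (right_pt t (Suc n) s) = X (right_pt t (Suc n) s)" for n
            using True right_pt_bounds(1)[OF t, of "Suc n" s] right_pt_le[OF t, of "Suc n" s] by (simp add: u_def)
          moreover have "u s = X s" using True by (simp add: u_def)
          ultimately have "(\<lambda>n. u (right_pt t (Suc n) s)) \<longlonglongrightarrow> u s"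
            using cadlag_right_pt[OF cad _ t, of s] True by simp
          moreover have "(\<lambda>n. left_pt t (Suc n) s) \<longlonglongrightarrow> s"
            by (rule LIMSEQ_Suc[OF left_pt_tendsto[OF t]])
          ultimately have "(\<lambda>n. E (Suc n) s) \<longlonglongrightarrow> \<gamma> * exp (- \<gamma> * (t - s)) * u s - \<gamma> * exp (- \<gamma> * (t - s)) * u s"
            unfolding E_def by (intro tendsto_intros)
          then show ?thesis using True by simp
        qed simp
      qed
      show "AE s in lborel. norm (indicator {0..t} s *\<^sub>R E (Suc n) s) \<le> indicator {0..t} s * (2 * \<gamma> * B)" for n
        using EB[of "Suc n"] by (auto simp: indicator_def)
    qed (auto simp: emeasure_lborel_Icc_eq)
    then have lim: "(\<lambda>n. LBINT s:{0..t}. E (Suc n) s) \<longlonglongrightarrow> 0" by simp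
    \<comment> \<open>Summation by parts in the form \<open>e i * (X (i + 1) - X i) = (e (i + 1) * X
      (i + 1) - e i * X i) - (e (i + 1) - e i) * X (i + 1)\<close>, with the increments of
      \<open>\<xi>\<close> replaced through the equation.\<close>
    have main: "c * OU_sum \<gamma> t n \<xi> = X t - exp (- \<gamma> * t) * x + (LBINT s:{0..t}. E n s)" if n: "0 < n" for n
    proof -
      let ?p = "grid t n"
      define e where "e i = exp (- \<gamma> * (t - ?p i))" for i
      have p: "0 \<le> ?p i" "?p i \<le> ?p (Suc i)" for i
        using t by (simp_all add: grid_nonneg grid_mono)
      have pn: "?p (Suc i) \<le> t" if "i < n" for i using grid_le[of t "Suc i" n] t that by simp
      have inc: "c * (\<xi> (?p (Suc i)) - \<xi> (?p i)) = X (?p (Suc i)) - X (?p i) + \<gamma> * (LBINT s:{?p i<..?p (Suc i)}. u s)"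
        if i: "i < n" for i
      proof -
        have X_u: "(LBINT s:{0..b}. X s) = (LBINT s:{0..b}. u s)" if "b \<le> t" for b
          using that unfolding u_def set_lebesgue_integral_def
          by (intro Bochner_Integration.integral_cong refl) (auto simp: indicator_def)
        have "{0..?p (Suc i)} = {0..?p i} \<union> {?p i<..?p (Suc i)}" using p[of i] by auto
        then have "(LBINT s:{0..?p (Suc i)}. u s) = (LBINT s:{0..?p i}. u s) + (LBINT s:{?p i<..?p (Suc i)}. u s)"
          by (simp only:) (intro set_integral_Un uint uint', auto)
        then show ?thesis
          using eq[OF p(1)[of i]] eq[OF p(1)[of "Suc i"]] pn[OF i] p[of i]
          by (simp add: X_u algebra_simps)
      qed
      have piece: "(LBINT s:{?p i<..?p (Suc i)}. E n s)
          = \<gamma> * e i * (LBINT s:{?p i<..?p (Suc i)}. u s) - (e (Suc i) - e i) * X (?p (Suc i))" if i: "i < n" for i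
      proof -
        have "(LBINT s:{?p i<..?p (Suc i)}. E n s)
          = (LBINT s:{?p i<..?p (Suc i)}. \<gamma> * e i * u s - \<gamma> * exp (- \<gamma> * (t - s)) * X (?p (Suc i)))"
          using pn[OF i] p[of "Suc i"]
          by (intro set_lebesgue_integral_cong) (auto simp: E_def e_def grid_pts[OF t n] u_def[of "grid _ _ _"])
        also have "\<dots> = (LBINT s:{?p i<..?p (Suc i)}. \<gamma> * e i * u s) - (LBINT s:{?p i<..?p (Suc i)}. \<gamma> * exp (- \<gamma> * (t - s)) * X (?p (Suc i)))"
        proof (rule set_integral_diff)
          show "set_integrable lborel {?p i<..?p (Suc i)} (\<lambda>s. \<gamma> * e i * u s)"
            using uint' by (intro set_integrable_mult_right) auto
          show "set_integrable lborel {?p i<..?p (Suc i)} (\<lambda>s. \<gamma> * exp (- \<gamma> * (t - s)) * X (?p (Suc i)))"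
            by (rule set_integrable_subset[where A="{?p i..?p (Suc i)}"])
               (auto intro!: borel_integrable_atLeastAtMost' continuous_intros)
        qed
        also have "\<dots> = \<gamma> * e i * (LBINT s:{?p i<..?p (Suc i)}. u s) - (e (Suc i) - e i) * X (?p (Suc i))"
          using LBINT_exp_Ioc[OF p(2)[of i], of \<gamma> t] by (simp add: e_def)
        finally show ?thesis .
      qed
      have "c * OU_sum \<gamma> t n \<xi> = (\<Sum>i<n. e i * (c * (\<xi> (?p (Suc i)) - \<xi> (?p i))))"
        by (simp add: OU_sum_def e_def sum_distrib_left mult_ac)
      also have "\<dots> = (\<Sum>i<n. (e (Suc i) * X (?p (Suc i)) - e i * X (?p i)) + (LBINT s:{?p i<..?p (Suc i)}. E n s))"
        by (intro sum.cong refl, simp only: lessThan_iff inc piece) (simp add: algebra_simps)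
      also have "\<dots> = (e n * X (?p n) - e 0 * X (?p 0)) + (\<Sum>i<n. LBINT s:{?p i<..?p (Suc i)}. E n s)"
        using sum_lessThan_telescope[of "\<lambda>i. e i * X (?p i)" n] by (simp only: sum.distrib)
      also have "(\<Sum>i<n. LBINT s:{?p i<..?p (Suc i)}. E n s) = (LBINT s:{0..t}. E n s)"
        using t n by (intro LBINT_grid_sum[symmetric] Eint) auto
      finally show ?thesis using n X0 by (simp add: e_def)
    qed
    have "(\<lambda>n. X t - exp (- \<gamma> * t) * x + (LBINT s:{0..t}. E (Suc n) s)) \<longlonglongrightarrow> X t - exp (- \<gamma> * t) * x + 0"
      by (intro tendsto_intros lim)
    then have "(\<lambda>n. c * OU_sum \<gamma> t (Suc n) \<xi>) \<longlonglongrightarrow> X t - exp (- \<gamma> * t) * x"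
      by (simp add: main)
    then show ?thesis by (rule LIMSEQ_imp_Suc)
  qed
qed

lemma OU_sum_drift:
  "OU_sum \<gamma> t n (\<lambda>s. g s + a * s) = OU_sum \<gamma> t n g + a * (\<Sum>i<n. (t / real n) *\<^sub>R exp (- \<gamma> * (t - grid t n i)))"
proof -
  have "exp (- \<gamma> * (t - grid t n i)) * (g (grid t n (Suc i)) + a * grid t n (Suc i) - (g (grid t n i) + a * grid t n i))
    = exp (- \<gamma> * (t - grid t n i)) * (g (grid t n (Suc i)) - g (grid t n i)) + a * ((t / real n) *\<^sub>R exp (- \<gamma> * (t - grid t n i)))" for i
    unfolding grid_Suc[of t n i, symmetric] by (simp add: algebra_simps)
  then show ?thesis by (simp add: OU_sum_def sum.distrib sum_distrib_left)
qed

text \<open>The solution and the Riemann-Stieltjes integral are unrelated by definition. The same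
  left-tagged sums converge to an expression in each, so uniqueness of limits gives the
  variation-of-constants formula.\<close>

lemma OU_explicit:
  fixes X \<xi> :: "real \<Rightarrow> real"
  assumes "cadlag X" and t: "0 \<le> t" and \<gamma>: "0 < \<gamma>" and "\<xi> 0 = 0"
    and "\<And>s. 0 \<le> s \<Longrightarrow> X s = x - \<gamma> * (LBINT u:{0..s}. X u) + c * \<xi> s"
    and I: "has_RS_integral (\<lambda>s. exp (- \<gamma> * (t - s))) (\<lambda>s. \<xi> s - a * s) 0 t I"
  shows "X t = exp (- \<gamma> * t) * x + c * (a * (1 - exp (- \<gamma> * t)) / \<gamma> + I)"
proof -
  have "(\<lambda>n. \<Sum>i<n. (t / real n) *\<^sub>R exp (- \<gamma> * (t - grid t n i))) \<longlonglongrightarrow> (LBINT s:{0..t}. exp (- \<gamma> * (t - s)))"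
    by (intro Riemann_sum_tendsto t continuous_intros)
  also have "(LBINT s:{0..t}. exp (- \<gamma> * (t - s))) = (1 - exp (- \<gamma> * t)) / \<gamma>"
  proof -
    have "(LBINT s:{0..t}. exp (- \<gamma> * (t - s))) = (LBINT s=0..t. exp (- \<gamma> * (t - s)))"
      using t interval_integral_Icc[of 0 t "\<lambda>s. exp (- \<gamma> * (t - s))"] by (simp add: zero_ereal_def)
    also have "\<dots> = exp (- \<gamma> * (t - t)) / \<gamma> - exp (- \<gamma> * (t - 0)) / \<gamma>"
      unfolding zero_ereal_def using \<gamma>
      by (intro interval_integral_FTC_finite)
         (auto intro!: continuous_intros derivative_eq_intros simp flip: has_real_derivative_iff_has_vector_derivative)
    finally show ?thesis by (simp add: diff_divide_distrib)
  qed
  finally have R: "(\<lambda>n. \<Sum>i<n. (t / real n) *\<^sub>R exp (- \<gamma> * (t - grid t n i))) \<longlonglongrightarrow> (1 - exp (- \<gamma> * t)) / \<gamma>" .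
  have "(\<lambda>n. c * OU_sum \<gamma> t n (\<lambda>s. (\<xi> s - a * s) + a * s)) \<longlonglongrightarrow> c * (I + a * ((1 - exp (- \<gamma> * t)) / \<gamma>))"
    unfolding OU_sum_drift by (intro tendsto_intros OU_sum_tendsto I t R)
  then have "(\<lambda>n. c * OU_sum \<gamma> t n \<xi>) \<longlonglongrightarrow> c * (I + a * ((1 - exp (- \<gamma> * t)) / \<gamma>))"
    by simp
  moreover have "(\<lambda>n. c * OU_sum \<gamma> t n \<xi>) \<longlonglongrightarrow> X t - exp (- \<gamma> * t) * x"
    using assms by (intro OU_path_limit) auto
  ultimately have "c * (I + a * ((1 - exp (- \<gamma> * t)) / \<gamma>)) = X t - exp (- \<gamma> * t) * x"
    by (rule LIMSEQ_unique)
  then show ?thesis by (simp add: algebra_simps)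
qed

subsection \<open>Bounds on Levy exponents\<close>

definition levy_integrand :: "real \<Rightarrow> real \<Rightarrow> complex" where
  "levy_integrand z x = iexp (z * x) - 1 - \<i> * complex_of_real (z * x * indicator {-1..1} x)"

lemma levy_integrand_measurable [measurable]: "levy_integrand z \<in> borel_measurable borel"
  unfolding levy_integrand_def[abs_def] by measurable

lemma levy_integrand_small:
  assumes "x \<in> {-1..1}"
  shows "cmod (levy_integrand z x) \<le> z\<^sup>2 / 2 * x\<^sup>2"
proof -
  have "cmod (iexp (z * x) - (\<Sum>k\<le>1. (\<i> * (z * x))^k / fact k)) \<le> \<bar>z * x\<bar>^Suc 1 / fact (Suc 1)"
    by (rule iexp_approx1)
  then show ?thesis
    using assms by (simp add: levy_integrand_def power_mult_distrib algebra_simps power2_eq_square)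
qed

text \<open>Here \<open>\<bar>exp (i u) - 1\<bar>\<close> is at most \<open>min 2 u\<close>, and
  \<open>min 2 u \<le> 3 * u / (1 + u)\<close> with equality at \<open>u = 2\<close>, so 3 is the
  best constant.\<close>

lemma levy_integrand_big:
  assumes "x \<notin> {-1..1}"
  shows "cmod (levy_integrand z x) \<le> 3 * \<bar>z * x\<bar> / (1 + \<bar>z * x\<bar>)" "cmod (levy_integrand z x) \<le> 2"
proof -
  have "cmod (iexp (z * x) - (\<Sum>k\<le>0. (\<i> * (z * x))^k / fact k)) \<le> \<bar>z * x\<bar>^Suc 0 / fact (Suc 0)"
    by (rule iexp_approx1)
  then have 1: "cmod (levy_integrand z x) \<le> \<bar>z * x\<bar>"
    using assms by (simp add: levy_integrand_def)
  show 2: "cmod (levy_integrand z x) \<le> 2"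
    using assms norm_triangle_ineq4[of "iexp (z * x)" 1] by (simp add: levy_integrand_def)
  show "cmod (levy_integrand z x) \<le> 3 * \<bar>z * x\<bar> / (1 + \<bar>z * x\<bar>)"
  proof (cases "\<bar>z * x\<bar> \<le> 2")
    case True
    have "\<bar>z * x\<bar> * (1 + \<bar>z * x\<bar>) \<le> \<bar>z * x\<bar> * 3"
      using True by (intro mult_left_mono) auto
    then have "\<bar>z * x\<bar> \<le> 3 * \<bar>z * x\<bar> / (1 + \<bar>z * x\<bar>)"
      by (subst pos_le_divide_eq) (auto simp: mult.commute)
    then show ?thesis using 1 by linarith
  next
    case False
    then have "2 \<le> 3 * \<bar>z * x\<bar> / (1 + \<bar>z * x\<bar>)"
      by (subst pos_le_divide_eq) auto
    then show ?thesis using 2 by linarith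
  qed
qed

lemma one_le_square: "x \<notin> {-1..1} \<Longrightarrow> 1 \<le> (x::real)\<^sup>2"
  using power_mono[of 1 "\<bar>x\<bar>" 2] by auto

lemma levy_integrand_bound: "cmod (levy_integrand z x) \<le> (z\<^sup>2 / 2 + 2) * min 1 (x\<^sup>2)"
proof (cases "x \<in> {-1..1}")
  case True
  then have "x\<^sup>2 \<le> 1" by (auto simp: abs_square_le_1)
  then have "(z\<^sup>2 / 2 + 2) * min 1 (x\<^sup>2) = z\<^sup>2 / 2 * x\<^sup>2 + 2 * x\<^sup>2"
    by (simp add: distrib_right min_absorb2)
  moreover have "0 \<le> 2 * x\<^sup>2" by simp
  ultimately show ?thesis
    using levy_integrand_small[OF True, of z] by linarith
next
  case False
  then have "1 \<le> x\<^sup>2" by (rule one_le_square)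
  show ?thesis
  proof -
    have "cmod (levy_integrand z x) \<le> 2" by (rule levy_integrand_big(2)[OF False])
    also have "\<dots> \<le> z\<^sup>2 / 2 + 2" by simp
    also have "\<dots> = (z\<^sup>2 / 2 + 2) * min 1 (x\<^sup>2)" using \<open>1 \<le> x\<^sup>2\<close> by (simp add: min_absorb1)
    finally show ?thesis .
  qed
qed

lemma levy_exponent_split:
  "levy_exponent a \<sigma> \<pi> z = \<i> * complex_of_real (a * z) + levy_exponent 0 \<sigma> \<pi> z"
  by (simp add: levy_exponent_def)

lemma levy_exponent_alt:
  "levy_exponent 0 \<sigma> \<pi> z = (CLINT x|\<pi>. levy_integrand z x) - complex_of_real (\<sigma> * z\<^sup>2 / 2)"
  by (simp add: levy_exponent_def levy_integrand_def[abs_def])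

text \<open>The big jumps are bounded by \<open>3 u / (1 + u)\<close> rather than \<open>min 2 u\<close> because the integral of the
  former along \<open>u * exp (- \<gamma> s)\<close> is exactly \<open>3 / \<gamma> * ln (1 + u)\<close>, which the logarithmic moment
  controls.\<close>

definition levy_bound :: "real \<Rightarrow> real measure \<Rightarrow> real \<Rightarrow> ennreal" where
  "levy_bound \<sigma> \<pi> z = ennreal (z\<^sup>2) * (ennreal \<sigma> + (\<integral>\<^sup>+x\<in>{-1..1}. ennreal (x\<^sup>2) \<partial>\<pi>)) +
    (\<integral>\<^sup>+x\<in>- {-1..1}. ennreal (3 * \<bar>z * x\<bar> / (1 + \<bar>z * x\<bar>)) \<partial>\<pi>)"

lemma saturated_mono:
  fixes u v :: real
  assumes "0 \<le> u" "u \<le> v"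
  shows "3 * u / (1 + u) \<le> 3 * v / (1 + v)"
  using assms by (simp add: divide_simps add_pos_nonneg) (simp add: algebra_simps)

text \<open>Makes the bound at an upper bound of a sequence of arguments a dominating function for
  the whole sequence.\<close>

lemma levy_bound_mono:
  assumes "\<bar>y\<bar> \<le> \<bar>z\<bar>"
  shows "levy_bound \<sigma> \<pi> y \<le> levy_bound \<sigma> \<pi> z"
  unfolding levy_bound_def
proof (intro add_mono mult_right_mono nn_integral_mono ennreal_leI)
  show "y\<^sup>2 \<le> z\<^sup>2" using assms by (simp add: abs_le_square_iff)
  show "3 * \<bar>y * x\<bar> / (1 + \<bar>y * x\<bar>) \<le> 3 * \<bar>z * x\<bar> / (1 + \<bar>z * x\<bar>)" for x
    using assms by (intro saturated_mono) (auto simp: abs_mult mult_right_mono)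
qed auto

context
  fixes \<pi> :: "real measure"
  assumes \<pi>: "levy_measure \<pi>"
begin

lemma sets_levy: "sets \<pi> = sets borel"
  using \<pi> by (simp add: levy_measure_def)

lemma space_levy: "space \<pi> = UNIV"
  using sets_eq_imp_space_eq[OF sets_levy] by simp

lemma levy_integrable_min: "integrable \<pi> (\<lambda>x. min 1 (x\<^sup>2))"
proof -
  note [measurable_cong] = sets_levy
  show ?thesis using \<pi> by (intro integrableI_nonneg) (auto simp: levy_measure_def)
qed

lemma levy_integrable_integrand: "integrable \<pi> (levy_integrand z)"
proof -
  note [measurable_cong] = sets_levy
  show ?thesis
    by (rule Bochner_Integration.integrable_bound[OF integrable_mult_right[OF levy_integrable_min, of "z\<^sup>2 / 2 + 2"]])
       (use levy_integrand_bound in \<open>auto simp: abs_mult\<close>)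
qed

lemma levy_big_finite: "emeasure \<pi> (- {-1..1}) < \<infinity>"
proof -
  note [measurable_cong] = sets_levy
  have "emeasure \<pi> (- {-1..1}) = (\<integral>\<^sup>+x. indicator (- {-1..1}) x \<partial>\<pi>)"
    by (simp add: sets_levy)
  also have "\<dots> \<le> (\<integral>\<^sup>+x. ennreal (min 1 (x\<^sup>2)) \<partial>\<pi>)"
  proof (intro nn_integral_mono)
    fix x :: real
    note one_le_square[of x]    then show "indicator (- {-1..1}) x \<le> ennreal (min 1 (x\<^sup>2))"
      by (auto simp: indicator_def min_def)
  qed
  also have "\<dots> < \<infinity>" using \<pi> by (simp add: levy_measure_def)
  finally show ?thesis .
qed

text \<open>A convergent sequence of arguments is bounded by some \<open>K\<close>, and the
  integrand bound at \<open>K\<close> dominates. Continuity serves the Riemann sums of the exponent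
  and, later, the limit law at 0.\<close>

lemma levy_exponent_continuous: "continuous_on UNIV (levy_exponent 0 \<sigma> \<pi>)"
proof -
  note [measurable_cong] = sets_levy
  have "isCont (\<lambda>z. CLINT x|\<pi>. levy_integrand z x) z" for z
  proof (unfold continuous_at_sequentially comp_def, intro allI impI)
    fix Z :: "nat \<Rightarrow> real" assume Z: "Z \<longlonglongrightarrow> z"
    then obtain K where K: "\<And>n. \<bar>Z n\<bar> \<le> K"
      by (metis Bseq_def convergentI convergent_imp_Bseq real_norm_def)
    have K2: "(Z n)\<^sup>2 \<le> K\<^sup>2" for n
      using K[of n] by (metis abs_ge_zero power2_abs power_mono)
    show "(\<lambda>n. CLINT x|\<pi>. levy_integrand (Z n) x) \<longlonglongrightarrow> (CLINT x|\<pi>. levy_integrand z x)"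
    proof (rule integral_dominated_convergence[where w="\<lambda>x. (K\<^sup>2 / 2 + 2) * min 1 (x\<^sup>2)"])
      show "AE x in \<pi>. (\<lambda>n. levy_integrand (Z n) x) \<longlonglongrightarrow> levy_integrand z x"
        unfolding levy_integrand_def by (intro AE_I2 tendsto_intros Z)
      show "AE x in \<pi>. cmod (levy_integrand (Z n) x) \<le> (K\<^sup>2 / 2 + 2) * min 1 (x\<^sup>2)" for n
      proof (intro AE_I2)
        fix x
        show "cmod (levy_integrand (Z n) x) \<le> (K\<^sup>2 / 2 + 2) * min 1 (x\<^sup>2)"
          by (rule order_trans[OF levy_integrand_bound]) (use K2[of n] in \<open>intro mult_right_mono; simp\<close>)
      qed
    qed (use levy_integrable_min in auto)
  qed
  then show ?thesis
    unfolding levy_exponent_alt by (intro continuous_at_imp_continuous_on ballI continuous_intros) auto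
qed

lemma levy_exponent_bound:
  assumes "0 \<le> \<sigma>"
  shows "ennreal (cmod (levy_exponent 0 \<sigma> \<pi> z)) \<le> levy_bound \<sigma> \<pi> z"
proof -
  note [measurable_cong] = sets_levy
  have "ennreal (cmod (CLINT x|\<pi>. levy_integrand z x)) \<le> (\<integral>\<^sup>+x. ennreal (cmod (levy_integrand z x)) \<partial>\<pi>)"
    by (rule integral_norm_bound_ennreal[OF levy_integrable_integrand])
  also have "\<dots> \<le> (\<integral>\<^sup>+x. ennreal (z\<^sup>2) * (ennreal (x\<^sup>2) * indicator {-1..1} x) +
      ennreal (3 * \<bar>z * x\<bar> / (1 + \<bar>z * x\<bar>)) * indicator (- {-1..1}) x \<partial>\<pi>)"
  proof (intro nn_integral_mono)
    fix x :: real
    have "z\<^sup>2 / 2 * x\<^sup>2 \<le> z\<^sup>2 * x\<^sup>2" by (intro mult_right_mono) auto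
    then have "x \<in> {-1..1} \<Longrightarrow> cmod (levy_integrand z x) \<le> z\<^sup>2 * x\<^sup>2"
      using levy_integrand_small[of x z] by linarith
    then show "ennreal (cmod (levy_integrand z x)) \<le> ennreal (z\<^sup>2) * (ennreal (x\<^sup>2) * indicator {-1..1} x) +
      ennreal (3 * \<bar>z * x\<bar> / (1 + \<bar>z * x\<bar>)) * indicator (- {-1..1}) x"
      using levy_integrand_big(1)[of x z] by (cases "x \<in> {-1..1}") (auto simp: ennreal_mult[symmetric] intro!: ennreal_leI)
  qed
  also have "\<dots> = ennreal (z\<^sup>2) * (\<integral>\<^sup>+x\<in>{-1..1}. ennreal (x\<^sup>2) \<partial>\<pi>) +
      (\<integral>\<^sup>+x\<in>- {-1..1}. ennreal (3 * \<bar>z * x\<bar> / (1 + \<bar>z * x\<bar>)) \<partial>\<pi>)"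
    by (subst nn_integral_add) (auto simp: nn_integral_cmult)
  finally have 1: "ennreal (cmod (CLINT x|\<pi>. levy_integrand z x)) \<le> \<dots>" .
  have "cmod (levy_exponent 0 \<sigma> \<pi> z) \<le> cmod (CLINT x|\<pi>. levy_integrand z x) + cmod (complex_of_real (\<sigma> * z\<^sup>2 / 2))"
    unfolding levy_exponent_alt by (rule norm_triangle_ineq4)
  also have "cmod (complex_of_real (\<sigma> * z\<^sup>2 / 2)) \<le> z\<^sup>2 * \<sigma>"
    unfolding norm_of_real using assms by (simp add: abs_mult)
  finally have "ennreal (cmod (levy_exponent 0 \<sigma> \<pi> z)) \<le> ennreal (cmod (CLINT x|\<pi>. levy_integrand z x) + z\<^sup>2 * \<sigma>)"
    by (intro ennreal_leI) simp
  also have "\<dots> = ennreal (cmod (CLINT x|\<pi>. levy_integrand z x)) + ennreal (z\<^sup>2) * ennreal \<sigma>"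
    using assms by (simp add: ennreal_plus ennreal_mult)
  also note add_right_mono[OF 1]
  finally show ?thesis by (simp add: levy_bound_def distrib_left add_ac)
qed

end

section \<open>Levy bounds integrated along an exponentially decaying argument\<close>

lemma nn_integral_exp_decay:
  assumes "0 < \<gamma>"
  shows "(\<integral>\<^sup>+s\<in>{0..}. ennreal ((exp (- \<gamma> * s))\<^sup>2) \<partial>lborel) = ennreal (1 / (2 * \<gamma>))"
proof -
  have "(\<integral>\<^sup>+s. ennreal ((exp (- \<gamma> * s))\<^sup>2) * indicator {0..} s \<partial>lborel) = ennreal (0 - (- (exp (- \<gamma> * 0))\<^sup>2 / (2 * \<gamma>)))"
  proof (rule nn_integral_FTC_atLeast)
    show "((\<lambda>s. - (exp (- \<gamma> * s))\<^sup>2 / (2 * \<gamma>)) \<longlongrightarrow> 0) at_top"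
      using assms by real_asymp
    fix s :: real
    show "((\<lambda>s. - (exp (- \<gamma> * s))\<^sup>2 / (2 * \<gamma>)) has_real_derivative (exp (- \<gamma> * s))\<^sup>2) (at s)"
      using assms by (auto intro!: derivative_eq_intros simp: power2_eq_square field_simps)
  qed auto
  then show ?thesis by simp
qed

lemma nn_integral_saturated_decay:
  assumes "0 < \<gamma>" "0 \<le> u"
  shows "(\<integral>\<^sup>+s\<in>{0..}. ennreal (3 * (u * exp (- \<gamma> * s)) / (1 + u * exp (- \<gamma> * s))) \<partial>lborel) = ennreal (3 / \<gamma> * ln (1 + u))"
proof -
  have pos: "0 < 1 + u * exp (- \<gamma> * s)" for s using assms by (simp add: add_pos_nonneg)
  have "(\<integral>\<^sup>+s. ennreal (3 * (u * exp (- \<gamma> * s)) / (1 + u * exp (- \<gamma> * s))) * indicator {0..} s \<partial>lborel)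
      = ennreal (0 - (- 3 / \<gamma> * ln (1 + u * exp (- \<gamma> * 0))))"
  proof (rule nn_integral_FTC_atLeast)
    have "((\<lambda>s. - 3 / \<gamma> * ln (1 + u * exp (- \<gamma> * s))) \<longlongrightarrow> - 3 / \<gamma> * ln (1 + u * 0)) at_top"
    proof (intro tendsto_intros)
      show "((\<lambda>s. exp (- \<gamma> * s)) \<longlongrightarrow> 0) at_top" using assms by real_asymp
    qed auto
    then show "((\<lambda>s. - 3 / \<gamma> * ln (1 + u * exp (- \<gamma> * s))) \<longlongrightarrow> 0) at_top" by simp
    fix s :: real
    show "((\<lambda>s. - 3 / \<gamma> * ln (1 + u * exp (- \<gamma> * s))) has_real_derivative
        3 * (u * exp (- \<gamma> * s)) / (1 + u * exp (- \<gamma> * s))) (at s)"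
    proof (rule DERIV_cong)
      show "((\<lambda>s. - 3 / \<gamma> * ln (1 + u * exp (- \<gamma> * s))) has_real_derivative
        - 3 / \<gamma> * (u * (exp (- \<gamma> * s) * (- \<gamma>)) / (1 + u * exp (- \<gamma> * s)))) (at s)"
        using pos[of s] by (auto intro!: derivative_eq_intros)
      show "- 3 / \<gamma> * (u * (exp (- \<gamma> * s) * (- \<gamma>)) / (1 + u * exp (- \<gamma> * s)))
          = 3 * (u * exp (- \<gamma> * s)) / (1 + u * exp (- \<gamma> * s))"
        using assms by simp
    qed
    show "0 \<le> 3 * (u * exp (- \<gamma> * s)) / (1 + u * exp (- \<gamma> * s))"
      using assms pos[of s] by simp
  qed auto
  then show ?thesis by simp
qed

text \<open>From \<open>1 + u * x \<le> (1 + u) * x\<close>: this separates the argument of the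
  characteristic function from the size of the jump, leaving exactly the logarithmic moment.\<close>

lemma ln_1_plus_mult_le:
  fixes u x :: real
  assumes "0 \<le> u" "1 \<le> x"
  shows "ln (1 + u * x) \<le> u + ln x"
proof -
  have "ln (1 + u * x) \<le> ln ((1 + u) * x)"
    using assms by (subst ln_le_cancel_iff) (auto simp: algebra_simps intro!: add_pos_nonneg)
  also have "\<dots> = ln (1 + u) + ln x"
    using assms by (intro ln_mult_pos) auto
  also have "ln (1 + u) \<le> u" using assms by (intro ln_add_one_self_le_self)
  finally show ?thesis by simp
qed

text \<open>A Levy measure may be infinite, but its restriction to big jumps is finite; this
  provides the sigma-finiteness required for exchanging the integrals over time and jumps.\<close>

definition big_jumps :: "real measure \<Rightarrow> real measure" where
  "big_jumps \<pi> = density \<pi> (indicator (- {-1..1}))"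

context
  fixes \<pi> :: "real measure"
  assumes \<pi>: "levy_measure \<pi>"
begin

lemma sets_big_jumps: "sets (big_jumps \<pi>) = sets borel"
  by (simp add: big_jumps_def sets_levy[OF \<pi>])

lemma finite_measure_big_jumps: "finite_measure (big_jumps \<pi>)"
proof (rule finite_measureI)
  have "emeasure (big_jumps \<pi>) (space (big_jumps \<pi>)) = emeasure \<pi> (- {-1..1})"
    unfolding big_jumps_def by (subst emeasure_density)
      (auto simp: space_levy[OF \<pi>] sets_levy[OF \<pi>] intro!: borel_measurable_indicator)
  then show "emeasure (big_jumps \<pi>) (space (big_jumps \<pi>)) \<noteq> \<infinity>"
    using levy_big_finite[OF \<pi>] by simp
qed

lemma nn_integral_big_jumps:
  assumes "f \<in> borel_measurable borel"
  shows "(\<integral>\<^sup>+x. f x \<partial>big_jumps \<pi>) = (\<integral>\<^sup>+x\<in>- {-1..1}. f x \<partial>\<pi>)"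
  unfolding big_jumps_def using assms by (subst nn_integral_density)
    (auto simp: mult.commute sets_levy[OF \<pi>] measurable_cong_sets[OF sets_levy[OF \<pi>] refl] intro!: borel_measurable_indicator)

lemma levy_bound_measurable: "levy_bound \<sigma> \<pi> \<in> borel_measurable borel"
proof -
  interpret N: finite_measure "big_jumps \<pi>" by (rule finite_measure_big_jumps)
  have pm: "borel_measurable (borel \<Otimes>\<^sub>M big_jumps \<pi>) = borel_measurable (borel \<Otimes>\<^sub>M borel)"
    by (rule measurable_cong_sets[OF sets_pair_measure_cong refl]) (simp_all add: sets_big_jumps)
  have [measurable]: "(\<lambda>z. \<integral>\<^sup>+x. ennreal (3 * \<bar>z * x\<bar> / (1 + \<bar>z * x\<bar>)) \<partial>big_jumps \<pi>) \<in> borel_measurable borel"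
    by (rule N.borel_measurable_nn_integral) (unfold pm, measurable)
  have "levy_bound \<sigma> \<pi> = (\<lambda>z. ennreal (z\<^sup>2) * (ennreal \<sigma> + (\<integral>\<^sup>+x\<in>{-1..1}. ennreal (x\<^sup>2) \<partial>\<pi>)) +
    (\<integral>\<^sup>+x. ennreal (3 * \<bar>z * x\<bar> / (1 + \<bar>z * x\<bar>)) \<partial>big_jumps \<pi>))"
    unfolding levy_bound_def[abs_def] by (intro ext arg_cong2[where f="(+)"] refl nn_integral_big_jumps[symmetric]) measurable
  then show ?thesis by simp
qed

end

text \<open>Integrating over all times from the start makes every later estimate uniform in
  \<open>t\<close>. Small jumps and the Gaussian part carry the square of the decay factor; for big
  jumps the order of integration is exchanged.\<close>

lemma levy_bound_decay:
  assumes \<pi>: "levy_measure \<pi>" and \<gamma>: "0 < \<gamma>"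
  shows "(\<integral>\<^sup>+s\<in>{0..}. levy_bound \<sigma> \<pi> (y * exp (- \<gamma> * s)) \<partial>lborel) \<le>
    ennreal (y\<^sup>2 / \<gamma>) * (ennreal \<sigma> + (\<integral>\<^sup>+x\<in>{-1..1}. ennreal (x\<^sup>2) \<partial>\<pi>)) +
    ennreal (3 / \<gamma>) * (ennreal \<bar>y\<bar> * emeasure \<pi> (- {-1..1}) + (\<integral>\<^sup>+x\<in>- {-1..1}. ennreal (ln \<bar>x\<bar>) \<partial>\<pi>))"
proof -
  note [measurable_cong] = sets_levy[OF \<pi>]
  let ?N = "big_jumps \<pi>"
  interpret N: finite_measure ?N by (rule finite_measure_big_jumps[OF \<pi>])
  interpret P: pair_sigma_finite lborel ?N ..
  let ?e = "\<lambda>s. exp (- \<gamma> * s)"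
  let ?V = "ennreal \<sigma> + (\<integral>\<^sup>+x\<in>{-1..1}. ennreal (x\<^sup>2) \<partial>\<pi>)"
  let ?k = "\<lambda>s x. ennreal (3 * (\<bar>y * x\<bar> * ?e s) / (1 + \<bar>y * x\<bar> * ?e s)) * indicator {0..} s"
  have pm: "borel_measurable (lborel \<Otimes>\<^sub>M ?N) = borel_measurable (borel \<Otimes>\<^sub>M borel)"
    by (rule measurable_cong_sets[OF sets_pair_measure_cong refl]) (simp_all add: sets_big_jumps[OF \<pi>])
  have meas: "(\<lambda>s. \<integral>\<^sup>+x. ?k s x \<partial>?N) \<in> borel_measurable lborel"
    by (rule N.borel_measurable_nn_integral) (unfold pm, measurable)
  have "(\<integral>\<^sup>+s\<in>{0..}. levy_bound \<sigma> \<pi> (y * ?e s) \<partial>lborel)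
    = (\<integral>\<^sup>+s. ennreal (y\<^sup>2) * ?V * (ennreal ((?e s)\<^sup>2) * indicator {0..} s) + (\<integral>\<^sup>+x. ?k s x \<partial>?N) \<partial>lborel)"
  proof (intro nn_integral_cong)
    fix s :: real
    show "levy_bound \<sigma> \<pi> (y * ?e s) * indicator {0..} s
      = ennreal (y\<^sup>2) * ?V * (ennreal ((?e s)\<^sup>2) * indicator {0..} s) + (\<integral>\<^sup>+x. ?k s x \<partial>?N)"
    proof (cases "s \<in> {0..}")
      case True
      have "ennreal ((y * ?e s)\<^sup>2) * ?V = ennreal (y\<^sup>2) * ?V * ennreal ((?e s)\<^sup>2)"
        by (simp add: power_mult_distrib ennreal_mult mult_ac)
      moreover have "(\<integral>\<^sup>+x\<in>- {-1..1}. ennreal (3 * \<bar>y * ?e s * x\<bar> / (1 + \<bar>y * ?e s * x\<bar>)) \<partial>\<pi>) = (\<integral>\<^sup>+x. ?k s x \<partial>?N)"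
        using True by (subst nn_integral_big_jumps[OF \<pi>]) (auto simp: abs_mult mult_ac)
      ultimately show ?thesis using True by (simp add: levy_bound_def)
    qed simp
  qed
  also have "\<dots> = (\<integral>\<^sup>+s. ennreal (y\<^sup>2) * ?V * (ennreal ((?e s)\<^sup>2) * indicator {0..} s) \<partial>lborel)
      + (\<integral>\<^sup>+s. (\<integral>\<^sup>+x. ?k s x \<partial>?N) \<partial>lborel)"
    by (rule nn_integral_add[OF _ meas]) measurable
  also have "(\<integral>\<^sup>+s. ennreal (y\<^sup>2) * ?V * (ennreal ((?e s)\<^sup>2) * indicator {0..} s) \<partial>lborel)
      = ennreal (y\<^sup>2) * ?V * ennreal (1 / (2 * \<gamma>))"
    by (subst nn_integral_cmult, measurable) (simp only: nn_integral_exp_decay[OF \<gamma>])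
  also have "ennreal (y\<^sup>2) * ?V * ennreal (1 / (2 * \<gamma>)) = ennreal (y\<^sup>2 * (1 / (2 * \<gamma>))) * ?V"
    using \<gamma> by (subst ennreal_mult) (auto simp: mult_ac)
  also have "\<dots> \<le> ennreal (y\<^sup>2 / \<gamma>) * ?V"
    using \<gamma> by (intro mult_right_mono ennreal_leI) (auto simp: field_simps)
  also have "(\<integral>\<^sup>+s. (\<integral>\<^sup>+x. ?k s x \<partial>?N) \<partial>lborel) = (\<integral>\<^sup>+x. (\<integral>\<^sup>+s. ?k s x \<partial>lborel) \<partial>?N)"
    by (rule P.Fubini'[symmetric]) (unfold pm, measurable)
  also have "\<dots> = (\<integral>\<^sup>+x. ennreal (3 / \<gamma> * ln (1 + \<bar>y * x\<bar>)) \<partial>?N)"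
    using \<gamma> by (intro nn_integral_cong nn_integral_saturated_decay) auto
  also have "\<dots> = (\<integral>\<^sup>+x\<in>- {-1..1}. ennreal (3 / \<gamma> * ln (1 + \<bar>y * x\<bar>)) \<partial>\<pi>)"
    by (rule nn_integral_big_jumps[OF \<pi>]) measurable
  also have "\<dots> \<le> (\<integral>\<^sup>+x. ennreal (3 / \<gamma>) * (ennreal \<bar>y\<bar> * indicator (- {-1..1}) x + ennreal (ln \<bar>x\<bar>) * indicator (- {-1..1}) x) \<partial>\<pi>)"
  proof (intro nn_integral_mono)
    fix x :: real
    show "ennreal (3 / \<gamma> * ln (1 + \<bar>y * x\<bar>)) * indicator (- {-1..1}) x
      \<le> ennreal (3 / \<gamma>) * (ennreal \<bar>y\<bar> * indicator (- {-1..1}) x + ennreal (ln \<bar>x\<bar>) * indicator (- {-1..1}) x)"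
    proof (cases "x \<in> {-1..1}")
      case False
      then have x: "1 \<le> \<bar>x\<bar>" by auto
      have "3 / \<gamma> * ln (1 + \<bar>y\<bar> * \<bar>x\<bar>) \<le> 3 / \<gamma> * (\<bar>y\<bar> + ln \<bar>x\<bar>)"
        using \<gamma> x by (intro mult_left_mono ln_1_plus_mult_le) auto
      then have "ennreal (3 / \<gamma> * ln (1 + \<bar>y * x\<bar>)) \<le> ennreal (3 / \<gamma> * (\<bar>y\<bar> + ln \<bar>x\<bar>))"
        by (intro ennreal_leI) (simp add: abs_mult)
      also have "\<dots> = ennreal (3 / \<gamma>) * (ennreal \<bar>y\<bar> + ennreal (ln \<bar>x\<bar>))"
        using \<gamma> x by (subst ennreal_mult, simp, simp, subst ennreal_plus, auto)
      finally show ?thesis using False by simp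
    qed simp
  qed
  also have "\<dots> = ennreal (3 / \<gamma>) * (ennreal \<bar>y\<bar> * emeasure \<pi> (- {-1..1}) + (\<integral>\<^sup>+x\<in>- {-1..1}. ennreal (ln \<bar>x\<bar>) \<partial>\<pi>))"
    by (subst nn_integral_cmult, measurable, subst nn_integral_add, measurable,
        subst nn_integral_cmult_indicator) (auto simp: sets_levy[OF \<pi>])
  finally show ?thesis by (simp add: add_left_mono)
qed

subsection \<open>The law of the stochastic convolution\<close>

lemma LBINT_Icc_reflect:
  fixes f :: "real \<Rightarrow> complex"
  shows "(CLBINT s:{0..t}. f (t - s)) = (CLBINT s:{0..t}. f s)"
  unfolding set_lebesgue_integral_def
  by (subst (2) lborel_integral_real_affine[where c="-1" and t=t])
     (auto simp: indicator_def intro!: Bochner_Integration.integral_cong)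

text \<open>The grid sums are sums of independent stationary increments, so their characteristic
  functions are exponentials of Riemann sums of the Levy exponent, and both sides pass to the
  limit.\<close>

lemma char_levy_OU_integral:
  assumes levy: "levy_process_with M \<xi> a \<sigma> \<pi>"
    and I: "levy_OU_integral M (\<lambda>t \<omega>. \<xi> t \<omega> - a * t) \<gamma> I"
    and t: "0 \<le> t"
  shows "char (distr M borel (I t)) z = exp (CLBINT s:{0..t}. levy_exponent 0 \<sigma> \<pi> (z * exp (- \<gamma> * s)))"
proof -
  have LP: "levy_process M \<xi>" and \<pi>: "levy_measure \<pi>" and \<sigma>: "0 \<le> \<sigma>"
    and ch: "\<And>s l. 0 \<le> s \<Longrightarrow> char (distr M borel (\<xi> s)) l = exp (complex_of_real s * levy_exponent a \<sigma> \<pi> l)"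
    using levy by (auto simp: levy_process_with_def)
  interpret prob_space M using LP by (simp add: levy_process_def)
  have \<xi>m: "\<And>s. 0 \<le> s \<Longrightarrow> \<xi> s \<in> borel_measurable M"
    and stat: "\<And>s u. 0 \<le> s \<Longrightarrow> s \<le> u \<Longrightarrow> distr M borel (\<lambda>\<omega>. \<xi> u \<omega> - \<xi> s \<omega>) = distr M borel (\<xi> (u - s))"
    and ind: "\<And>(n :: nat) (p :: nat \<Rightarrow> real). 0 \<le> p 0 \<Longrightarrow> (\<And>i. i < n \<Longrightarrow> p i \<le> p (Suc i)) \<Longrightarrow>
        indep_vars (\<lambda>_. borel) (\<lambda>i \<omega>. \<xi> (p (Suc i)) \<omega> - \<xi> (p i) \<omega>) {..<n}"
    using LP by (auto simp: levy_process_def)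
  have Im [measurable]: "I t \<in> borel_measurable M"
    and RS: "AE \<omega> in M. has_RS_integral (\<lambda>s. exp (- \<gamma> * (t - s))) (\<lambda>s. \<xi> s \<omega> - a * s) 0 t (I t \<omega>)"
    using I t by (auto simp: levy_OU_integral_def)
  let ?S = "\<lambda>n \<omega>. OU_sum \<gamma> t n (\<lambda>s. \<xi> s \<omega> - a * s)"
  have \<xi>g [measurable]: "\<xi> (grid t n i) \<in> borel_measurable M" for n i
    by (rule \<xi>m[OF grid_nonneg[OF t]])
  have Sm [measurable]: "?S n \<in> borel_measurable M" for n
    unfolding OU_sum_def by measurable
  have lim: "(\<lambda>n. char (distr M borel (?S n)) z) \<longlonglongrightarrow> char (distr M borel (I t)) z"
  proof -
    have "(\<lambda>n. CLINT \<omega>|M. iexp (z * ?S n \<omega>)) \<longlonglongrightarrow> (CLINT \<omega>|M. iexp (z * I t \<omega>))"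
    proof (rule integral_dominated_convergence[where w="\<lambda>_. 1"])
      show "AE \<omega> in M. (\<lambda>n. iexp (z * ?S n \<omega>)) \<longlonglongrightarrow> iexp (z * I t \<omega>)"
        using RS by eventually_elim (intro tendsto_intros OU_sum_tendsto t, assumption)
    qed auto
    then show ?thesis unfolding char_def by (simp add: integral_distr)
  qed
  have val: "char (distr M borel (?S n)) z = exp (\<Sum>i<n. (t / real n) *\<^sub>R levy_exponent 0 \<sigma> \<pi> (z * exp (- \<gamma> * (t - grid t n i))))" for n
  proof -
    let ?e = "\<lambda>i. exp (- \<gamma> * (t - grid t n i))"
    let ?D = "\<lambda>i \<omega>. \<xi> (grid t n (Suc i)) \<omega> - \<xi> (grid t n i) \<omega>"
    let ?X = "\<lambda>i \<omega>. - (?e i * (a * (t / real n))) + ?e i * ?D i \<omega>"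
    \<comment> \<open>Removing the drift from the path turns into a deterministic shift of each
      summand, which cancels the linear term \<open>a\<close> of the exponent.\<close>
    have S: "?S n = (\<lambda>\<omega>. \<Sum>i<n. ?X i \<omega>)"
    proof (unfold OU_sum_def, intro ext sum.cong refl)
      fix \<omega> i
      show "?e i * (\<xi> (grid t n (Suc i)) \<omega> - a * grid t n (Suc i) - (\<xi> (grid t n i) \<omega> - a * grid t n i)) = ?X i \<omega>"
        unfolding grid_Suc[of t n i, symmetric] by (simp add: algebra_simps)
    qed
    have Dm: "?D i \<in> borel_measurable M" for i
      by measurable
    have "indep_vars (\<lambda>_. borel) ?D {..<n}"
      using t by (intro ind) (auto simp: grid_mono)
    then have "indep_vars (\<lambda>_. borel) ?X {..<n}"
      by (rule indep_vars_compose2) auto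
    then have "char (distr M borel (?S n)) z = (\<Prod>i<n. char (distr M borel (?X i)) z)"
      unfolding S by (rule char_distr_sum)
    also have "\<dots> = (\<Prod>i<n. exp ((t / real n) *\<^sub>R levy_exponent 0 \<sigma> \<pi> (z * ?e i)))"
    proof (intro prod.cong refl)
      fix i
      have "distr M borel (?X i) = distr (distr M borel (?D i)) borel (\<lambda>y. - (?e i * (a * (t / real n))) + ?e i * y)"
        using Dm by (subst distr_distr) (auto simp: comp_def)
      moreover have "distr M borel (?D i) = distr M borel (\<xi> (t / real n))"
        using t by (subst stat) (auto simp: grid_nonneg grid_mono grid_Suc)
      moreover have "real_distribution (distr M borel (\<xi> (t / real n)))"
        using t by (intro real_distribution_distr \<xi>m) simp
      ultimately have "char (distr M borel (?X i)) z = iexp (- (?e i * (a * (t / real n))) * z) * char (distr M borel (\<xi> (t / real n))) (?e i * z)"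
        by (simp only: char_distr_affine)
      also have "\<dots> = iexp (- (?e i * (a * (t / real n))) * z) * exp (complex_of_real (t / real n) * levy_exponent a \<sigma> \<pi> (?e i * z))"
        using t by (subst ch) auto
      also have "\<dots> = exp ((t / real n) *\<^sub>R levy_exponent 0 \<sigma> \<pi> (z * ?e i))"
        unfolding exp_add[symmetric] levy_exponent_split[of a] scaleR_conv_of_real
        by (rule arg_cong[where f=exp]) (simp add: algebra_simps)
      finally show "char (distr M borel (?X i)) z = exp ((t / real n) *\<^sub>R levy_exponent 0 \<sigma> \<pi> (z * ?e i))" .
    qed
    also have "\<dots> = exp (\<Sum>i<n. (t / real n) *\<^sub>R levy_exponent 0 \<sigma> \<pi> (z * ?e i))"
      by (simp add: exp_sum)
    finally show ?thesis .
  qed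
  have "(\<lambda>n. \<Sum>i<n. (t / real n) *\<^sub>R levy_exponent 0 \<sigma> \<pi> (z * exp (- \<gamma> * (t - grid t n i))))
      \<longlonglongrightarrow> (CLBINT s:{0..t}. levy_exponent 0 \<sigma> \<pi> (z * exp (- \<gamma> * (t - s))))"
    by (intro Riemann_sum_tendsto t continuous_on_compose2[OF levy_exponent_continuous[OF \<pi>]] continuous_intros) auto
  then have "(\<lambda>n. char (distr M borel (?S n)) z) \<longlonglongrightarrow> exp (CLBINT s:{0..t}. levy_exponent 0 \<sigma> \<pi> (z * exp (- \<gamma> * (t - s))))"
    unfolding val by (rule tendsto_exp)
  then have "char (distr M borel (I t)) z = exp (CLBINT s:{0..t}. levy_exponent 0 \<sigma> \<pi> (z * exp (- \<gamma> * (t - s))))"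
    using lim LIMSEQ_unique by blast
  also have "(CLBINT s:{0..t}. levy_exponent 0 \<sigma> \<pi> (z * exp (- \<gamma> * (t - s)))) = (CLBINT s:{0..t}. levy_exponent 0 \<sigma> \<pi> (z * exp (- \<gamma> * s)))"
    by (rule LBINT_Icc_reflect)
  finally show ?thesis .
qed

subsection \<open>Limits of series and of laws\<close>

text \<open>Dominated convergence for the counting measure.\<close>

lemma tannery:
  fixes f :: "nat \<Rightarrow> nat \<Rightarrow> 'b :: {banach, second_countable_topology}"
  assumes lim: "\<And>j. (\<lambda>n. f n j) \<longlonglongrightarrow> g j"
    and bound: "\<And>n j. norm (f n j) \<le> B j" and B: "summable B"
  shows "(\<lambda>n. \<Sum>j. f n j) \<longlonglongrightarrow> (\<Sum>j. g j)"
proof -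
  have B0: "0 \<le> B j" for j using bound[of 0 j] norm_ge_zero order_trans by blast
  have Bi: "integrable (count_space UNIV) B"
    using B B0 by (simp add: integrable_count_space_nat_iff)
  have gB: "norm (g j) \<le> B j" for j
    by (rule LIMSEQ_le_const2[OF tendsto_norm[OF lim[of j]]]) (simp add: bound)
  have fi: "integrable (count_space UNIV) (f n)" for n
    by (rule Bochner_Integration.integrable_bound[OF Bi]) (use bound B0 in auto)
  have gi: "integrable (count_space UNIV) g"
    by (rule Bochner_Integration.integrable_bound[OF Bi]) (use gB B0 in auto)
  have "(\<lambda>n. integral\<^sup>L (count_space UNIV) (f n)) \<longlonglongrightarrow> integral\<^sup>L (count_space UNIV) g"
    by (rule integral_dominated_convergence[OF _ _ Bi]) (use lim bound in auto)
  then show ?thesis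
    by (simp add: integral_count_space_nat fi gi)
qed

text \<open>The derivative of \<open>exp\<close> has modulus at most 1 on the closed left
  half-plane, which is convex.\<close>

lemma cmod_one_minus_exp_le:
  assumes "Re w \<le> 0"
  shows "cmod (1 - exp w) \<le> cmod w"
proof -
  have "cmod (exp 0 - exp w) \<le> 1 * cmod (0 - w)"
  proof (rule field_differentiable_bound[where S="{z. Re z \<le> 0}"])
    show "convex {z. Re z \<le> 0}" by (rule convex_halfspace_Re_le)
  qed (use assms in \<open>auto intro!: derivative_eq_intros\<close>)
  then show ?thesis by simp
qed

text \<open>A standard normal variable has second moment 1, so the Gaussian average of
  \<open>1 + (z / c)\<^sup>2\<close> is \<open>1 + 1 / c\<^sup>2\<close>.\<close>

lemma measure_tail_le_quadratic:
  assumes \<mu>: "real_distribution \<mu>" and c: "0 < c" and \<kappa>: "\<And>z. cmod (1 - char \<mu> z) \<le> (1 + z\<^sup>2) * \<kappa>"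
  shows "measure \<mu> {y. c \<le> \<bar>y\<bar>} \<le> gauss_const * ((1 + 1 / c\<^sup>2) * \<kappa>)"
proof -
  interpret \<mu>: real_distribution \<mu> by fact
  interpret N: real_distribution std_normal_distribution by (rule real_dist_normal_dist)
  have i2: "integrable std_normal_distribution (\<lambda>z. z\<^sup>2)"
    by (rule integrable_std_normal_distribution_moment)
  have m2: "(LINT z|std_normal_distribution. z\<^sup>2) = 1"
    using std_normal_distribution_even_moments(1)[of 1] by (simp add: has_bochner_integral_integral_eq)
  have "measure \<mu> {y. c \<le> \<bar>y\<bar>} \<le> gauss_const * (LINT z|std_normal_distribution. cmod (1 - char \<mu> (z / c)))"
    by (rule measure_tail_le_char[OF \<mu> c])
  also have "(LINT z|std_normal_distribution. cmod (1 - char \<mu> (z / c))) \<le> (LINT z|std_normal_distribution. \<kappa> + \<kappa> / c\<^sup>2 * z\<^sup>2)"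
  proof (rule integral_mono)
    have "cmod (1 - char \<mu> z) \<le> 2" for z
      using norm_triangle_ineq4[of 1 "char \<mu> z"] \<mu>.cmod_char_le_1[of z] by simp
    then show "integrable std_normal_distribution (\<lambda>z. cmod (1 - char \<mu> (z / c)))"
      by (intro N.integrable_const_bound[where B=2]) auto
    show "cmod (1 - char \<mu> (z / c)) \<le> \<kappa> + \<kappa> / c\<^sup>2 * z\<^sup>2" for z
      using \<kappa>[of "z / c"] by (simp add: algebra_simps power_divide)
  qed (use i2 in auto)
  also have "\<dots> = (1 + 1 / c\<^sup>2) * \<kappa>"
    using i2 m2 N.prob_space by (simp add: algebra_simps)
  finally show ?thesis using gauss_const_pos by (simp add: mult_left_mono)
qed

lemma limit_law_eqI:
  assumes "converges_in_law \<Lambda> \<mu>" "\<And>t. 0 \<le> t \<Longrightarrow> real_distribution (\<Lambda> t)"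
  shows "limit_law \<Lambda> = \<mu>"
  unfolding limit_law_def
proof (rule the_equality)
  show "converges_in_law \<Lambda> \<mu>" by (rule assms(1))
  fix \<nu> assume \<nu>: "converges_in_law \<Lambda> \<nu>"
  have s: "(\<forall>n. 0 \<le> real n) \<and> filterlim real at_top sequentially"
    by (simp add: filterlim_real_sequentially)
  have w: "weak_conv_m (\<lambda>n. \<Lambda> (real n)) \<mu>" "weak_conv_m (\<lambda>n. \<Lambda> (real n)) \<nu>"
    using assms(1) \<nu> s unfolding converges_in_law_def by blast+
  have rd: "real_distribution \<mu>" "real_distribution \<nu>"
    using assms(1) \<nu> unfolding converges_in_law_def by auto
  have "char \<nu> z = char \<mu> z" for z
    using levy_continuity1[OF _ rd(1) w(1), of z] levy_continuity1[OF _ rd(2) w(2), of z] assms(2)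
    by (intro LIMSEQ_unique) auto
  then show "\<nu> = \<mu>" by (intro Levy_uniqueness rd) auto
qed

lemma converges_in_lawI:
  assumes \<mu>: "real_distribution \<mu>" and \<Lambda>: "\<And>t. 0 \<le> t \<Longrightarrow> real_distribution (\<Lambda> t)"
    and "\<And>s z. (\<And>n. 0 \<le> s n) \<Longrightarrow> filterlim s at_top sequentially \<Longrightarrow> (\<lambda>n. char (\<Lambda> (s n)) z) \<longlonglongrightarrow> char \<mu> z"
  shows "converges_in_law \<Lambda> \<mu>"
  unfolding converges_in_law_def using assms by (auto intro!: levy_continuity)

subsection \<open>Superpositions of stochastic convolutions\<close>

locale OU_superposition =
  fixes M :: "'a measure" and \<xi> I :: "nat \<Rightarrow> real \<Rightarrow> 'a \<Rightarrow> real" and a \<sigma> \<gamma> m :: "nat \<Rightarrow> real"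
    and \<pi> :: "nat \<Rightarrow> real measure"
  assumes levy: "\<And>j. levy_process_with M (\<xi> j) (a j) (\<sigma> j) (\<pi> j)"
    and indep: "indep_processes M \<xi>"
    and \<gamma>_pos: "\<And>j. 0 < \<gamma> j"
    and m_pos: "\<And>j. 0 < m j"
    and I: "\<And>j. levy_OU_integral M (\<lambda>t \<omega>. \<xi> j t \<omega> - a j * t) (\<gamma> j) (I j)"
    and b2: "summable (\<lambda>j. (m j)\<^sup>2 * \<sigma> j / \<gamma> j)"
    and c1: "(\<Sum>j. ennreal ((m j)\<^sup>2 / \<gamma> j) * (\<integral>\<^sup>+z\<in>{-1..1}. ennreal (z\<^sup>2) \<partial>\<pi> j)) < \<infinity>"
    and c2: "(\<Sum>j. ennreal (m j / \<gamma> j) * emeasure (\<pi> j) (- {-1..1})) < \<infinity>"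
    and d: "(\<Sum>j. ennreal (1 / \<gamma> j) * (\<integral>\<^sup>+z\<in>- {-1..1}. ennreal (ln \<bar>z\<bar>) \<partial>\<pi> j)) < \<infinity>"
begin

sublocale prob_space M
  using levy[of 0] by (simp add: levy_process_with_def levy_process_def)

lemma \<sigma>_nonneg: "0 \<le> \<sigma> j" and levy_\<pi>: "levy_measure (\<pi> j)"
  using levy[of j] by (auto simp: levy_process_with_def levy_process_def)

lemma measurable_I: "0 \<le> t \<Longrightarrow> I j t \<in> borel_measurable M"
  and RS_integral: "0 \<le> t \<Longrightarrow> AE \<omega> in M. has_RS_integral (\<lambda>s. exp (- \<gamma> j * (t - s))) (\<lambda>s. \<xi> j s \<omega> - a j * s) 0 t (I j t \<omega>)"
  using I[of j] by (auto simp: levy_OU_integral_def)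

text \<open>The coefficient of \<open>1 + z\<^sup>2\<close> in the time-integrated bound for the
  \<open>j\<close>-th exponent. Expanded, it consists, up to factors 3, of the summands of
  \<open>b2\<close>, \<open>c1\<close>, \<open>c2\<close> and \<open>d\<close>.\<close>

definition cost :: "nat \<Rightarrow> ennreal" where
  "cost j = ennreal ((m j)\<^sup>2 / \<gamma> j) * (ennreal (\<sigma> j) + (\<integral>\<^sup>+x\<in>{-1..1}. ennreal (x\<^sup>2) \<partial>\<pi> j)) +
    ennreal (3 / \<gamma> j) * (ennreal (m j) * emeasure (\<pi> j) (- {-1..1}) + (\<integral>\<^sup>+x\<in>- {-1..1}. ennreal (ln \<bar>x\<bar>) \<partial>\<pi> j))"

lemma suminf_cost: "(\<Sum>j. cost j) < \<infinity>"
proof -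
  have "cost j = ennreal ((m j)\<^sup>2 * \<sigma> j / \<gamma> j) + ennreal ((m j)\<^sup>2 / \<gamma> j) * (\<integral>\<^sup>+x\<in>{-1..1}. ennreal (x\<^sup>2) \<partial>\<pi> j)
     + 3 * (ennreal (m j / \<gamma> j) * emeasure (\<pi> j) (- {-1..1}))
     + 3 * (ennreal (1 / \<gamma> j) * (\<integral>\<^sup>+x\<in>- {-1..1}. ennreal (ln \<bar>x\<bar>) \<partial>\<pi> j))" for j
  proof -
    have 1: "ennreal ((m j)\<^sup>2 * \<sigma> j / \<gamma> j) = ennreal ((m j)\<^sup>2 / \<gamma> j) * ennreal (\<sigma> j)"
      using \<sigma>_nonneg[of j] \<gamma>_pos[of j] by (simp add: ennreal_mult[symmetric])
    have 3: "ennreal (3 / \<gamma> j) = 3 * ennreal (1 / \<gamma> j)"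
      using \<gamma>_pos[of j] by (simp add: ennreal_mult[symmetric] flip: ennreal_numeral)
    have 2: "ennreal (m j / \<gamma> j) = ennreal (1 / \<gamma> j) * ennreal (m j)"
      using m_pos[of j] \<gamma>_pos[of j] by (simp add: ennreal_mult[symmetric])
    show ?thesis unfolding cost_def 1 2 3 by (simp add: distrib_left mult_ac add_ac)
  qed
  then have "(\<Sum>j. cost j) = (\<Sum>j. ennreal ((m j)\<^sup>2 * \<sigma> j / \<gamma> j)) + (\<Sum>j. ennreal ((m j)\<^sup>2 / \<gamma> j) * (\<integral>\<^sup>+x\<in>{-1..1}. ennreal (x\<^sup>2) \<partial>\<pi> j))
     + 3 * (\<Sum>j. ennreal (m j / \<gamma> j) * emeasure (\<pi> j) (- {-1..1}))
     + 3 * (\<Sum>j. ennreal (1 / \<gamma> j) * (\<integral>\<^sup>+x\<in>- {-1..1}. ennreal (ln \<bar>x\<bar>) \<partial>\<pi> j))"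
    by (simp add: suminf_add[symmetric] summableI ennreal_suminf_cmult)
  moreover have "(\<Sum>j. ennreal ((m j)\<^sup>2 * \<sigma> j / \<gamma> j)) < \<infinity>"
    using b2 \<sigma>_nonneg \<gamma>_pos by (simp add: suminf_ennreal2 less_imp_le)
  ultimately show ?thesis
    using c1 c2 d by (simp add: ennreal_mult_less_top)
qed

definition C :: "nat \<Rightarrow> real" where "C j = enn2real (cost j)"

lemma C_nonneg: "0 \<le> C j" by (simp add: C_def)

lemma cost_eq: "cost j = ennreal (C j)"
proof -
  have "cost j \<le> (\<Sum>j. cost j)"
    using sum_le_suminf[of cost "{j}"] by (simp add: summableI)
  then show ?thesis using suminf_cost by (simp add: C_def le_less_trans)
qed

lemma summable_C: "summable C"
  using suminf_cost C_nonneg by (intro summable_suminf_not_top) (auto simp: cost_eq)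

definition \<psi> :: "nat \<Rightarrow> real \<Rightarrow> complex" where
  "\<psi> j z = levy_exponent 0 (\<sigma> j) (\<pi> j) z"

lemma \<psi>_measurable [measurable]: "\<psi> j \<in> borel_measurable borel"
  unfolding \<psi>_def[abs_def]
  by (rule borel_measurable_continuous_onI[OF levy_exponent_continuous[OF levy_\<pi>]])

lemma \<psi>_continuous: "isCont (\<psi> j) z"
  using levy_exponent_continuous[OF levy_\<pi>] unfolding \<psi>_def[abs_def] by (simp add: continuous_on_eq_continuous_at)

lemma \<psi>_0: "\<psi> j 0 = 0"
  by (simp add: \<psi>_def levy_exponent_def)

lemma \<psi>_bound: "ennreal (cmod (\<psi> j z)) \<le> levy_bound (\<sigma> j) (\<pi> j) z"
  unfolding \<psi>_def by (rule levy_exponent_bound[OF levy_\<pi> \<sigma>_nonneg])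

text \<open>The three parts of the bound grow like \<open>z\<^sup>2\<close>,
  \<open>\<bar>z\<bar>\<close> and a constant, all of which are at most multiples of
  \<open>1 + z\<^sup>2\<close>.\<close>

lemma levy_bound_cost:
  "(\<integral>\<^sup>+s\<in>{0..}. levy_bound (\<sigma> j) (\<pi> j) (m j * z * exp (- \<gamma> j * s)) \<partial>lborel) \<le> ennreal ((1 + z\<^sup>2) * C j)"
proof -
  define E where "E = ennreal (1 + z\<^sup>2)"
  have "ennreal ((m j * z)\<^sup>2 / \<gamma> j) \<le> ennreal ((1 + z\<^sup>2) * ((m j)\<^sup>2 / \<gamma> j))"
    using \<gamma>_pos[of j] by (intro ennreal_leI) (simp add: power_mult_distrib divide_simps algebra_simps)
  also have "\<dots> = ennreal (1 + z\<^sup>2) * ennreal ((m j)\<^sup>2 / \<gamma> j)"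
    using \<gamma>_pos[of j] by (intro ennreal_mult) auto
  finally have 1: "ennreal ((m j * z)\<^sup>2 / \<gamma> j) \<le> ennreal (1 + z\<^sup>2) * ennreal ((m j)\<^sup>2 / \<gamma> j)" .
  have "\<bar>z\<bar> \<le> 1 + z\<^sup>2"
    using zero_le_power2[of "\<bar>z\<bar> - 1"] zero_le_power2[of z] by (simp add: power2_diff algebra_simps del: zero_le_power2) 
  then have "ennreal \<bar>m j * z\<bar> \<le> ennreal ((1 + z\<^sup>2) * m j)"
    using m_pos[of j] by (intro ennreal_leI) (simp add: abs_mult mult.commute)
  also have "\<dots> = ennreal (1 + z\<^sup>2) * ennreal (m j)"
    using m_pos[of j] by (intro ennreal_mult) auto
  finally have 2: "ennreal \<bar>m j * z\<bar> \<le> ennreal (1 + z\<^sup>2) * ennreal (m j)" .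
  have 3: "1 \<le> ennreal (1 + z\<^sup>2)" by simp
  have 3: "x \<le> ennreal (1 + z\<^sup>2) * x" for x
    using mult_right_mono[OF 3, of x] by simp
  have "(\<integral>\<^sup>+s\<in>{0..}. levy_bound (\<sigma> j) (\<pi> j) (m j * z * exp (- \<gamma> j * s)) \<partial>lborel) \<le>
    ennreal ((m j * z)\<^sup>2 / \<gamma> j) * (ennreal (\<sigma> j) + (\<integral>\<^sup>+x\<in>{-1..1}. ennreal (x\<^sup>2) \<partial>\<pi> j)) +
    ennreal (3 / \<gamma> j) * (ennreal \<bar>m j * z\<bar> * emeasure (\<pi> j) (- {-1..1}) + (\<integral>\<^sup>+x\<in>- {-1..1}. ennreal (ln \<bar>x\<bar>) \<partial>\<pi> j))"
    by (rule levy_bound_decay[OF levy_\<pi> \<gamma>_pos])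
  also have "\<dots> \<le> (ennreal (1 + z\<^sup>2) * ennreal ((m j)\<^sup>2 / \<gamma> j)) * (ennreal (\<sigma> j) + (\<integral>\<^sup>+x\<in>{-1..1}. ennreal (x\<^sup>2) \<partial>\<pi> j)) +
    ennreal (3 / \<gamma> j) * ((ennreal (1 + z\<^sup>2) * ennreal (m j)) * emeasure (\<pi> j) (- {-1..1}) + ennreal (1 + z\<^sup>2) * (\<integral>\<^sup>+x\<in>- {-1..1}. ennreal (ln \<bar>x\<bar>) \<partial>\<pi> j))"
    by (intro add_mono mult_right_mono mult_left_mono 1 2 3) auto
  also have "\<dots> = ennreal (1 + z\<^sup>2) * cost j"
    unfolding cost_def E_def[symmetric] by (simp add: distrib_left mult_ac)
  also have "\<dots> = ennreal ((1 + z\<^sup>2) * C j)"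
    unfolding cost_eq by (intro ennreal_mult[symmetric]) (auto simp: C_nonneg)
  finally show ?thesis .
qed

lemma \<psi>_cost: "(\<integral>\<^sup>+s\<in>{0..}. ennreal (cmod (\<psi> j (m j * z * exp (- \<gamma> j * s)))) \<partial>lborel) \<le> ennreal ((1 + z\<^sup>2) * C j)"
  by (rule order_trans[OF nn_integral_mono levy_bound_cost]) (auto simp: indicator_def \<psi>_bound)

lemma \<psi>_integrable: "set_integrable lborel {0..} (\<lambda>s. \<psi> j (m j * z * exp (- \<gamma> j * s)))"
  unfolding set_integrable_def
proof (rule integrableI_bounded)
  have "(\<integral>\<^sup>+s. ennreal (norm (indicator {0..} s *\<^sub>R \<psi> j (m j * z * exp (- \<gamma> j * s)))) \<partial>lborel)
    = (\<integral>\<^sup>+s\<in>{0..}. ennreal (cmod (\<psi> j (m j * z * exp (- \<gamma> j * s)))) \<partial>lborel)"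
    by (intro nn_integral_cong) (auto simp: indicator_def)
  also have "\<dots> < \<infinity>" using \<psi>_cost[of j z] by (rule le_less_trans) simp
  finally show "(\<integral>\<^sup>+s. ennreal (norm (indicator {0..} s *\<^sub>R \<psi> j (m j * z * exp (- \<gamma> j * s)))) \<partial>lborel) < \<infinity>" .
qed measurable

text \<open>An explicit logarithm of the characteristic function of \<open>m j * I j t\<close>:
  products over \<open>j\<close> become sums without any choice of branch.\<close>

definition \<Psi> :: "nat \<Rightarrow> real \<Rightarrow> real \<Rightarrow> complex" where
  "\<Psi> j t z = (CLBINT s:{0..t}. \<psi> j (m j * z * exp (- \<gamma> j * s)))"

definition \<Psi>_lim :: "nat \<Rightarrow> real \<Rightarrow> complex" where
  "\<Psi>_lim j z = (CLBINT s:{0..}. \<psi> j (m j * z * exp (- \<gamma> j * s)))"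

lemma cmod_set_integral_\<psi>:
  assumes "A \<subseteq> {0..}" "A \<in> sets borel"
  shows "ennreal (cmod (CLBINT s:A. \<psi> j (m j * z * exp (- \<gamma> j * s)))) \<le>
    (\<integral>\<^sup>+s\<in>{0..}. ennreal (cmod (\<psi> j (m j * z * exp (- \<gamma> j * s)))) \<partial>lborel)"
proof -
  have "set_integrable lborel A (\<lambda>s. \<psi> j (m j * z * exp (- \<gamma> j * s)))"
    using assms by (intro set_integrable_subset[OF \<psi>_integrable]) auto
  then have "ennreal (cmod (CLBINT s:A. \<psi> j (m j * z * exp (- \<gamma> j * s))))
    \<le> (\<integral>\<^sup>+s. ennreal (norm (indicator A s *\<^sub>R \<psi> j (m j * z * exp (- \<gamma> j * s)))) \<partial>lborel)"
    unfolding set_lebesgue_integral_def set_integrable_def by (rule integral_norm_bound_ennreal)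
  also have "\<dots> \<le> (\<integral>\<^sup>+s\<in>{0..}. ennreal (cmod (\<psi> j (m j * z * exp (- \<gamma> j * s)))) \<partial>lborel)"
    using assms by (intro nn_integral_mono) (auto simp: indicator_def)
  finally show ?thesis .
qed

text \<open>Every time set lies in \<open>{0..}\<close>, so the bound is free of \<open>t\<close>.
  This uniformity drives both the convergence of the series and the interchange of the sum with the
  limit in time.\<close>

lemma \<Psi>_bound: "cmod (\<Psi> j t z) \<le> (1 + z\<^sup>2) * C j"
  and \<Psi>_lim_bound: "cmod (\<Psi>_lim j z) \<le> (1 + z\<^sup>2) * C j"
proof -
  have *: "cmod (CLBINT s:A. \<psi> j (m j * z * exp (- \<gamma> j * s))) \<le> (1 + z\<^sup>2) * C j"
    if "A \<subseteq> {0..}" "A \<in> sets borel" for A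
    using order_trans[OF cmod_set_integral_\<psi>[OF that] \<psi>_cost[of j z]]
    by (subst (asm) ennreal_le_iff) (auto simp: C_nonneg)
  show "cmod (\<Psi> j t z) \<le> (1 + z\<^sup>2) * C j" unfolding \<Psi>_def by (rule *) auto
  show "cmod (\<Psi>_lim j z) \<le> (1 + z\<^sup>2) * C j" unfolding \<Psi>_lim_def by (rule *) auto
qed

lemma \<Psi>_tendsto:
  assumes "filterlim s at_top sequentially"
  shows "(\<lambda>n. \<Psi> j (s n) z) \<longlonglongrightarrow> \<Psi>_lim j z"
  unfolding \<Psi>_def \<Psi>_lim_def set_lebesgue_integral_def
proof (rule integral_dominated_convergence[where w="\<lambda>u. cmod (indicator {0..} u *\<^sub>R \<psi> j (m j * z * exp (- \<gamma> j * u)))"])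
  show "integrable lborel (\<lambda>u. cmod (indicator {0..} u *\<^sub>R \<psi> j (m j * z * exp (- \<gamma> j * u))))"
    using \<psi>_integrable unfolding set_integrable_def by (rule integrable_norm)
  show "AE u in lborel. (\<lambda>n. indicator {0..s n} u *\<^sub>R \<psi> j (m j * z * exp (- \<gamma> j * u)))
      \<longlonglongrightarrow> indicator {0..} u *\<^sub>R \<psi> j (m j * z * exp (- \<gamma> j * u))"
  proof (intro AE_I2 tendsto_eventually)
    fix u :: real
    have "\<forall>\<^sub>F n in sequentially. u \<le> s n" using assms by (simp add: filterlim_at_top)
    then show "\<forall>\<^sub>F n in sequentially. indicator {0..s n} u *\<^sub>R \<psi> j (m j * z * exp (- \<gamma> j * u))
      = indicator {0..} u *\<^sub>R \<psi> j (m j * z * exp (- \<gamma> j * u))"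
      by eventually_elim (auto simp: indicator_def)
  qed
qed (auto simp: indicator_def)

text \<open>Supplies the continuity at 0 that the existence of the limit law rests on. The bound at
  the largest argument \<open>K\<close> dominates along the whole time axis.\<close>

lemma \<Psi>_lim_tendsto_0:
  assumes "Z \<longlonglongrightarrow> 0"
  shows "(\<lambda>n. \<Psi>_lim j (Z n)) \<longlonglongrightarrow> 0"
proof -
  obtain K where K: "\<And>n. \<bar>Z n\<bar> \<le> K"
    using assms by (metis Bseq_def convergentI convergent_imp_Bseq real_norm_def)
  have "(\<lambda>n. \<integral>\<^sup>+s\<in>{0..}. ennreal (cmod (\<psi> j (m j * Z n * exp (- \<gamma> j * s)))) \<partial>lborel) \<longlonglongrightarrow> (\<integral>\<^sup>+s. 0 \<partial>(lborel :: real measure))"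
  proof (rule nn_integral_dominated_convergence[where w="\<lambda>s. levy_bound (\<sigma> j) (\<pi> j) (m j * K * exp (- \<gamma> j * s)) * indicator {0..} s"])
    show "(\<lambda>s. levy_bound (\<sigma> j) (\<pi> j) (m j * K * exp (- \<gamma> j * s)) * indicator {0..} s) \<in> borel_measurable lborel"
    proof -
      note [measurable] = levy_bound_measurable[OF levy_\<pi>, of "\<sigma> j" j]
      show ?thesis by measurable
    qed
    show "(\<integral>\<^sup>+s\<in>{0..}. levy_bound (\<sigma> j) (\<pi> j) (m j * K * exp (- \<gamma> j * s)) \<partial>lborel) < \<infinity>"
      using levy_bound_cost[of j K] by (rule le_less_trans) simp
    show "AE s in lborel. ennreal (cmod (\<psi> j (m j * Z n * exp (- \<gamma> j * s)))) * indicator {0..} s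
      \<le> levy_bound (\<sigma> j) (\<pi> j) (m j * K * exp (- \<gamma> j * s)) * indicator {0..} s" for n
    proof (intro AE_I2 mult_right_mono)
      fix s
      have "\<bar>m j * Z n * exp (- \<gamma> j * s)\<bar> \<le> \<bar>m j * K * exp (- \<gamma> j * s)\<bar>"
        using K[of n] by (auto simp: abs_mult intro!: mult_right_mono mult_left_mono)
      then show "ennreal (cmod (\<psi> j (m j * Z n * exp (- \<gamma> j * s)))) \<le> levy_bound (\<sigma> j) (\<pi> j) (m j * K * exp (- \<gamma> j * s))"
        by (rule order_trans[OF \<psi>_bound levy_bound_mono])
    qed auto
    show "AE s in lborel. (\<lambda>n. ennreal (cmod (\<psi> j (m j * Z n * exp (- \<gamma> j * s)))) * indicator {0..} s) \<longlonglongrightarrow> 0"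
    proof (intro AE_I2)
      fix s :: real
      have "(\<lambda>n. m j * Z n * exp (- \<gamma> j * s)) \<longlonglongrightarrow> m j * 0 * exp (- \<gamma> j * s)"
        by (intro tendsto_intros assms)
      then have "(\<lambda>n. \<psi> j (m j * Z n * exp (- \<gamma> j * s))) \<longlonglongrightarrow> \<psi> j 0"
        by (intro isCont_tendsto_compose[OF \<psi>_continuous]) simp
      then have "(\<lambda>n. cmod (\<psi> j (m j * Z n * exp (- \<gamma> j * s)))) \<longlonglongrightarrow> 0"
        by (simp add: \<psi>_0 tendsto_norm_zero)
      then have "(\<lambda>n. ennreal (cmod (\<psi> j (m j * Z n * exp (- \<gamma> j * s))))) \<longlonglongrightarrow> ennreal 0"
        by (rule tendsto_ennrealI)
      then show "(\<lambda>n. ennreal (cmod (\<psi> j (m j * Z n * exp (- \<gamma> j * s)))) * indicator {0..} s) \<longlonglongrightarrow> 0"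
        by (cases "s \<in> {0..}") auto
    qed
  qed measurable
  then have u: "(\<lambda>n. \<integral>\<^sup>+s\<in>{0..}. ennreal (cmod (\<psi> j (m j * Z n * exp (- \<gamma> j * s)))) \<partial>lborel) \<longlonglongrightarrow> 0"
    by simp
  have "(\<lambda>n. ennreal (cmod (\<Psi>_lim j (Z n)))) \<longlonglongrightarrow> 0"
    unfolding \<Psi>_lim_def
    by (rule tendsto_sandwich[OF _ _ tendsto_const u]) (intro always_eventually allI cmod_set_integral_\<psi>; simp)+
  then have "(\<lambda>n. cmod (\<Psi>_lim j (Z n))) \<longlonglongrightarrow> 0"
    by (subst (asm) ennreal_0[symmetric], subst (asm) tendsto_ennreal_iff) auto
  then show ?thesis by (rule tendsto_norm_zero_cancel)
qed

lemma char_I: "0 \<le> t \<Longrightarrow> char (distr M borel (I j t)) (m j * z) = exp (\<Psi> j t z)"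
  unfolding \<Psi>_def \<psi>_def by (rule char_levy_OU_integral[OF levy I])

text \<open>Read off from the modulus of a characteristic function rather than from the integral.
  The sign lets factors be dropped from a product.\<close>

lemma Re_\<Psi>: "0 \<le> t \<Longrightarrow> Re (\<Psi> j t z) \<le> 0"
proof -
  assume t: "0 \<le> t"
  interpret D: real_distribution "distr M borel (I j t)"
    by (rule real_distribution_distr[OF measurable_I[OF t]])
  have "cmod (exp (\<Psi> j t z)) \<le> 1"
    unfolding char_I[OF t, symmetric] by (rule D.cmod_char_le_1)
  then show ?thesis by simp
qed

text \<open>\<open>I j\<close> is only an almost sure version and may depend on more than the path
  of \<open>\<xi> j\<close>. This limit is a measurable function of that path alone, defined
  everywhere, so independence of the processes carries over directly.\<close>

definition conv :: "nat \<Rightarrow> real \<Rightarrow> 'a \<Rightarrow> real" where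
  "conv j t \<omega> = m j * lim (\<lambda>n. OU_sum (\<gamma> j) t n (\<lambda>s. \<xi> j s \<omega> - a j * s))"

lemma conv_AE: "0 \<le> t \<Longrightarrow> AE \<omega> in M. \<forall>j. conv j t \<omega> = m j * I j t \<omega>"
proof (subst AE_all_countable, intro allI)
  fix j assume t: "0 \<le> t"
  show "AE \<omega> in M. conv j t \<omega> = m j * I j t \<omega>"
    using RS_integral[OF t, of j]
  proof eventually_elim
    case (elim \<omega>)
    show ?case unfolding conv_def using limI[OF OU_sum_tendsto[OF elim t]] by simp
  qed
qed

lemma conv_indep: 
  assumes t: "0 \<le> t"
  shows "indep_vars (\<lambda>_. borel) (\<lambda>j. conv j t) UNIV"
proof -
  let ?P = "Pi\<^sub>M {0..} (\<lambda>_. borel :: real measure)"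
  let ?F = "\<lambda>j (f :: real \<Rightarrow> real). m j * lim (\<lambda>n. OU_sum (\<gamma> j) t n (\<lambda>s. f s - a j * s))"
  have "indep_vars (\<lambda>_. ?P) (\<lambda>j \<omega>. \<lambda>s\<in>{0..}. \<xi> j s \<omega>) UNIV"
    using indep by (simp add: indep_processes_def)
  moreover have "?F j \<in> borel_measurable ?P" for j
  proof -
    have [measurable]: "(\<lambda>f. f (grid t n i)) \<in> borel_measurable ?P" for n i
      by (rule measurable_component_singleton) (use grid_nonneg[OF t] in auto)
    have "(\<lambda>f. OU_sum (\<gamma> j) t n (\<lambda>s. f s - a j * s)) \<in> borel_measurable ?P" for n
      unfolding OU_sum_def by measurable
    then show ?thesis
      by (intro borel_measurable_times borel_measurable_const borel_measurable_lim_metric)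
  qed
  ultimately have "indep_vars (\<lambda>_. borel) (\<lambda>j \<omega>. ?F j (\<lambda>s\<in>{0..}. \<xi> j s \<omega>)) UNIV"
    by (rule indep_vars_compose2)
  also have "(\<lambda>j \<omega>. ?F j (\<lambda>s\<in>{0..}. \<xi> j s \<omega>)) = (\<lambda>j. conv j t)"
    using grid_nonneg[OF t] by (simp add: fun_eq_iff conv_def OU_sum_def)
  finally show ?thesis .
qed

lemma conv_measurable: "0 \<le> t \<Longrightarrow> conv j t \<in> borel_measurable M"
  using conv_indep by (auto simp: indep_vars_def)

lemma char_conv:
  assumes t: "0 \<le> t"
  shows "char (distr M borel (conv j t)) z = exp (\<Psi> j t z)"
proof -
  have "distr M borel (conv j t) = distr M borel (\<lambda>\<omega>. 0 + m j * I j t \<omega>)"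
    using conv_AE[OF t] conv_measurable[OF t] measurable_I[OF t]
    by (intro distr_cong_AE) (auto elim: eventually_mono)
  also have "\<dots> = distr (distr M borel (I j t)) borel (\<lambda>y. 0 + m j * y)"
    using measurable_I[OF t] by (subst distr_distr) (auto simp: comp_def)
  finally show ?thesis
    using measurable_I[OF t] char_I[OF t] by (simp add: char_distr_affine real_distribution_distr del: add_0)
qed

lemma char_conv_sum:
  assumes t: "0 \<le> t" and "finite A"
  shows "char (distr M borel (\<lambda>\<omega>. \<Sum>j\<in>A. conv j t \<omega>)) z = exp (\<Sum>j\<in>A. \<Psi> j t z)"
proof -
  have "indep_vars (\<lambda>_. borel) (\<lambda>j. conv j t) A"
    by (rule indep_vars_subset[OF conv_indep[OF t]]) simp
  then show ?thesis using assms by (simp add: char_distr_sum char_conv exp_sum)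
qed

text \<open>The exponents of a block add up, so its probability of being large is at most a constant
  times the corresponding block of the summable sequence \<open>C\<close>.\<close>

lemma conv_summable:
  assumes t: "0 \<le> t"
  shows "AE \<omega> in M. summable (\<lambda>j. conv j t \<omega>)"
proof (rule indep_series_AE_summable[OF conv_indep[OF t]])
  note [measurable] = conv_measurable[OF t]
  fix c e :: real assume c: "0 < c" and e: "0 < e"
  have tail: "prob {\<omega>\<in>space M. c \<le> \<bar>\<Sum>j=k..<n. conv j t \<omega>\<bar>} \<le> gauss_const * ((1 + 1 / c\<^sup>2) * (\<Sum>j=k..<n. C j))" for k n
  proof -
    let ?\<mu> = "distr M borel (\<lambda>\<omega>. \<Sum>j=k..<n. conv j t \<omega>)"
    have "prob {\<omega>\<in>space M. c \<le> \<bar>\<Sum>j=k..<n. conv j t \<omega>\<bar>} = measure ?\<mu> {y. c \<le> \<bar>y\<bar>}"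
      by (subst measure_distr) (auto intro!: arg_cong[where f=prob])
    also have "\<dots> \<le> gauss_const * ((1 + 1 / c\<^sup>2) * (\<Sum>j=k..<n. C j))"
    proof (rule measure_tail_le_quadratic[OF _ c])
      show "real_distribution ?\<mu>" by (rule real_distribution_distr) measurable
      fix z
      have "cmod (1 - char ?\<mu> z) \<le> cmod (\<Sum>j=k..<n. \<Psi> j t z)"
        unfolding char_conv_sum[OF t finite_atLeastLessThan]
        by (rule cmod_one_minus_exp_le) (auto intro!: sum_nonpos Re_\<Psi> t)
      also have "\<dots> \<le> (\<Sum>j=k..<n. (1 + z\<^sup>2) * C j)"
        by (rule sum_norm_le) (rule \<Psi>_bound)
      finally show "cmod (1 - char ?\<mu> z) \<le> (1 + z\<^sup>2) * (\<Sum>j=k..<n. C j)"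
        by (simp add: sum_distrib_left)
    qed
    finally show ?thesis .
  qed
  define K where "K = gauss_const * (1 + 1 / c\<^sup>2)"
  have K: "0 < K" using gauss_const_pos by (auto simp: K_def intro!: mult_pos_pos add_pos_nonneg)
  obtain N where N: "\<And>k n. N \<le> k \<Longrightarrow> norm (\<Sum>j=k..<n. C j) < e / K"
    using summable_C e K unfolding summable_Cauchy by (meson divide_pos_pos)
  have "prob {\<omega>\<in>space M. c \<le> \<bar>\<Sum>j=k..<n. conv j t \<omega>\<bar>} \<le> e" if "N \<le> k" for k n
  proof -
    have "K * (\<Sum>j=k..<n. C j) \<le> K * (e / K)"
      using N[OF that, of n] K by (intro mult_left_mono) auto
    also have "\<dots> = e" using K by simp
    also have "K * (\<Sum>j=k..<n. C j) = gauss_const * ((1 + 1 / c\<^sup>2) * (\<Sum>j=k..<n. C j))"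
      by (simp add: K_def mult.assoc)
    finally show ?thesis using tail[of k n] by linarith
  qed
  then show "\<exists>N. \<forall>m\<ge>N. \<forall>n\<ge>m. prob {\<omega>\<in>space M. c \<le> \<bar>\<Sum>j=m..<n. conv j t \<omega>\<bar>} \<le> e" by blast
qed

lemma I_summable:
  assumes t: "0 \<le> t"
  shows "AE \<omega> in M. summable (\<lambda>j. m j * I j t \<omega>)"
  using conv_summable[OF t] conv_AE[OF t] by eventually_elim simp

lemma superposition_I_measurable: "0 \<le> t \<Longrightarrow> superposition m I t \<in> borel_measurable M"
  unfolding superposition_def[abs_def] using measurable_I by measurable

abbreviation law_I :: "real \<Rightarrow> real measure" where
  "law_I \<equiv> superposition_law M m I"

lemma real_distribution_law_I: "0 \<le> t \<Longrightarrow> real_distribution (law_I t)"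
  unfolding superposition_law_def by (intro real_distribution_distr superposition_I_measurable)

lemma summable_\<Psi>: "summable (\<lambda>j. \<Psi> j t z)"
  by (rule summable_comparison_test[OF _ summable_mult[OF summable_C]]) (use \<Psi>_bound in blast)

lemma char_partial_tendsto:
  assumes t: "0 \<le> t"
  shows "(\<lambda>n. exp (\<Sum>j<n. \<Psi> j t z)) \<longlonglongrightarrow> char (law_I t) z"
proof -
  note [measurable] = conv_measurable[OF t] superposition_I_measurable[OF t]
  have "(\<lambda>n. CLINT \<omega>|M. iexp (z * (\<Sum>j<n. conv j t \<omega>))) \<longlonglongrightarrow> (CLINT \<omega>|M. iexp (z * superposition m I t \<omega>))"
  proof (rule integral_dominated_convergence[where w="\<lambda>_. 1"])
    show "AE \<omega> in M. (\<lambda>n. iexp (z * (\<Sum>j<n. conv j t \<omega>))) \<longlonglongrightarrow> iexp (z * superposition m I t \<omega>)"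
      using conv_summable[OF t] conv_AE[OF t]
    proof eventually_elim
      case (elim \<omega>)
      then have "(\<lambda>n. \<Sum>j<n. conv j t \<omega>) \<longlonglongrightarrow> superposition m I t \<omega>"
        using summable_LIMSEQ[OF elim(1)] by (simp add: superposition_def)
      then show ?case by (intro tendsto_intros)
    qed
  qed auto
  also have "(CLINT \<omega>|M. iexp (z * superposition m I t \<omega>)) = char (law_I t) z"
    by (simp add: char_def superposition_law_def integral_distr)
  also have "(\<lambda>n. CLINT \<omega>|M. iexp (z * (\<Sum>j<n. conv j t \<omega>))) = (\<lambda>n. exp (\<Sum>j<n. \<Psi> j t z))"
    unfolding char_conv_sum[OF t finite_lessThan, symmetric] char_def by (simp add: integral_distr)
  finally show ?thesis .
qed

lemma char_law_I: "0 \<le> t \<Longrightarrow> char (law_I t) z = exp (\<Sum>j. \<Psi> j t z)"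
  using tendsto_exp[OF summable_LIMSEQ[OF summable_\<Psi>]] char_partial_tendsto LIMSEQ_unique by blast

text \<open>All other independent factors have modulus at most 1. Through this estimate condition
  (H) for one summand governs the whole superposition.\<close>

lemma cmod_char_law_I_le:
  assumes t: "0 \<le> t"
  shows "cmod (char (law_I t) z) \<le> cmod (char (distr M borel (I k t)) (m k * z))"
proof (rule LIMSEQ_le_const2[OF tendsto_norm[OF char_partial_tendsto[OF t]]], intro exI allI impI)
  \<comment> \<open>From \<open>Suc k\<close> on, the partial sum over \<open>{..<n}\<close>
    contains the index \<open>k\<close>.\<close>
  fix n assume "Suc k \<le> n"
  then have "(\<Sum>j<n. Re (\<Psi> j t z)) = Re (\<Psi> k t z) + (\<Sum>j\<in>{..<n} - {k}. Re (\<Psi> j t z))"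
    by (intro sum.remove) auto
  also have "\<dots> \<le> Re (\<Psi> k t z) + 0"
    using Re_\<Psi>[OF t] by (intro add_left_mono sum_nonpos) auto
  finally show "cmod (exp (\<Sum>j<n. \<Psi> j t z)) \<le> cmod (char (distr M borel (I k t)) (m k * z))"
    by (simp add: char_I[OF t])
qed

lemma \<Psi>_sum_tendsto:
  assumes "filterlim s at_top sequentially"
  shows "(\<lambda>n. exp (\<Sum>j. \<Psi> j (s n) z)) \<longlonglongrightarrow> exp (\<Sum>j. \<Psi>_lim j z)"
  by (intro tendsto_exp tannery[OF \<Psi>_tendsto[OF assms] \<Psi>_bound] summable_mult summable_C)

lemma \<Psi>_lim_isCont: "isCont (\<lambda>z. exp (\<Sum>j. \<Psi>_lim j z)) 0"
proof (unfold continuous_at_sequentially comp_def, intro allI impI)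
  fix Z :: "nat \<Rightarrow> real" assume Z: "Z \<longlonglongrightarrow> 0"
  obtain K where K: "\<And>n. \<bar>Z n\<bar> \<le> K"
    using Z by (metis Bseq_def convergentI convergent_imp_Bseq real_norm_def)
  have K2: "(Z n)\<^sup>2 \<le> K\<^sup>2" for n
    using K[of n] by (metis abs_ge_zero power2_abs power_mono)
  have z0: "\<Psi>_lim j 0 = 0" for j by (simp add: \<Psi>_lim_def \<psi>_0)
  have "(\<lambda>n. \<Sum>j. \<Psi>_lim j (Z n)) \<longlonglongrightarrow> (\<Sum>j. \<Psi>_lim j 0)"
  proof (rule tannery[where B="\<lambda>j. (1 + K\<^sup>2) * C j"])
    show "(\<lambda>n. \<Psi>_lim j (Z n)) \<longlonglongrightarrow> \<Psi>_lim j 0" for j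
      using \<Psi>_lim_tendsto_0[OF Z] by (simp add: z0)
    show "norm (\<Psi>_lim j (Z n)) \<le> (1 + K\<^sup>2) * C j" for n j
      by (rule order_trans[OF \<Psi>_lim_bound mult_right_mono[OF _ C_nonneg]]) (simp add: K2)
  qed (intro summable_mult summable_C)
  then show "(\<lambda>n. exp (\<Sum>j. \<Psi>_lim j (Z n))) \<longlonglongrightarrow> exp (\<Sum>j. \<Psi>_lim j 0)"
    by (rule tendsto_exp)
qed

text \<open>\<open>limit_law\<close> is a definite description, so nothing is known of it before a
  limit is exhibited. Integer times produce a law with the right transform; convergence along all
  sequences of times and uniqueness then identify it.\<close>

lemma real_distribution_limit_I: "real_distribution (limit_law law_I)"
  and char_limit_I: "char (limit_law law_I) = (\<lambda>z. exp (\<Sum>j. \<Psi>_lim j z))"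
  and converges_in_law_I: "converges_in_law law_I (limit_law law_I)"
proof -
  have lim: "(\<lambda>n. char (law_I (s n)) z) \<longlonglongrightarrow> exp (\<Sum>j. \<Psi>_lim j z)"
    if "\<And>n. 0 \<le> s n" "filterlim s at_top sequentially" for s z
    using \<Psi>_sum_tendsto[OF that(2)] that(1) by (simp add: char_law_I)
  have "\<exists>L. real_distribution L \<and> char L = (\<lambda>z. exp (\<Sum>j. \<Psi>_lim j z))"
  proof (rule limit_distribution_exists[where \<mu>="\<lambda>n. law_I (real n)"])
    show "(\<lambda>n. char (law_I (real n)) z) \<longlonglongrightarrow> exp (\<Sum>j. \<Psi>_lim j z)" for z
      by (rule lim[OF _ filterlim_real_sequentially]) simp
  qed (auto intro: real_distribution_law_I \<Psi>_lim_isCont)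
  then obtain L where L: "real_distribution L" "char L = (\<lambda>z. exp (\<Sum>j. \<Psi>_lim j z))" by blast
  have conv: "converges_in_law law_I L"
    by (intro converges_in_lawI L real_distribution_law_I) (auto simp: L(2) intro!: lim)
  have "limit_law law_I = L" by (rule limit_law_eqI[OF conv real_distribution_law_I])
  then show "real_distribution (limit_law law_I)" "char (limit_law law_I) = (\<lambda>z. exp (\<Sum>j. \<Psi>_lim j z))"
    "converges_in_law law_I (limit_law law_I)"
    using L conv by auto
qed

lemma char_law_I_tendsto:
  assumes "\<And>n. 0 \<le> s n" "filterlim s at_top sequentially"
  shows "(\<lambda>n. char (law_I (s n)) z) \<longlonglongrightarrow> char (limit_law law_I) z"
  using \<Psi>_sum_tendsto[OF assms(2)] assms(1) by (simp add: char_law_I char_limit_I)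

end

section \<open>Condition (H) and convergence of shifted laws in total variation\<close>

lemma nn_integral_tail_scale:
  fixes f :: "real \<Rightarrow> ennreal"
  assumes "0 < k" and [measurable]: "f \<in> borel_measurable borel"
  shows "(\<integral>\<^sup>+l\<in>{l. R / k < \<bar>l\<bar>}. f (k * l) \<partial>lborel) = ennreal (1 / k) * (\<integral>\<^sup>+l\<in>{l. R < \<bar>l\<bar>}. f l \<partial>lborel)"
proof -
  have "(\<integral>\<^sup>+l\<in>{l. R < \<bar>l\<bar>}. f l \<partial>lborel) = ennreal \<bar>k\<bar> * (\<integral>\<^sup>+l. f (0 + k * l) * indicator {l. R < \<bar>l\<bar>} (0 + k * l) \<partial>lborel)"
    by (rule nn_integral_real_affine) (use assms in auto)
  also have "(\<integral>\<^sup>+l. f (0 + k * l) * indicator {l. R < \<bar>l\<bar>} (0 + k * l) \<partial>lborel) = (\<integral>\<^sup>+l\<in>{l. R / k < \<bar>l\<bar>}. f (k * l) \<partial>lborel)"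
    using assms by (intro nn_integral_cong) (auto simp: indicator_def abs_mult field_simps)
  finally have "ennreal (1 / k) * (\<integral>\<^sup>+l\<in>{l. R < \<bar>l\<bar>}. f l \<partial>lborel) = ennreal (1 / k * k) * (\<integral>\<^sup>+l\<in>{l. R / k < \<bar>l\<bar>}. f (k * l) \<partial>lborel)"
    using assms by (simp add: ennreal_mult[symmetric] mult.assoc[symmetric])
  then show ?thesis using assms by simp
qed

text \<open>Continuity of translation at 0: the factors \<open>iexp (b n * l)\<close> tend to 1
  pointwise and twice the modulus of \<open>char L\<close> dominates. It gives the behaviour of the
  profile at plus infinity.\<close>

lemma tv_dist_shift_to_0:
  assumes L: "real_distribution L" and int: "integrable lborel (char L)" and b: "b \<longlonglongrightarrow> 0"
  shows "(\<lambda>n. tv_dist (distr L borel (\<lambda>y. b n + y)) L) \<longlonglongrightarrow> 0"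
proof (rule tv_dist_tendsto_0)
  interpret L: real_distribution L by (rule L)
  have ch: "char (distr L borel (\<lambda>y. b n + y)) l = iexp (b n * l) * char L l" for n l
    using char_distr_affine[OF L, of "b n" 1 l] by simp
  show "real_distribution (distr L borel (\<lambda>y. b n + y))" for n
    by (intro real_distribution_distr_real L) simp
  show "integrable lborel (char (distr L borel (\<lambda>y. b n + y)))" for n
  proof (rule Bochner_Integration.integrable_bound[OF int])
    interpret D: real_distribution "distr L borel (\<lambda>y. b n + y)"
      by (intro real_distribution_distr_real L) simp
    show "char (distr L borel (\<lambda>y. b n + y)) \<in> borel_measurable lborel"
      using D.char_measurable by simp
  qed (simp add: ch norm_mult)
  have "(\<lambda>n. LBINT l. cmod (iexp (b n * l) * char L l - char L l)) \<longlonglongrightarrow> (\<integral>l. (0::real) \<partial>(lborel :: real measure))"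
  proof (rule integral_dominated_convergence[where w="\<lambda>l. 2 * cmod (char L l)"])
    have "(\<lambda>n. cmod (iexp (b n * l) * char L l - char L l)) \<longlonglongrightarrow> cmod (iexp (0 * l) * char L l - char L l)" for l
      by (intro tendsto_intros b)
    then show "AE l in lborel. (\<lambda>n. cmod (iexp (b n * l) * char L l - char L l)) \<longlonglongrightarrow> 0"
      by simp
    have "cmod (iexp (b n * l) * char L l - char L l) \<le> 2 * cmod (char L l)" for n l
      using norm_triangle_ineq4[of "iexp (b n * l) * char L l" "char L l"] by (simp add: norm_mult)
    then show "AE l in lborel. norm (cmod (iexp (b n * l) * char L l - char L l)) \<le> 2 * cmod (char L l)" for n
      by simp
  qed (use int in auto)
  then show "(\<lambda>n. LBINT l. cmod (char (distr L borel (\<lambda>y. b n + y)) l - char L l)) \<longlonglongrightarrow> 0"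
    by (simp add: ch)
qed (use L int in auto)

context OU_superposition
begin

lemma tails_law_I:
  assumes H: "condition_H (\<lambda>t. distr M borel (I k t))" and s: "filterlim s at_top sequentially" "\<And>n. 0 < s n" and e: "0 < e"
  shows "\<exists>R>0. \<forall>\<^sub>F n in sequentially. (\<integral>\<^sup>+l\<in>{l. R < \<bar>l\<bar>}. ennreal (cmod (char (law_I (s n)) l)) \<partial>lborel) \<le> ennreal e"
proof -
  obtain t0 :: "real \<Rightarrow> real" where t0: "((\<lambda>R. SUP s\<in>{t0 R<..}. \<integral>\<^sup>+l\<in>{l. R < \<bar>l\<bar>}. ennreal (cmod (char (distr M borel (I k s)) l)) \<partial>lborel)
           \<longlongrightarrow> 0) at_top"
    using H unfolding condition_H_def by blast
  have "\<forall>\<^sub>F R in at_top. (SUP s\<in>{t0 R<..}. \<integral>\<^sup>+l\<in>{l. R < \<bar>l\<bar>}. ennreal (cmod (char (distr M borel (I k s)) l)) \<partial>lborel) < ennreal (e * m k)"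
    using e m_pos[of k] by (intro order_tendstoD(2)[OF t0]) simp
  then have "\<exists>R>0. (SUP s\<in>{t0 R<..}. \<integral>\<^sup>+l\<in>{l. R < \<bar>l\<bar>}. ennreal (cmod (char (distr M borel (I k s)) l)) \<partial>lborel) < ennreal (e * m k)"
    using eventually_happens[OF eventually_conj[OF _ eventually_gt_at_top[of 0]]] by fastforce
  then obtain R where R: "0 < R" "(SUP s\<in>{t0 R<..}. \<integral>\<^sup>+l\<in>{l. R < \<bar>l\<bar>}. ennreal (cmod (char (distr M borel (I k s)) l)) \<partial>lborel) < ennreal (e * m k)"
    by blast
  have ev: "\<forall>\<^sub>F n in sequentially. t0 R < s n"
    using s(1) by (simp add: filterlim_at_top_dense)
  show ?thesis
  \<comment> \<open>The summand enters with argument \<open>m k * l\<close>: this rescales the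
    cut-off \<open>R\<close> to \<open>R / m k\<close> and multiplies the tail by
    \<open>1 / m k\<close>, which is why the tail was made smaller than
    \<open>e * m k\<close>.\<close>
  proof (intro exI[of _ "R / m k"] conjI)
    show "0 < R / m k" using R m_pos by simp
    show "\<forall>\<^sub>F n in sequentially. (\<integral>\<^sup>+l\<in>{l. R / m k < \<bar>l\<bar>}. ennreal (cmod (char (law_I (s n)) l)) \<partial>lborel) \<le> ennreal e"
      using ev
    proof eventually_elim
      case (elim n)
      have sn: "0 \<le> s n" using s(2)[of n] by simp
      interpret D: real_distribution "distr M borel (I k (s n))"
        by (rule real_distribution_distr[OF measurable_I[OF sn]])
      have "(\<integral>\<^sup>+l\<in>{l. R / m k < \<bar>l\<bar>}. ennreal (cmod (char (law_I (s n)) l)) \<partial>lborel)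
        \<le> (\<integral>\<^sup>+l\<in>{l. R / m k < \<bar>l\<bar>}. ennreal (cmod (char (distr M borel (I k (s n))) (m k * l))) \<partial>lborel)"
        by (intro nn_integral_mono mult_right_mono ennreal_leI cmod_char_law_I_le sn) auto
      also have "\<dots> = ennreal (1 / m k) * (\<integral>\<^sup>+l\<in>{l. R < \<bar>l\<bar>}. ennreal (cmod (char (distr M borel (I k (s n))) l)) \<partial>lborel)"
        by (rule nn_integral_tail_scale[OF m_pos]) measurable
      also have "\<dots> \<le> ennreal (1 / m k) * ennreal (e * m k)"
        by (intro mult_left_mono order_trans[OF SUP_upper less_imp_le[OF R(2)]]) (use elim in auto)
      also have "\<dots> = ennreal e"
        using m_pos[of k] e by (simp add: ennreal_mult[symmetric])
      finally show ?case .
    qed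
  qed
qed

lemma integrable_char_law_I:
  assumes H: "condition_H (\<lambda>t. distr M borel (I k t))" and t: "0 < t"
  shows "integrable lborel (char (law_I t))"
proof (rule Bochner_Integration.integrable_bound)
  interpret D: real_distribution "law_I t" using t by (intro real_distribution_law_I) simp
  have "integrable lborel (char (distr M borel (I k t)))"
    using H t by (simp add: condition_H_def)
  then have "integrable lborel (\<lambda>l. char (distr M borel (I k t)) (0 + m k * l))"
    using m_pos[of k] by (intro lborel_integrable_real_affine) auto
  then show "integrable lborel (\<lambda>l. char (distr M borel (I k t)) (m k * l))" by simp
  show "char (law_I t) \<in> borel_measurable lborel" by simp
  show "AE l in lborel. cmod (char (law_I t) l) \<le> cmod (char (distr M borel (I k t)) (m k * l))"
    using t by (intro AE_I2 cmod_char_law_I_le) simp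
qed

text \<open>A shift multiplies the characteristic function by a factor of modulus 1, so tails and
  integrability are unaffected and the L1 argument covers the moving shift as well. The triangle
  inequality then turns convergence of the laws into convergence of their distances to
  \<open>L\<close>.\<close>

lemma shifted_law_I_tendsto:
  assumes H: "condition_H (\<lambda>t. distr M borel (I k t))" and s: "filterlim s at_top sequentially" "\<And>n. 0 < s n"
    and b: "b \<longlonglongrightarrow> b0" and L: "L = limit_law law_I"
  shows "(\<lambda>n. tv_dist (distr (law_I (s n)) borel (\<lambda>y. b n + y)) L) \<longlonglongrightarrow> tv_dist (distr L borel (\<lambda>y. b0 + y)) L"
    and "integrable lborel (char L)"
proof -
  have s0: "0 \<le> s n" for n using s(2)[of n] by simp
  note rdI = real_distribution_law_I[OF s0]
  have rdL: "real_distribution L" and lim: "(\<lambda>n. char (law_I (s n)) z) \<longlonglongrightarrow> char L z" for z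
    unfolding L using char_law_I_tendsto[of s] s s0 real_distribution_limit_I by auto
  define \<mu> where "\<mu> n = distr (law_I (s n)) borel (\<lambda>y. b n + y)" for n
  define \<nu> where "\<nu> = distr L borel (\<lambda>y. b0 + y)"
  have ch\<mu>: "char (\<mu> n) l = iexp (b n * l) * char (law_I (s n)) l" for n l
    using char_distr_affine[OF rdI, of n "b n" 1 l] by (simp add: \<mu>_def)
  have ch\<nu>: "char \<nu> l = iexp (b0 * l) * char L l" for l
    using char_distr_affine[OF rdL, of b0 1 l] by (simp add: \<nu>_def)
  have rd\<mu>: "real_distribution (\<mu> n)" for n unfolding \<mu>_def by (intro real_distribution_distr_real rdI) simp
  have rd\<nu>: "real_distribution \<nu>" unfolding \<nu>_def by (intro real_distribution_distr_real rdL) simp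
  have int\<mu>: "integrable lborel (char (\<mu> n))" for n
  proof (rule Bochner_Integration.integrable_bound[OF integrable_char_law_I[OF H s(2)[of n]]])
    interpret D: real_distribution "\<mu> n" by (rule rd\<mu>)
    show "char (\<mu> n) \<in> borel_measurable lborel" by simp
  qed (simp add: ch\<mu> norm_mult)
  have lim\<mu>: "(\<lambda>n. char (\<mu> n) l) \<longlonglongrightarrow> char \<nu> l" for l
    unfolding ch\<mu> ch\<nu> by (intro tendsto_intros b lim)
  have tails: "\<exists>R>0. \<forall>\<^sub>F n in sequentially. (\<integral>\<^sup>+l\<in>{l. R < \<bar>l\<bar>}. ennreal (cmod (char (\<mu> n) l)) \<partial>lborel) \<le> ennreal e"
    if "0 < e" for e :: real
    using tails_law_I[OF H s that] by (simp add: ch\<mu> norm_mult)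
  note conv = char_L1_convergence[OF rd\<mu> rd\<nu> int\<mu> lim\<mu> tails]
  show "integrable lborel (char L)"
  proof (rule Bochner_Integration.integrable_bound[OF conv(1)])
    interpret D: real_distribution L by (rule rdL)
    show "char L \<in> borel_measurable lborel" by simp
    show "AE l in lborel. cmod (char L l) \<le> cmod (char \<nu> l)"
      by (intro AE_I2) (simp only: ch\<nu> norm_mult norm_exp_i_times mult_1 order_refl)
  qed
  have 1: "(\<lambda>n. tv_dist (\<mu> n) \<nu>) \<longlonglongrightarrow> 0"
    by (rule tv_dist_tendsto_0[OF rd\<mu> rd\<nu> int\<mu> conv])
  have 2: "\<bar>tv_dist (\<mu> n) L - tv_dist \<nu> L\<bar> \<le> tv_dist (\<mu> n) \<nu>" for n
    using tv_dist_triangle[OF rd\<mu> rd\<nu> rdL, of n] tv_dist_triangle[OF rd\<nu> rd\<mu> rdL, of n] tv_dist_commute[of \<nu> "\<mu> n"]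
    by linarith
  have "(\<lambda>n. \<bar>tv_dist (\<mu> n) L - tv_dist \<nu> L\<bar>) \<longlonglongrightarrow> 0"
    by (rule tendsto_sandwich[OF _ _ tendsto_const 1]) (use 2 in auto)
  then have "(\<lambda>n. tv_dist (\<mu> n) L - tv_dist \<nu> L) \<longlonglongrightarrow> 0"
    by (rule tendsto_rabs_zero_cancel)
  then show "(\<lambda>n. tv_dist (distr (law_I (s n)) borel (\<lambda>y. b n + y)) L) \<longlonglongrightarrow> tv_dist (distr L borel (\<lambda>y. b0 + y)) L"
    unfolding \<mu>_def \<nu>_def by (rule LIM_zero_cancel)
qed

end

section \<open>The solutions as affine images of the superposed convolutions\<close>

locale OU_superposition_solution = OU_superposition +
  fixes X :: "real \<Rightarrow> nat \<Rightarrow> real \<Rightarrow> 'a \<Rightarrow> real" and x :: "nat \<Rightarrow> real"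
  assumes X: "\<And>\<epsilon> j. 0 < \<epsilon> \<Longrightarrow> OU_solution M (\<xi> j) (\<gamma> j) (x j) \<epsilon> (X \<epsilon> j)"
    and a: "summable (\<lambda>j. m j * \<bar>x j\<bar>)"
    and b1: "summable (\<lambda>j. m j * \<bar>a j\<bar> / \<gamma> j)"
begin

text \<open>\<open>start\<close> and \<open>drift\<close> are the functions \<open>D\<close> and
  \<open>A\<close> of the overview, and \<open>drift_lim\<close> is the value of \<open>A\<close> at
  infinity.\<close>

definition start :: "real \<Rightarrow> real" where
  "start t = (\<Sum>j. m j * (exp (- \<gamma> j * t) * x j))"

definition drift :: "real \<Rightarrow> real" where
  "drift t = (\<Sum>j. m j * (a j * (1 - exp (- \<gamma> j * t)) / \<gamma> j))"

definition drift_lim :: real where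
  "drift_lim = (\<Sum>j. m j * (a j / \<gamma> j))"

lemma start_term_bound: "0 \<le> t \<Longrightarrow> \<bar>m j * (exp (- \<gamma> j * t) * x j)\<bar> \<le> m j * \<bar>x j\<bar>"
  using m_pos[of j] \<gamma>_pos[of j] by (simp add: abs_mult mult_left_le_one_le)

lemma drift_term_bound: "0 \<le> t \<Longrightarrow> \<bar>m j * (a j * (1 - exp (- \<gamma> j * t)) / \<gamma> j)\<bar> \<le> m j * \<bar>a j\<bar> / \<gamma> j"
proof -
  assume t: "0 \<le> t"
  have e: "0 \<le> 1 - exp (- \<gamma> j * t)" "1 - exp (- \<gamma> j * t) \<le> 1" using \<gamma>_pos[of j] t by auto
  have "\<bar>m j * (a j * (1 - exp (- \<gamma> j * t)) / \<gamma> j)\<bar> = m j * \<bar>a j\<bar> / \<gamma> j * (1 - exp (- \<gamma> j * t))"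
    using m_pos[of j] \<gamma>_pos[of j] e(1) by (simp add: abs_mult)
  also have "\<dots> \<le> m j * \<bar>a j\<bar> / \<gamma> j * 1"
    using m_pos[of j] \<gamma>_pos[of j] e by (intro mult_left_mono) auto
  finally show ?thesis by simp
qed

lemma start_summable: "0 \<le> t \<Longrightarrow> summable (\<lambda>j. m j * (exp (- \<gamma> j * t) * x j))"
  by (rule summable_comparison_test[OF _ a]) (use start_term_bound in auto)

lemma drift_summable: "0 \<le> t \<Longrightarrow> summable (\<lambda>j. m j * (a j * (1 - exp (- \<gamma> j * t)) / \<gamma> j))"
  by (rule summable_comparison_test[OF _ b1]) (use drift_term_bound in auto)

lemma exp_decay_tendsto:
  fixes g :: real
  assumes "0 < g" "filterlim s at_top sequentially"
  shows "(\<lambda>n. exp (- g * s n)) \<longlonglongrightarrow> 0"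
proof -
  have "((\<lambda>u. exp (- g * u)) \<longlongrightarrow> 0) at_top" using assms(1) by real_asymp
  then show ?thesis by (rule filterlim_compose) (rule assms(2))
qed

lemma start_tendsto:
  assumes "\<And>n. 0 \<le> s n" "filterlim s at_top sequentially"
  shows "(\<lambda>n. start (s n)) \<longlonglongrightarrow> 0"
proof -
  have "(\<lambda>n. start (s n)) \<longlonglongrightarrow> (\<Sum>j. m j * (0 * x j))"
    unfolding start_def
  proof (rule tannery[OF _ _ a])
    show "(\<lambda>n. m j * (exp (- \<gamma> j * s n) * x j)) \<longlonglongrightarrow> m j * (0 * x j)" for j
      by (intro tendsto_intros exp_decay_tendsto \<gamma>_pos assms)
  qed (use start_term_bound assms in auto)
  then show ?thesis by simp
qed

lemma drift_tendsto:
  assumes "\<And>n. 0 \<le> s n" "filterlim s at_top sequentially"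
  shows "(\<lambda>n. drift (s n)) \<longlonglongrightarrow> drift_lim"
proof -
  have g0: "\<gamma> j \<noteq> 0" for j using \<gamma>_pos[of j] by simp
  have "(\<lambda>n. drift (s n)) \<longlonglongrightarrow> (\<Sum>j. m j * (a j * (1 - 0) / \<gamma> j))"
    unfolding drift_def
  proof (rule tannery[OF _ _ b1])
    show "(\<lambda>n. m j * (a j * (1 - exp (- \<gamma> j * s n)) / \<gamma> j)) \<longlonglongrightarrow> m j * (a j * (1 - 0) / \<gamma> j)" for j
      by (intro tendsto_intros exp_decay_tendsto \<gamma>_pos assms g0)
    show "norm (m j * (a j * (1 - exp (- \<gamma> j * s n)) / \<gamma> j)) \<le> m j * \<bar>a j\<bar> / \<gamma> j" for n j
      unfolding real_norm_def by (rule drift_term_bound[OF assms(1)])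
  qed
  then show ?thesis by (simp add: drift_lim_def)
qed

lemma X_explicit:
  assumes \<epsilon>: "0 < \<epsilon>" and t: "0 \<le> t"
  shows "AE \<omega> in M. \<forall>j. X \<epsilon> j t \<omega> = exp (- \<gamma> j * t) * x j + sqrt \<epsilon> * (a j * (1 - exp (- \<gamma> j * t)) / \<gamma> j + I j t \<omega>)"
proof (subst AE_all_countable, intro allI)
  fix j
  have "AE \<omega> in M. cadlag (\<lambda>t. X \<epsilon> j t \<omega>) \<and>
        (\<forall>t\<ge>0. X \<epsilon> j t \<omega> = x j - \<gamma> j * (LBINT s:{0..t}. X \<epsilon> j s \<omega>) + sqrt \<epsilon> * \<xi> j t \<omega>)"
    using X[OF \<epsilon>, of j] by (simp add: OU_solution_def)
  moreover have "AE \<omega> in M. \<xi> j 0 \<omega> = 0 \<and> cadlag (\<lambda>t. \<xi> j t \<omega>)"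
    using levy[of j] by (simp add: levy_process_with_def levy_process_def)
  ultimately show "AE \<omega> in M. X \<epsilon> j t \<omega> = exp (- \<gamma> j * t) * x j + sqrt \<epsilon> * (a j * (1 - exp (- \<gamma> j * t)) / \<gamma> j + I j t \<omega>)"
    using RS_integral[OF t, of j]
  proof eventually_elim
    case (elim \<omega>)
    then show ?case
      by (intro OU_explicit[where X="\<lambda>t. X \<epsilon> j t \<omega>" and \<xi>="\<lambda>t. \<xi> j t \<omega>"] t \<gamma>_pos) auto
  qed
qed

lemma superposition_X:
  assumes \<epsilon>: "0 < \<epsilon>" and t: "0 \<le> t"
  shows "AE \<omega> in M. summable (\<lambda>j. m j * X \<epsilon> j t \<omega>) \<and>
     superposition m (X \<epsilon>) t \<omega> = (start t + sqrt \<epsilon> * drift t) + sqrt \<epsilon> * superposition m I t \<omega>"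
  using X_explicit[OF \<epsilon> t] I_summable[OF t]
proof eventually_elim
  case (elim \<omega>)
  let ?f = "\<lambda>j. m j * (exp (- \<gamma> j * t) * x j)" and ?g = "\<lambda>j. m j * (a j * (1 - exp (- \<gamma> j * t)) / \<gamma> j)"
  have eq: "m j * X \<epsilon> j t \<omega> = (?f j + sqrt \<epsilon> * ?g j) + sqrt \<epsilon> * (m j * I j t \<omega>)" for j
    using elim(1) by (simp add: algebra_simps)
  have "(\<lambda>j. (?f j + sqrt \<epsilon> * ?g j) + sqrt \<epsilon> * (m j * I j t \<omega>)) sums
     ((start t + sqrt \<epsilon> * drift t) + sqrt \<epsilon> * superposition m I t \<omega>)"
    unfolding start_def drift_def superposition_def
    by (intro sums_add sums_mult summable_sums start_summable drift_summable elim t)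
  then have "(\<lambda>j. m j * X \<epsilon> j t \<omega>) sums ((start t + sqrt \<epsilon> * drift t) + sqrt \<epsilon> * superposition m I t \<omega>)"
    by (simp add: eq)
  then show ?case by (auto simp: superposition_def sums_iff)
qed

lemma law_X:
  assumes \<epsilon>: "0 < \<epsilon>" and t: "0 \<le> t"
  shows "superposition_law M m (X \<epsilon>) t = distr (law_I t) borel (\<lambda>y. (start t + sqrt \<epsilon> * drift t) + sqrt \<epsilon> * y)"
proof -
  note [measurable] = superposition_I_measurable[OF t]
  have "X \<epsilon> j t \<in> borel_measurable M" for j
    using X[OF \<epsilon>, of j] t by (simp add: OU_solution_def)
  then have [measurable]: "superposition m (X \<epsilon>) t \<in> borel_measurable M"
    unfolding superposition_def[abs_def] by measurable
  have "superposition_law M m (X \<epsilon>) t = distr M borel (\<lambda>\<omega>. (start t + sqrt \<epsilon> * drift t) + sqrt \<epsilon> * superposition m I t \<omega>)"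
    unfolding superposition_law_def
    by (rule distr_cong_AE) (use superposition_X[OF \<epsilon> t] in \<open>auto elim: eventually_mono\<close>)
  then show ?thesis
    by (simp add: superposition_law_def distr_distr comp_def)
qed

lemma law_X_limit:
  assumes \<epsilon>: "0 < \<epsilon>"
  shows "converges_in_law (superposition_law M m (X \<epsilon>)) (distr (limit_law law_I) borel (\<lambda>y. sqrt \<epsilon> * drift_lim + sqrt \<epsilon> * y))"
    and "limit_law (superposition_law M m (X \<epsilon>)) = distr (limit_law law_I) borel (\<lambda>y. sqrt \<epsilon> * drift_lim + sqrt \<epsilon> * y)"
proof -
  have rdX: "real_distribution (superposition_law M m (X \<epsilon>) t)" if "0 \<le> t" for t
    unfolding law_X[OF \<epsilon> that] by (intro real_distribution_distr_real real_distribution_law_I that) simp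
  show *: "converges_in_law (superposition_law M m (X \<epsilon>)) (distr (limit_law law_I) borel (\<lambda>y. sqrt \<epsilon> * drift_lim + sqrt \<epsilon> * y))"
  proof (rule converges_in_lawI)
    fix s :: "nat \<Rightarrow> real" and z :: real assume s: "\<And>n. 0 \<le> s n" "filterlim s at_top sequentially"
    have "(\<lambda>n. iexp ((start (s n) + sqrt \<epsilon> * drift (s n)) * z) * char (law_I (s n)) (sqrt \<epsilon> * z))
      \<longlonglongrightarrow> iexp ((0 + sqrt \<epsilon> * drift_lim) * z) * char (limit_law law_I) (sqrt \<epsilon> * z)"
      by (intro tendsto_intros char_law_I_tendsto s start_tendsto drift_tendsto)
    then show "(\<lambda>n. char (superposition_law M m (X \<epsilon>) (s n)) z)
      \<longlonglongrightarrow> char (distr (limit_law law_I) borel (\<lambda>y. sqrt \<epsilon> * drift_lim + sqrt \<epsilon> * y)) z"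
      by (simp add: law_X[OF \<epsilon> s(1)] real_distribution_limit_I char_distr_affine real_distribution_law_I s(1))
  qed (auto intro!: real_distribution_distr_real rdX real_distribution_limit_I)
  show "limit_law (superposition_law M m (X \<epsilon>)) = distr (limit_law law_I) borel (\<lambda>y. sqrt \<epsilon> * drift_lim + sqrt \<epsilon> * y)"
    by (rule limit_law_eqI[OF * rdX])
qed

text \<open>Both laws are images under the same affine map \<open>?T\<close>. Factoring it out
  cancels the scale of the noise, enlarges the initial condition to
  \<open>start t / sqrt \<epsilon>\<close> and leaves the unfinished part of the drift.\<close>

lemma dist_to_equilibrium_X:
  assumes \<epsilon>: "0 < \<epsilon>" and t: "0 \<le> t"
  shows "dist_to_equilibrium M m (X \<epsilon>) t =
    tv_dist (distr (law_I t) borel (\<lambda>y. (start t / sqrt \<epsilon> + (drift t - drift_lim)) + y)) (limit_law law_I)"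
proof -
  let ?L = "limit_law law_I"
  let ?T = "\<lambda>y. sqrt \<epsilon> * drift_lim + sqrt \<epsilon> * y" and ?b = "start t / sqrt \<epsilon> + (drift t - drift_lim)"
  interpret D: real_distribution "law_I t" by (rule real_distribution_law_I[OF t])
  have "distr (law_I t) borel (\<lambda>y. (start t + sqrt \<epsilon> * drift t) + sqrt \<epsilon> * y) = distr (distr (law_I t) borel (\<lambda>y. ?b + y)) borel ?T"
    using \<epsilon> by (subst distr_distr) (auto simp: comp_def algebra_simps)
  then have "dist_to_equilibrium M m (X \<epsilon>) t = tv_dist (distr (distr (law_I t) borel (\<lambda>y. ?b + y)) borel ?T) (distr ?L borel ?T)"
    by (simp add: dist_to_equilibrium_def law_X[OF \<epsilon> t] law_X_limit[OF \<epsilon>])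
  also have "\<dots> = tv_dist (distr (law_I t) borel (\<lambda>y. ?b + y)) ?L"
    by (rule tv_dist_distr_inverse[where T'="\<lambda>y. (y - sqrt \<epsilon> * drift_lim) / sqrt \<epsilon>"])
       (use \<epsilon> in \<open>auto intro!: real_distribution_distr_real real_distribution_law_I t real_distribution_limit_I\<close>)
  finally show ?thesis .
qed

text \<open>After multiplication by \<open>exp (g * t)\<close>, terms with rate \<open>g\<close> are
  constant in time and faster ones die out. Domination by \<open>m j * \<bar>x j\<bar>\<close>
  allows the termwise limit even if the rates accumulate at \<open>g\<close>.\<close>

lemma scaled_start_tendsto:
  assumes g: "\<And>j. g \<le> \<gamma> j" and s: "\<And>n. 0 \<le> s n" "filterlim s at_top sequentially"
  shows "(\<lambda>n. exp (g * s n) * start (s n)) \<longlonglongrightarrow> (\<Sum>\<^sub>\<infinity>j\<in>{j. \<gamma> j = g}. m j * x j)"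
proof -
  let ?f = "\<lambda>j. if \<gamma> j = g then m j * x j else 0"
  have bound: "norm (m j * (exp (- (\<gamma> j - g) * u) * x j)) \<le> m j * \<bar>x j\<bar>" if "0 \<le> u" for u j
  proof -
    have "exp (- (\<gamma> j - g) * u) \<le> 1" using g[of j] that by (simp add: mult_nonpos_nonneg)
    then have "m j * (exp (- (\<gamma> j - g) * u) * \<bar>x j\<bar>) \<le> m j * (1 * \<bar>x j\<bar>)"
      using m_pos[of j] by (intro mult_left_mono mult_right_mono) auto
    then show ?thesis using m_pos[of j] by (simp add: abs_mult)
  qed
  have "(\<lambda>n. \<Sum>j. m j * (exp (- (\<gamma> j - g) * s n) * x j)) \<longlonglongrightarrow> (\<Sum>j. ?f j)"
  proof (rule tannery[OF _ _ a])
    fix j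
    show "(\<lambda>n. m j * (exp (- (\<gamma> j - g) * s n) * x j)) \<longlonglongrightarrow> ?f j"
    proof (cases "\<gamma> j = g")
      case False
      then have "0 < \<gamma> j - g" using g[of j] by simp
      then have "(\<lambda>n. m j * (exp (- (\<gamma> j - g) * s n) * x j)) \<longlonglongrightarrow> m j * (0 * x j)"
        by (intro tendsto_intros exp_decay_tendsto s)
      then show ?thesis using False by simp
    qed simp
  qed (use bound s in auto)
  moreover have "exp (g * u) * start u = (\<Sum>j. m j * (exp (- (\<gamma> j - g) * u) * x j))" if "0 \<le> u" for u
    unfolding start_def using start_summable[OF that]
    by (subst suminf_mult[symmetric]) (auto intro!: suminf_cong simp: algebra_simps exp_diff exp_minus exp_add divide_simps)
  \<comment> \<open>Absolute summability identifies the ordered series with the unordered sum over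
    the set of slowest rates, be it finite or infinite.\<close>
  moreover have "(\<Sum>j. ?f j) = (\<Sum>\<^sub>\<infinity>j\<in>{j. \<gamma> j = g}. m j * x j)"
  proof -
    have sn: "summable (\<lambda>j. norm (?f j))"
      by (rule summable_comparison_test[OF _ a]) (use m_pos in \<open>auto simp: abs_mult less_imp_le\<close>)
    have "(?f has_sum (\<Sum>j. ?f j)) UNIV"
      by (rule norm_summable_imp_has_sum[OF sn summable_sums[OF summable_norm_cancel[OF sn]]])
    then have "(\<Sum>\<^sub>\<infinity>j. ?f j) = (\<Sum>j. ?f j)" by (rule infsumI)
    moreover have "(\<Sum>\<^sub>\<infinity>j. ?f j) = (\<Sum>\<^sub>\<infinity>j\<in>{j. \<gamma> j = g}. m j * x j)"
      by (rule infsum_cong_neutral) auto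
    ultimately show ?thesis by simp
  qed
  ultimately show ?thesis using s(1) by simp
qed

end

section \<open>Cut-off time, window and profile\<close>

theorem theorem3p2:
  fixes M :: "'a measure"
    and \<xi> I :: "nat \<Rightarrow> real \<Rightarrow> 'a \<Rightarrow> real"
    and X :: "real \<Rightarrow> nat \<Rightarrow> real \<Rightarrow> 'a \<Rightarrow> real"
    and a \<sigma> \<gamma> m x :: "nat \<Rightarrow> real"
    and \<pi> :: "nat \<Rightarrow> real measure"
    and r w :: "real \<Rightarrow> real"
  assumes levy: "\<And>j. levy_process_with M (\<xi> j) (a j) (\<sigma> j) (\<pi> j)"
    and indep: "indep_processes M \<xi>"
    and \<gamma>_pos: "\<And>j. 0 < \<gamma> j"
    and m_pos: "\<And>j. 0 < m j"
    and m_sum: "m sums 1"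
    and X: "\<And>\<epsilon> j. 0 < \<epsilon> \<Longrightarrow> OU_solution M (\<xi> j) (\<gamma> j) (x j) \<epsilon> (X \<epsilon> j)"
    and I: "\<And>j. levy_OU_integral M (\<lambda>t \<omega>. \<xi> j t \<omega> - a j * t) (\<gamma> j) (I j)"
    and a: "summable (\<lambda>j. m j * \<bar>x j\<bar>)"
    and b1: "summable (\<lambda>j. m j * \<bar>a j\<bar> / \<gamma> j)"
    and b2: "summable (\<lambda>j. (m j)\<^sup>2 * \<sigma> j / \<gamma> j)"
    and c1: "(\<Sum>j. ennreal ((m j)\<^sup>2 / \<gamma> j) * (\<integral>\<^sup>+z\<in>{-1..1}. ennreal (z\<^sup>2) \<partial>\<pi> j)) < \<infinity>"
    and c2: "(\<Sum>j. ennreal (m j / \<gamma> j) * emeasure (\<pi> j) (- {-1..1})) < \<infinity>"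
    and d: "(\<Sum>j. ennreal (1 / \<gamma> j) * (\<integral>\<^sup>+z\<in>- {-1..1}. ennreal (ln \<bar>z\<bar>) \<partial>\<pi> j)) < \<infinity>"
    and e: "\<exists>j. condition_H (\<lambda>t. distr M borel (I j t))"
    and f: "\<exists>g>0. \<forall>j. g \<le> \<gamma> j"
    and g1: "slowest \<gamma> \<noteq> {}"
    and g2: "(\<Sum>\<^sub>\<infinity>j\<in>slowest \<gamma>. m j * x j) \<noteq> 0"
    and r: "(r \<longlongrightarrow> 0) (at_right 0)"
    and w: "\<And>\<epsilon>. w \<epsilon> = 1 / min_rate \<gamma> + r \<epsilon>"
  shows "let L = limit_law (superposition_law M m I);
             G = (\<lambda>c. tv_dist (distr L borel
                   (\<lambda>y. exp (- c) * (\<Sum>\<^sub>\<infinity>j\<in>slowest \<gamma>. m j * x j) + y)) L)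
         in (\<forall>\<epsilon>>0. well_posed M m (X \<epsilon>)) \<and> well_posed M m I \<and>
            (\<forall>c. G c \<in> {0..1}) \<and>
            profile_cutoff (\<lambda>\<epsilon>. dist_to_equilibrium M m (X \<epsilon>))
              (\<lambda>\<epsilon>. 1 / (2 * min_rate \<gamma>) * ln (1 / \<epsilon>)) w G"
proof -
  interpret OU_superposition_solution M \<xi> I a \<sigma> \<gamma> m \<pi> X x
    by unfold_locales fact+
  define g where "g = min_rate \<gamma>"
  define S where "S = (\<Sum>\<^sub>\<infinity>j\<in>slowest \<gamma>. m j * x j)"
  define L where "L = limit_law law_I"
  define G where "G c = tv_dist (distr L borel (\<lambda>y. exp (- c) * S + y)) L" for c
  define t where "t \<epsilon> = 1 / (2 * g) * ln (1 / \<epsilon>)" for \<epsilon>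
  \<comment> \<open>The infimum of the rates is attained by some \<open>\<gamma> j\<close>, hence
    positive.\<close>
  have g_pos: "0 < g"
  proof -
    obtain j where "\<gamma> j = g" using g1 by (auto simp: slowest_def g_def)
    then show ?thesis using \<gamma>_pos[of j] by simp
  qed
  have g_le: "g \<le> \<gamma> j" for j
    unfolding g_def min_rate_def
    by (rule cINF_lower) (use \<gamma>_pos in \<open>auto intro!: bdd_belowI[of _ 0] less_imp_le\<close>)
  have S_eq: "S = (\<Sum>\<^sub>\<infinity>j\<in>{j. \<gamma> j = g}. m j * x j)"
    by (simp add: S_def slowest_def g_def)
  obtain k where H: "condition_H (\<lambda>t. distr M borel (I k t))" using e by blast
  have rdL: "real_distribution L" unfolding L_def by (rule real_distribution_limit_I)
  \<comment> \<open>Integrability of \<open>char L\<close> involves no times, so any sequence of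
    positive times tending to infinity, with a constant shift, will do.\<close>
  have intL: "integrable lborel (char L)"
    by (rule shifted_law_I_tendsto(2)[OF H _ _ tendsto_const L_def, of "\<lambda>n. real n + 1"]) (real_asymp, simp)
  have wpX: "well_posed M m (X \<epsilon>)" if "0 < \<epsilon>" for \<epsilon>
    unfolding well_posed_def
    using superposition_X[OF that] law_X_limit(1)[OF that] by (auto elim!: eventually_mono)
  have wpI: "well_posed M m I"
    unfolding well_posed_def using I_summable converges_in_law_I by auto
  have rdS: "real_distribution (distr L borel (\<lambda>y. b + y))" for b
    by (intro real_distribution_distr_real rdL) simp
  have G01: "G c \<in> {0..1}" for c
    unfolding G_def using tv_dist_nonneg[OF rdS rdL] tv_dist_le_1[OF rdS rdL] by simp
  have t_lim: "filterlim t at_top (at_right 0)"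
    unfolding t_def using g_pos by real_asymp
  have w_lim: "(w \<longlongrightarrow> 1 / g) (at_right 0)"
  proof -
    have "((\<lambda>\<epsilon>. 1 / g + r \<epsilon>) \<longlongrightarrow> 1 / g + 0) (at_right 0)"
      by (intro tendsto_intros r)
    moreover have "w = (\<lambda>\<epsilon>. 1 / g + r \<epsilon>)" by (simp add: fun_eq_iff w g_def)
    ultimately show ?thesis by simp
  qed
  have w_small: "w \<in> o[at_right 0](t)"
  proof (rule smalloI_tendsto)
    show "((\<lambda>\<epsilon>. w \<epsilon> / t \<epsilon>) \<longlongrightarrow> 0) (at_right 0)"
      by (rule tendsto_divide_0[OF w_lim filterlim_at_top_imp_at_infinity[OF t_lim]])
    have "\<forall>\<^sub>F \<epsilon> in at_right 0. 0 < t \<epsilon>"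
      using t_lim by (simp add: filterlim_at_top_dense)
    then show "\<forall>\<^sub>F \<epsilon> in at_right 0. t \<epsilon> \<noteq> 0"
      by eventually_elim simp
  qed
  have profile: "((\<lambda>\<epsilon>. dist_to_equilibrium M m (X \<epsilon>) (t \<epsilon> + c * w \<epsilon>)) \<longlongrightarrow> G c) (at_right 0)" for c
    unfolding tendsto_at_iff_sequentially comp_def
  proof (intro allI impI)
    fix E :: "nat \<Rightarrow> real" assume "\<forall>i. E i \<in> {0<..} - {0}" and E0: "E \<longlonglongrightarrow> 0"
    then have E: "0 < E n" for n by auto
    have Er: "filterlim E (at_right 0) sequentially"
      by (rule tendsto_imp_filterlim_at_right[OF E0]) (simp add: E)
    define T where "T n = t (E n) + c * w (E n)" for n
    \<comment> \<open>The convergence results ask for positive times at every index, while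
      \<open>T n\<close> may be negative for small \<open>n\<close>. The truncation changes only
      finitely many terms.\<close>
    define s where "s n = max 1 (T n)" for n
    have tE: "filterlim (\<lambda>n. t (E n)) at_top sequentially"
      by (rule filterlim_compose[OF t_lim Er])
    have wE: "(\<lambda>n. w (E n)) \<longlonglongrightarrow> 1 / g"
      by (rule filterlim_compose[OF w_lim Er])
    have "filterlim (\<lambda>n. c * w (E n) + t (E n)) at_top sequentially"
      by (rule filterlim_tendsto_add_at_top[OF tendsto_mult[OF tendsto_const wE] tE])
    then have T: "filterlim T at_top sequentially"
      by (simp add: T_def[abs_def] add.commute)
    then have "\<forall>\<^sub>F n in sequentially. 1 \<le> T n" by (simp add: filterlim_at_top)
    then have sT: "\<forall>\<^sub>F n in sequentially. s n = T n"
      by eventually_elim (simp add: s_def)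
    have s: "filterlim s at_top sequentially"
      by (rule filterlim_at_top_mono[OF T]) (simp add: s_def)
    have s_pos: "0 < s n" for n by (simp add: s_def)
    have s_nonneg: "0 \<le> s n" for n using s_pos[of n] by simp
    define b where "b n = start (s n) / sqrt (E n) + (drift (s n) - drift_lim)" for n
    have "(\<lambda>n. exp (- (g * c * w (E n)))) \<longlonglongrightarrow> exp (- (g * c * (1 / g)))"
      by (intro tendsto_intros wE)
    \<comment> \<open>The choice of \<open>t\<close> is calibrated to give
      \<open>exp (- (g * t \<epsilon>)) = sqrt \<epsilon>\<close>, so only the window term survives;
      with \<open>w\<close> tending to \<open>1 / g\<close> the limit is
      \<open>exp (- c)\<close>.\<close>
    moreover have "exp (- (g * T n)) / sqrt (E n) = exp (- (g * c * w (E n)))" for n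
    proof -
      have "- (g * T n) = ln (sqrt (E n)) + - (g * c * w (E n))"
        using g_pos E[of n] by (simp add: T_def t_def ln_sqrt ln_div algebra_simps)
      then show ?thesis using E[of n] by (simp only: exp_add exp_ln real_sqrt_gt_0_iff) simp
    qed
    ultimately have "(\<lambda>n. exp (- (g * T n)) / sqrt (E n)) \<longlonglongrightarrow> exp (- c)"
      using g_pos by simp
    then have scale: "(\<lambda>n. exp (- (g * s n)) / sqrt (E n)) \<longlonglongrightarrow> exp (- c)"
      by (rule Lim_transform_eventually) (use sT in \<open>auto elim: eventually_mono\<close>)
    \<comment> \<open>The shift is split into a calibrated factor tending to
      \<open>exp (- c)\<close>, the rescaled initial condition tending to \<open>S\<close>, and a
      drift error tending to 0.\<close>
    have "(\<lambda>n. exp (- (g * s n)) / sqrt (E n) * (exp (g * s n) * start (s n)) + (drift (s n) - drift_lim))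
      \<longlonglongrightarrow> exp (- c) * S + (drift_lim - drift_lim)"
      unfolding S_eq
      by (intro tendsto_intros scale scaled_start_tendsto drift_tendsto g_le s s_nonneg)
    moreover have "exp (- (g * s n)) / sqrt (E n) * (exp (g * s n) * start (s n)) = start (s n) / sqrt (E n)" for n
      using E[of n] by (simp add: exp_minus field_simps)
    ultimately have b: "b \<longlonglongrightarrow> exp (- c) * S"
      by (simp only: b_def[abs_def]) simp
    have "(\<lambda>n. tv_dist (distr (law_I (s n)) borel (\<lambda>y. b n + y)) L) \<longlonglongrightarrow> G c"
      unfolding G_def by (rule shifted_law_I_tendsto(1)[OF H s s_pos b L_def])
    also have "(\<lambda>n. tv_dist (distr (law_I (s n)) borel (\<lambda>y. b n + y)) L) = (\<lambda>n. dist_to_equilibrium M m (X (E n)) (s n))"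
      unfolding b_def L_def dist_to_equilibrium_X[OF E s_nonneg] ..
    finally show "(\<lambda>n. dist_to_equilibrium M m (X (E n)) (t (E n) + c * w (E n))) \<longlonglongrightarrow> G c"
      by (rule Lim_transform_eventually) (use sT in \<open>auto simp: T_def elim: eventually_mono\<close>)
  qed
  \<comment> \<open>Here \<open>S \<noteq> 0\<close> is essential: only then does the shift
    \<open>exp (- c) * S\<close> become unbounded as \<open>c\<close> tends to minus
    infinity.\<close>
  have G_bot: "(G \<longlongrightarrow> 1) at_bot"
    unfolding G_def
  proof (rule tv_dist_shift_at_infinity[OF rdL])
    have "0 < \<bar>S\<bar>" using g2 by (simp add: S_def)
    then have "filterlim (\<lambda>c. exp (- c) * \<bar>S\<bar>) at_top at_bot" by real_asymp
    then show "filterlim (\<lambda>c. \<bar>exp (- c) * S\<bar>) at_top at_bot" by (simp add: abs_mult)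
  qed
  have G_top: "(G \<longlongrightarrow> 0) at_top"
  proof (rule tendsto_at_topI_sequentially)
    fix C :: "nat \<Rightarrow> real" assume C: "filterlim C at_top sequentially"
    have "(\<lambda>n. exp (- 1 * C n) * S) \<longlonglongrightarrow> 0 * S"
      by (intro tendsto_intros exp_decay_tendsto C) simp
    then show "(\<lambda>n. G (C n)) \<longlonglongrightarrow> 0"
      unfolding G_def by (intro tv_dist_shift_to_0 rdL intL) simp
  qed
  have "profile_cutoff (\<lambda>\<epsilon>. dist_to_equilibrium M m (X \<epsilon>)) t w G"
    unfolding profile_cutoff_def using t_lim w_small profile G_bot G_top by blast
  then show ?thesis
    using wpX wpI G01
    unfolding Let_def G_def[abs_def] t_def[abs_def] L_def g_def S_def by blast
qed

end
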